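(* Let $\mathfrak g$ be a complex simple Lie algebra of type $B_l$ and let $I\subset\Pi$ be of cardinality $r$. Then $$\sharp\mathcal F_I^{ab}=\begin{cases}\displaystyle 2^{l-r}+\sum_{j=1}^n2\binom{l-r-1}{l_j-1}&\text{if }\alpha_1\notin I,\\[2mm]\displaystyle 2^{l-r-1}+\sum_{j=1}^n\binom{l-r-1}{l_j-1}&\text{if }\alpha_1\in I,\end{cases}$$ where $n=s$ if $\alpha_l\notin I$ and $n=s-1$ if $\alpha_l\in I$.
   Context: $\Delta$ is the root system of $\mathfrak g$ with respect to a Cartan subalgebra $\mathfrak h$, $\Delta^+$ the positive roots, $\Pi=\{\alpha_1,\dots,\alpha_l\}$ the simple roots numbered along the Dynkin diagram of type $B_l$ with $\alpha_l$ the short simple root, $\mathfrak g_\alpha$ the root spaces. For $I\subset\Pi$, $\Delta_I=\mathbb ZI\cap\Delta$, $\mathfrak p_I=\mathfrak h\oplus\bigoplus_{\alpha\in\Delta_I\cup\Delta^+}\mathfrak g_\alpha$, $\mathcal F_I=\{\Phi\subset\Delta^+\setminus\Delta_I:\ \alpha\in\Phi,\ \beta\in\Delta^+\cup\Delta_I,\ \alpha+\beta\in\Delta^+\Rightarrow\alpha+\beta\in\Phi\}$ and, for $\Phi\in\mathcal F_I$, $\mathfrak i_\Phi=\bigoplus_{\alpha\in\Phi}\mathfrak g_\alpha$ (an ad-nilpotent ideal of $\mathfrak p_I$). $\mathcal F_I^{ab}=\{\Phi\in\mathcal F_I:\mathfrak i_\Phi\text{ is abelian}\}$. $I_1,\dots,I_s$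 are the connected components of $I$ in the Dynkin diagram, $r_j=\sharp I_j$, $m_j=\min\{i:\alpha_i\in I_j\}$, ordered so that $m_1<\dots<m_s$ ($s=0$ if $I=\emptyset$), and $l_j=m_j-\sum_{k=1}^{j-1}r_k$. As usual $\binom ab=0$ if $b>a\ge0$.
   Formalization: For I = Π (so r = l, n = 0) the printed formula gives 2^{-1}, while the only abelian ideal is the zero one, so the count is 1; here the exponent l−r−1 is read as 0 in that single case. All other I are as stated. *)

theory Defs
  imports Complex_Main "HOL-Library.Function_Algebras"
begin

text \<open>A complex Lie algebra is carried by a whole type \<^typ>\<open>'g\<close>, with scalar multiplication
  \<open>scale\<close> and bracket \<open>br\<close>.\<close>

locale complex_lie_algebra = vector_space scale
  for scale :: "complex \<Rightarrow> 'g::ab_group_add \<Rightarrow> 'g" +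
  fixes br :: "'g \<Rightarrow> 'g \<Rightarrow> 'g"
  assumes br_add_left: "br (x + y) z = br x z + br y z"
    and br_add_right: "br x (y + z) = br x y + br x z"
    and br_scale_left: "br (scale c x) y = scale c (br x y)"
    and br_scale_right: "br x (scale c y) = scale c (br x y)"
    and br_self: "br x x = 0"
    and br_jacobi: "br x (br y z) + br y (br z x) + br z (br x y) = 0"

definition lie_abelian :: "('g::ab_group_add \<Rightarrow> 'g \<Rightarrow> 'g) \<Rightarrow> 'g set \<Rightarrow> bool" where
  "lie_abelian br S \<longleftrightarrow> (\<forall>x\<in>S. \<forall>y\<in>S. br x y = 0)"

definition lie_ideal ::
  "(complex \<Rightarrow> 'g::ab_group_add \<Rightarrow> 'g) \<Rightarrow> ('g \<Rightarrow> 'g \<Rightarrow> 'g) \<Rightarrow> 'g set \<Rightarrow> bool" where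
  "lie_ideal scale br J \<longleftrightarrow> module.subspace scale J \<and> (\<forall>x. \<forall>y\<in>J. br x y \<in> J)"

locale complex_simple_lie_algebra = complex_lie_algebra scale br
  for scale :: "complex \<Rightarrow> 'g::ab_group_add \<Rightarrow> 'g" and br :: "'g \<Rightarrow> 'g \<Rightarrow> 'g" +
  assumes finite_dim: "\<exists>B. finite B \<and> span B = UNIV"
    and not_abelian: "\<not> lie_abelian br UNIV"
    and ideals_trivial: "lie_ideal scale br J \<Longrightarrow> J = {0} \<or> J = UNIV"

definition ad_diagonalizable ::
  "(complex \<Rightarrow> 'g::ab_group_add \<Rightarrow> 'g) \<Rightarrow> ('g \<Rightarrow> 'g \<Rightarrow> 'g) \<Rightarrow> 'g \<Rightarrow> bool" where
  "ad_diagonalizable scale br h \<longleftrightarrow>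
     (\<exists>B. \<not> module.dependent scale B \<and> module.span scale B = UNIV \<and>
          (\<forall>x\<in>B. \<exists>c. br h x = scale c x))"

text \<open>Cartan subalgebra of a complex semisimple Lie algebra: an abelian subalgebra that is its own
  centralizer and acts diagonalizably in the adjoint representation.\<close>

definition cartan_subalgebra ::
  "(complex \<Rightarrow> 'g::ab_group_add \<Rightarrow> 'g) \<Rightarrow> ('g \<Rightarrow> 'g \<Rightarrow> 'g) \<Rightarrow> 'g set \<Rightarrow> bool" where
  "cartan_subalgebra scale br H \<longleftrightarrow>
     module.subspace scale H \<and> lie_abelian br H \<and>
     (\<forall>x. (\<forall>h\<in>H. br h x = 0) \<longrightarrow> x \<in> H) \<and>
     (\<forall>h\<in>H. ad_diagonalizable scale br h)"

text \<open>A linear functional on the subspace \<open>H\<close> is represented by the function on \<^typ>\<open>'g\<close> that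
  vanishes outside \<open>H\<close> (this extension is not linear on the whole of \<^typ>\<open>'g\<close>).  The representation
  is unique and compatible with pointwise sums and scalar multiples, so equations between functionals
  on \<open>H\<close> are equations between functions.\<close>

definition dual_on ::
  "(complex \<Rightarrow> 'g::ab_group_add \<Rightarrow> 'g) \<Rightarrow> 'g set \<Rightarrow> ('g \<Rightarrow> complex) set" where
  "dual_on scale H =
     {\<alpha>. (\<forall>x\<in>H. \<forall>y\<in>H. \<alpha> (x + y) = \<alpha> x + \<alpha> y) \<and>
         (\<forall>c. \<forall>x\<in>H. \<alpha> (scale c x) = c * \<alpha> x) \<and>
         (\<forall>x. x \<notin> H \<longrightarrow> \<alpha> x = 0)}"

definition root_space ::
  "(complex \<Rightarrow> 'g::ab_group_add \<Rightarrow> 'g) \<Rightarrow> ('g \<Rightarrow> 'g \<Rightarrow> 'g) \<Rightarrow> 'g set \<Rightarrow> ('g \<Rightarrow> complex) \<Rightarrow> 'g set" where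
  "root_space scale br H \<alpha> = {x. \<forall>h\<in>H. br h x = scale (\<alpha> h) x}"

definition roots ::
  "(complex \<Rightarrow> 'g::ab_group_add \<Rightarrow> 'g) \<Rightarrow> ('g \<Rightarrow> 'g \<Rightarrow> 'g) \<Rightarrow> 'g set \<Rightarrow> ('g \<Rightarrow> complex) set" where
  "roots scale br H = {\<alpha> \<in> dual_on scale H. \<alpha> \<noteq> 0 \<and> root_space scale br H \<alpha> \<noteq> {0}}"

text \<open>\<open>h\<close> is the coroot of \<open>\<alpha>\<close>, i.e. the element of \<open>[g\<^sub>\<alpha>, g\<^sub>-\<^sub>\<alpha>]\<close> with \<open>\<alpha>(h) = 2\<close>; for
  \<open>h\<close> the coroot of \<open>\<alpha>\<close>, the number \<open>\<beta>(h)\<close> is the Cartan integer \<open>2(\<beta>,\<alpha>)/(\<alpha>,\<alpha>)\<close>.\<close>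

definition is_coroot ::
  "(complex \<Rightarrow> 'g::ab_group_add \<Rightarrow> 'g) \<Rightarrow> ('g \<Rightarrow> 'g \<Rightarrow> 'g) \<Rightarrow> 'g set \<Rightarrow> ('g \<Rightarrow> complex) \<Rightarrow> 'g \<Rightarrow> bool" where
  "is_coroot scale br H \<alpha> h \<longleftrightarrow>
     h \<in> H \<and>
     h \<in> module.span scale
            {br x y | x y. x \<in> root_space scale br H \<alpha> \<and> y \<in> root_space scale br H (- \<alpha>)} \<and>
     \<alpha> h = 2"

definition simple_system ::
  "(complex \<Rightarrow> 'g::ab_group_add \<Rightarrow> 'g) \<Rightarrow> ('g \<Rightarrow> 'g \<Rightarrow> 'g) \<Rightarrow> 'g set \<Rightarrow> nat \<Rightarrow>
   (nat \<Rightarrow> 'g \<Rightarrow> complex) \<Rightarrow> bool" where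
  "simple_system scale br H l \<alpha> \<longleftrightarrow>
     \<alpha> ` {1..l} \<subseteq> roots scale br H \<and>
     (\<forall>c :: nat \<Rightarrow> complex. (\<forall>x. (\<Sum>i=1..l. c i * \<alpha> i x) = 0) \<longrightarrow> (\<forall>i\<in>{1..l}. c i = 0)) \<and>
     (\<forall>\<beta> \<in> roots scale br H. \<exists>c :: nat \<Rightarrow> nat.
        \<beta> = (\<lambda>x. \<Sum>i=1..l. of_nat (c i) * \<alpha> i x) \<or>
        \<beta> = (\<lambda>x. - (\<Sum>i=1..l. of_nat (c i) * \<alpha> i x)))"

definition positive_roots ::
  "(complex \<Rightarrow> 'g::ab_group_add \<Rightarrow> 'g) \<Rightarrow> ('g \<Rightarrow> 'g \<Rightarrow> 'g) \<Rightarrow> 'g set \<Rightarrow> nat \<Rightarrow>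
   (nat \<Rightarrow> 'g \<Rightarrow> complex) \<Rightarrow> ('g \<Rightarrow> complex) set" where
  "positive_roots scale br H l \<alpha> =
     {\<beta> \<in> roots scale br H. \<exists>c :: nat \<Rightarrow> nat. \<beta> = (\<lambda>x. \<Sum>i=1..l. of_nat (c i) * \<alpha> i x)}"

text \<open>Entry \<open>(i, j)\<close> is the Cartan integer \<open>\<alpha>\<^sub>i(h\<^sub>j)\<close>, where \<open>h\<^sub>j\<close> is the coroot of \<open>\<alpha>\<^sub>j\<close>; the entry
  \<open>-2\<close> at \<open>(l - 1, l)\<close> makes \<open>\<alpha>\<^sub>l\<close> the short simple root.\<close>

definition cartan_matrix_B :: "nat \<Rightarrow> nat \<Rightarrow> nat \<Rightarrow> int" where
  "cartan_matrix_B l i j =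
     (if i = j then 2
      else if i + 1 = j \<and> j = l then - 2
      else if i + 1 = j \<or> j + 1 = i then - 1
      else 0)"

definition type_B ::
  "(complex \<Rightarrow> 'g::ab_group_add \<Rightarrow> 'g) \<Rightarrow> ('g \<Rightarrow> 'g \<Rightarrow> 'g) \<Rightarrow> 'g set \<Rightarrow> nat \<Rightarrow>
   (nat \<Rightarrow> 'g \<Rightarrow> complex) \<Rightarrow> bool" where
  "type_B scale br H l \<alpha> \<longleftrightarrow>
     (\<forall>j\<in>{1..l}. \<exists>h. is_coroot scale br H (\<alpha> j) h \<and>
        (\<forall>i\<in>{1..l}. \<alpha> i h = of_int (cartan_matrix_B l i j)))"

definition roots_gen ::
  "(complex \<Rightarrow> 'g::ab_group_add \<Rightarrow> 'g) \<Rightarrow> ('g \<Rightarrow> 'g \<Rightarrow> 'g) \<Rightarrow> 'g set \<Rightarrow>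
   ('g \<Rightarrow> complex) set \<Rightarrow> ('g \<Rightarrow> complex) set" where
  "roots_gen scale br H I =
     {\<lambda>x. \<Sum>\<gamma>\<in>I. of_int (c \<gamma>) * \<gamma> x | c :: ('g \<Rightarrow> complex) \<Rightarrow> int. True} \<inter> roots scale br H"

definition F_I ::
  "(complex \<Rightarrow> 'g::ab_group_add \<Rightarrow> 'g) \<Rightarrow> ('g \<Rightarrow> 'g \<Rightarrow> 'g) \<Rightarrow> 'g set \<Rightarrow> nat \<Rightarrow>
   (nat \<Rightarrow> 'g \<Rightarrow> complex) \<Rightarrow> ('g \<Rightarrow> complex) set \<Rightarrow> ('g \<Rightarrow> complex) set set" where
  "F_I scale br H l \<alpha> I =
     {\<Phi>. \<Phi> \<subseteq> positive_roots scale br H l \<alpha> - roots_gen scale br H I \<and>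
         (\<forall>\<beta>\<in>\<Phi>. \<forall>\<gamma> \<in> positive_roots scale br H l \<alpha> \<union> roots_gen scale br H I.
            \<beta> + \<gamma> \<in> positive_roots scale br H l \<alpha> \<longrightarrow> \<beta> + \<gamma> \<in> \<Phi>)}"

text \<open>Root spaces of distinct roots are linearly independent, so the span is the direct sum.\<close>

definition ideal_of ::
  "(complex \<Rightarrow> 'g::ab_group_add \<Rightarrow> 'g) \<Rightarrow> ('g \<Rightarrow> 'g \<Rightarrow> 'g) \<Rightarrow> 'g set \<Rightarrow>
   ('g \<Rightarrow> complex) set \<Rightarrow> 'g set" where
  "ideal_of scale br H \<Phi> = module.span scale (\<Union>\<beta>\<in>\<Phi>. root_space scale br H \<beta>)"

definition F_I_ab ::
  "(complex \<Rightarrow> 'g::ab_group_add \<Rightarrow> 'g) \<Rightarrow> ('g \<Rightarrow> 'g \<Rightarrow> 'g) \<Rightarrow> 'g set \<Rightarrow> nat \<Rightarrow>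
   (nat \<Rightarrow> 'g \<Rightarrow> complex) \<Rightarrow> ('g \<Rightarrow> complex) set \<Rightarrow> ('g \<Rightarrow> complex) set set" where
  "F_I_ab scale br H l \<alpha> I =
     {\<Phi> \<in> F_I scale br H l \<alpha> I. lie_abelian br (ideal_of scale br H \<Phi>)}"

text \<open>Distinct simple roots are joined in the Dynkin diagram iff their Cartan integer is nonzero.
  The components are the classes of the reachability relation of the subdiagram on \<open>I\<close>.\<close>

definition dynkin_edges ::
  "(complex \<Rightarrow> 'g::ab_group_add \<Rightarrow> 'g) \<Rightarrow> ('g \<Rightarrow> 'g \<Rightarrow> 'g) \<Rightarrow> 'g set \<Rightarrow>
   ('g \<Rightarrow> complex) set \<Rightarrow> (('g \<Rightarrow> complex) \<times> ('g \<Rightarrow> complex)) set" where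
  "dynkin_edges scale br H I =
     {(\<beta>, \<gamma>) \<in> I \<times> I. \<beta> \<noteq> \<gamma> \<and> (\<exists>h. is_coroot scale br H \<gamma> h \<and> \<beta> h \<noteq> 0)}"

definition dynkin_components ::
  "(complex \<Rightarrow> 'g::ab_group_add \<Rightarrow> 'g) \<Rightarrow> ('g \<Rightarrow> 'g \<Rightarrow> 'g) \<Rightarrow> 'g set \<Rightarrow>
   ('g \<Rightarrow> complex) set \<Rightarrow> ('g \<Rightarrow> complex) set set" where
  "dynkin_components scale br H I = I // (dynkin_edges scale br H I)\<^sup>*"

end

theory Submission
  imports Defs "HOL-Combinatorics.Permutations" "HOL-Library.Product_Plus"
begin

text \<open>
  Write the roots of type \<open>B\<^sub>l\<close> as \<open>\<plusminus>\<epsilon>\<^sub>i\<close> and \<open>\<plusminus>\<epsilon>\<^sub>i \<plusminus> \<epsilon>\<^sub>j\<close>, and cut \<open>1, \<dots>, l\<close> into blocks behind every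
  \<open>i\<close> with \<open>\<alpha>\<^sub>i \<notin> I\<close>; a component of \<open>I\<close> corresponds to a block with at least two elements, or to the
  block at the end that is not closed by a cut (which exists iff \<open>\<alpha>\<^sub>l \<in> I\<close>).  There are \<open>q = l - r\<close> cuts.

  An abelian ideal contains at most one short root, and this is \<open>\<epsilon>\<^sub>1\<close>, because \<open>\<epsilon>\<^sub>i + \<epsilon>\<^sub>j\<close> is a root and
  because \<open>\<epsilon>\<^sub>1\<close> is the largest short root.  If \<open>\<epsilon>\<^sub>1\<close> is absent, all roots of the ideal have the form
  \<open>\<epsilon>\<^sub>i + \<epsilon>\<^sub>j\<close>; stability under the Levi roots means that only the blocks of \<open>i\<close> and \<open>j\<close> matter, and the
  ideals correspond to the upper sets of the pairs \<open>x \<le> y \<le> q\<close> of blocks, where \<open>x = y\<close> is allowed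
  only for blocks with at least two elements.  Deciding whether the pair \<open>(1, q)\<close> is present gives Pascal's
  recursion, and hence (for \<open>q \<ge> 1\<close>) \<open>2\<^sup>q\<^sup>-\<^sup>1 + \<Sum> binom(q - 1, x - 1)\<close> upper sets, the sum being over the blocks \<open>x\<close> with at
  least two elements (lemma \<open>card_block_ideals\<close>).  The block number of the component \<open>I\<^sub>j\<close> is \<open>l\<^sub>j\<close> (lemma
  \<open>numbered_blocks\<close>).  If \<open>\<alpha>\<^sub>1 \<in> I\<close>, the root \<open>\<epsilon>\<^sub>1\<close> cannot occur, since \<open>\<epsilon>\<^sub>2\<close> would occur with it.  If
  \<open>\<alpha>\<^sub>1 \<notin> I\<close>, the ideals with \<open>\<epsilon>\<^sub>1\<close> are in bijection with those without: complete the row of the roots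
  \<open>\<epsilon>\<^sub>1 + \<epsilon>\<^sub>j\<close>, and add \<open>\<epsilon>\<^sub>1 - \<epsilon>\<^sub>j\<close> exactly when \<open>\<epsilon>\<^sub>1 + \<epsilon>\<^sub>j\<close> was absent.  This doubles the count (lemma
  \<open>card_ab_ideals\<close>).

  To get from the Lie algebra to this picture, one has to know the roots and which root spaces commute.
  Each coroot of a simple root belongs to an sl2 triple, and \<open>exp(ad e) exp(- ad f) exp(ad e)\<close> is an
  automorphism that realizes the simple reflection (lemma \<open>reflection\<close>).  So the set of roots, and the set
  of pairs of roots with nonzero bracket, are invariant under signed permutations of the coordinates.
  Since every root has simple coefficients of one sign and \<open>p \<alpha>\<^sub>i\<close> is no root for \<open>p \<ge> 2\<close>, the first
  invariance leaves only the known list of roots (lemma \<open>root_vecs_eq\<close>).  The second reduces the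
  brackets to one computation in an sl2 triple for each kind of pair.
\<close>

section \<open>Upper sets of shifted staircases\<close>

text \<open>The poset consists of the pairs \<open>a \<le> x \<le> y \<le> b\<close>, a pair being larger when both entries are smaller.
  It is a shifted staircase whose diagonal cells \<open>(x, x)\<close> are present only for \<open>x \<in> D\<close>.\<close>

definition upper_sets :: "nat set \<Rightarrow> nat \<Rightarrow> nat \<Rightarrow> (nat \<times> nat) set set" where
  "upper_sets D a b =
     {T. T \<subseteq> {(x, y). a \<le> x \<and> x \<le> y \<and> y \<le> b \<and> (x = y \<longrightarrow> x \<in> D)} \<and>
         (\<forall>x y x' y'. (x, y) \<in> T \<longrightarrow> a \<le> x' \<longrightarrow> x' \<le> y' \<longrightarrow> x' \<le> x \<longrightarrow> y' \<le> y \<longrightarrow>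
            (x' = y' \<longrightarrow> x' \<in> D) \<longrightarrow> (x', y') \<in> T)}"

lemma upper_setsI:
  assumes "\<And>x y. (x, y) \<in> T \<Longrightarrow> a \<le> x \<and> x \<le> y \<and> y \<le> b \<and> (x = y \<longrightarrow> x \<in> D)"
    and "\<And>x y x' y'. (x, y) \<in> T \<Longrightarrow> a \<le> x' \<Longrightarrow> x' \<le> y' \<Longrightarrow> x' \<le> x \<Longrightarrow> y' \<le> y \<Longrightarrow>
      (x' = y' \<longrightarrow> x' \<in> D) \<Longrightarrow> (x', y') \<in> T"
  shows "T \<in> upper_sets D a b"
  using assms unfolding upper_sets_def by blast

lemma upper_setsD:
  assumes "T \<in> upper_sets D a b" "(x, y) \<in> T"
  shows "a \<le> x" "x \<le> y" "y \<le> b" "x = y \<Longrightarrow> x \<in> D"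
  using assms unfolding upper_sets_def by auto

lemma upper_sets_closed:
  assumes "T \<in> upper_sets D a b" "(x, y) \<in> T" "a \<le> x'" "x' \<le> y'" "x' \<le> x" "y' \<le> y"
    "x' = y' \<Longrightarrow> x' \<in> D"
  shows "(x', y') \<in> T"
  using assms unfolding upper_sets_def by blast

lemma finite_upper_sets: "finite (upper_sets D a b)"
proof (rule finite_subset)
  show "upper_sets D a b \<subseteq> Pow ({a..b} \<times> {a..b})"
    by (auto simp: upper_sets_def)
qed simp

text \<open>An upper set without \<open>(a, b + 1)\<close> has no pair with second entry \<open>b + 1\<close>, since \<open>(a, b + 1)\<close> is the
  largest of these.  An upper set with \<open>(a, b + 1)\<close> contains the whole row of pairs with first entry \<open>a\<close>,
  and the remaining rows form an arbitrary upper set.  This is Pascal's recursion.\<close>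

lemma card_upper_sets_step:
  assumes "a \<le> b"
  shows "card (upper_sets D a (Suc b)) = card (upper_sets D a b) + card (upper_sets D (Suc a) (Suc b))"
proof -
  define row where "row = {(x, y). x = a \<and> a \<le> y \<and> y \<le> Suc b \<and> (y = a \<longrightarrow> a \<in> D)}"
  have split: "upper_sets D a (Suc b) = upper_sets D a b \<union> (\<lambda>T. row \<union> T) ` upper_sets D (Suc a) (Suc b)"
    (is "?L = ?A \<union> ?B")
  proof (intro equalityI subsetI)
    fix T assume T: "T \<in> ?L"
    show "T \<in> ?A \<union> ?B"
    proof (cases "(a, Suc b) \<in> T")
      case False
      have "T \<in> ?A"
      proof (rule upper_setsI)
        fix x y assume xy: "(x, y) \<in> T"
        have "y \<noteq> Suc b"
        proof
          assume "y = Suc b"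
          then have "(a, Suc b) \<in> T"
            using upper_setsD[OF T xy] \<open>y = Suc b\<close> assms by (auto intro: upper_sets_closed[OF T xy])
          with False show False by blast
        qed
        with upper_setsD[OF T xy] show "a \<le> x \<and> x \<le> y \<and> y \<le> b \<and> (x = y \<longrightarrow> x \<in> D)"
          by auto
      next
        fix x y x' y'
        assume "(x, y) \<in> T" "a \<le> x'" "x' \<le> y'" "x' \<le> x" "y' \<le> y" "x' = y' \<longrightarrow> x' \<in> D"
        then show "(x', y') \<in> T" using upper_sets_closed[OF T, of x y x' y'] by auto
      qed
      then show ?thesis by blast
    next
      case True
      have row: "row \<subseteq> T"
      proof
        fix p assume "p \<in> row"
        then obtain y where "p = (a, y)" "a \<le> y" "y \<le> Suc b" "y = a \<longrightarrow> a \<in> D"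
          by (auto simp: row_def)
        then show "p \<in> T" using upper_sets_closed[OF T True, of a y] by auto
      qed
      have "T - row \<in> upper_sets D (Suc a) (Suc b)"
      proof (rule upper_setsI)
        fix x y assume "(x, y) \<in> T - row"
        then show "Suc a \<le> x \<and> x \<le> y \<and> y \<le> Suc b \<and> (x = y \<longrightarrow> x \<in> D)"
          using upper_setsD[OF T, of x y] unfolding row_def mem_Collect_eq prod.case Diff_iff
          by (metis Suc_leI le_neq_implies_less)
      next
        fix x y x' y'
        assume *: "(x, y) \<in> T - row" "Suc a \<le> x'" "x' \<le> y'" "x' \<le> x" "y' \<le> y"
          "x' = y' \<longrightarrow> x' \<in> D"
        then have "(x', y') \<in> T"
          using upper_sets_closed[OF T, of x y x' y'] by auto
        moreover have "(x', y') \<notin> row" using * by (auto simp: row_def)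
        ultimately show "(x', y') \<in> T - row" by blast
      qed
      moreover have "T = row \<union> (T - row)" using row by blast
      ultimately show ?thesis by blast
    qed
  next
    fix T assume "T \<in> ?A \<union> ?B"
    then show "T \<in> ?L"
    proof
      assume T: "T \<in> ?A"
      show ?thesis
      proof (rule upper_setsI)
        fix x y assume "(x, y) \<in> T"
        from upper_setsD[OF T this] show "a \<le> x \<and> x \<le> y \<and> y \<le> Suc b \<and> (x = y \<longrightarrow> x \<in> D)"
          by auto
      next
        fix x y x' y'
        assume "(x, y) \<in> T" "a \<le> x'" "x' \<le> y'" "x' \<le> x" "y' \<le> y" "x' = y' \<longrightarrow> x' \<in> D"
        then show "(x', y') \<in> T" using upper_sets_closed[OF T, of x y x' y'] by auto
      qed
    next
      assume "T \<in> ?B"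
      then obtain U where U: "U \<in> upper_sets D (Suc a) (Suc b)" and T: "T = row \<union> U" by blast
      show ?thesis
      proof (rule upper_setsI)
        fix x y assume "(x, y) \<in> T"
        then show "a \<le> x \<and> x \<le> y \<and> y \<le> Suc b \<and> (x = y \<longrightarrow> x \<in> D)"
          using upper_setsD[OF U, of x y] assms by (auto simp: T row_def)
      next
        fix x y x' y'
        assume *: "(x, y) \<in> T" "a \<le> x'" "x' \<le> y'" "x' \<le> x" "y' \<le> y" "x' = y' \<longrightarrow> x' \<in> D"
        show "(x', y') \<in> T"
        proof (cases "x' = a")
          case True
          then have "(x', y') \<in> row"
            using * upper_setsD(3)[OF U, of x y] by (auto simp: T row_def)
          then show ?thesis by (simp add: T)
        next
          case False
          then have "(x, y) \<in> U" using * by (auto simp: T row_def)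
          then have "(x', y') \<in> U" using * False by (auto intro: upper_sets_closed[OF U, of x y])
          then show ?thesis by (simp add: T)
        qed
      qed
    qed
  qed
  have disj: "?A \<inter> ?B = {}"
  proof -
    have "(a, Suc b) \<in> row" using assms by (simp add: row_def)
    then have "(a, Suc b) \<in> T" if "T \<in> ?B" for T using that by blast
    moreover have "(a, Suc b) \<notin> T" if "T \<in> ?A" for T using that upper_setsD(3)[of T D a b a "Suc b"] by auto
    ultimately show ?thesis by blast
  qed
  have inj: "inj_on (\<lambda>T. row \<union> T) (upper_sets D (Suc a) (Suc b))"
  proof (rule inj_onI)
    fix T U assume TU: "T \<in> upper_sets D (Suc a) (Suc b)" "U \<in> upper_sets D (Suc a) (Suc b)"
      "row \<union> T = row \<union> U"
    have "T \<inter> row = {}" "U \<inter> row = {}" using TU(1,2) by (auto simp: row_def dest: upper_setsD)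
    with TU(3) show "T = U" by blast
  qed
  show ?thesis
    unfolding split
    by (subst card_Un_disjoint[OF _ _ disj]) (simp_all add: finite_upper_sets card_image[OF inj])
qed

lemma card_upper_sets_single: "card (upper_sets D a a) = (if a \<in> D then 2 else 1)"
proof -
  have "upper_sets D a a = (if a \<in> D then {{}, {(a, a)}} else {{}})"
  proof (intro equalityI subsetI)
    fix T assume T: "T \<in> upper_sets D a a"
    have *: "(x, y) = (a, a)" "a \<in> D" if "(x, y) \<in> T" for x y
    proof -
      show xy: "(x, y) = (a, a)" using upper_setsD(1-3)[OF T that] by simp
      show "a \<in> D" using upper_setsD(4)[OF T that] xy by simp
    qed
    show "T \<in> (if a \<in> D then {{}, {(a, a)}} else {{}})"
    proof (cases "T = {}")
      case False
      then obtain p where "p \<in> T" by blast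
      then have "p = (a, a)" "a \<in> D" using *[of "fst p" "snd p"] by simp_all
      moreover have "T \<subseteq> {(a, a)}" using *(1) by auto
      ultimately show ?thesis using \<open>p \<in> T\<close> by auto
    qed auto
  qed (auto intro!: upper_setsI split: if_splits)
  then show ?thesis by simp
qed

text \<open>Both the power of two and every single binomial coefficient obey the recursion above; the diagonal
  cells enter through the one-element interval \<open>a = b\<close>.\<close>

lemma card_upper_sets:
  assumes "a \<le> b"
  shows "card (upper_sets D a b) = 2 ^ (b - a) + (\<Sum>t \<in> D \<inter> {a..b}. (b - a) choose (t - a))"
  using assms
proof (induction "b - a" arbitrary: a b)
  case 0
  then have "b = a" by simp
  then show ?case by (auto simp: card_upper_sets_single)
next
  case (Suc d)
  define c where "c = b - 1"
  have b: "b = Suc c" and ac: "a \<le> c" and d: "d = c - a" using Suc.hyps(2) by (auto simp: c_def)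
  let ?S1 = "\<Sum>t \<in> D \<inter> {a..c}. d choose (t - a)"
  let ?S2 = "\<Sum>t \<in> D \<inter> {Suc a..b}. d choose (t - Suc a)"
  have "?S1 = (\<Sum>t \<in> D \<inter> {a..b}. d choose (t - a))"
    by (rule sum.mono_neutral_left) (use ac in \<open>auto simp: b d le_Suc_eq intro!: binomial_eq_0\<close>)
  moreover have "?S2 = (\<Sum>t \<in> D \<inter> {a..b}. if t = a then 0 else d choose (t - Suc a))"
    by (rule sum.mono_neutral_cong_left) (auto simp: b)
  moreover have "(d choose (t - a)) + (if t = a then 0 else d choose (t - Suc a)) = Suc d choose (t - a)"
    if "t \<in> D \<inter> {a..b}" for t
  proof (cases "t = a")
    case False
    with that have "t - a = Suc (t - Suc a)" by auto
    then show ?thesis using False by simp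
  qed simp
  ultimately have "?S1 + ?S2 = (\<Sum>t \<in> D \<inter> {a..b}. Suc d choose (t - a))"
    by (simp add: sum.distrib[symmetric])
  moreover have "card (upper_sets D a c) = 2 ^ d + ?S1"
    using Suc.hyps(1)[of c a] ac d by simp
  moreover have "card (upper_sets D (Suc a) b) = 2 ^ d + ?S2"
    using Suc.hyps(1)[of b "Suc a"] ac d b by simp
  moreover have "b - a = Suc d" using Suc by simp
  moreover have "card (upper_sets D a b) = card (upper_sets D a c) + card (upper_sets D (Suc a) b)"
    using card_upper_sets_step[OF ac, of D] by (simp add: b)
  ultimately show ?case by simp
qed

section \<open>Blocks of indices\<close>

text \<open>Cut \<open>1, 2, \<dots>, l\<close> behind every index outside \<open>J\<close>; then \<open>block J i\<close> is the number, counted from 1, of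
  the interval that contains \<open>i\<close>.  If \<open>J\<close> indexes the simple roots in \<open>I\<close>, two indices are in the same
  interval iff \<open>\<epsilon>\<^sub>i - \<epsilon>\<^sub>j\<close> is zero or a Levi root.\<close>

definition block :: "nat set \<Rightarrow> nat \<Rightarrow> nat" where
  "block J i = Suc (card ({1..<i} - J))"

lemma block_Suc: "1 \<le> i \<Longrightarrow> block J (Suc i) = (if i \<in> J then block J i else Suc (block J i))"
proof -
  assume "1 \<le> i"
  then have "{1..<Suc i} - J = (if i \<in> J then {1..<i} - J else insert i ({1..<i} - J))"
    by (auto simp: less_Suc_eq)
  then show ?thesis by (simp add: block_def)
qed

lemma block_mono: "i \<le> j \<Longrightarrow> block J i \<le> block J j"
  unfolding block_def by (auto intro!: card_mono)

lemma block_le_iff: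
  assumes "1 \<le> j"
  shows "block J i \<le> block J j \<longleftrightarrow> {j..<i} \<subseteq> J"
proof (cases "i \<le> j")
  case True
  then show ?thesis by (simp add: block_mono)
next
  case False
  then have "{1..<i} - J = ({1..<j} - J) \<union> ({j..<i} - J)" using assms by auto
  moreover have "card (({1..<j} - J) \<union> ({j..<i} - J)) = card ({1..<j} - J) + card ({j..<i} - J)"
    by (rule card_Un_disjoint) auto
  ultimately have "block J i = block J j + card ({j..<i} - J)" by (simp add: block_def)
  then show ?thesis by auto
qed

text \<open>For \<open>l \<in> J\<close> the last interval is not closed by a cut, so its number exceeds \<open>num_blocks l J\<close>.  This is
  intended: the Levi roots then contain \<open>\<plusminus>\<epsilon>\<^sub>i\<close> for the indices \<open>i\<close> of this interval.\<close>

abbreviation num_blocks :: "nat \<Rightarrow> nat set \<Rightarrow> nat" where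
  "num_blocks l J \<equiv> card ({1..l} - J)"

lemma block_le_num_blocks_iff:
  assumes "1 \<le> j"
  shows "block J j \<le> num_blocks l J \<longleftrightarrow> \<not> {j..l} \<subseteq> J"
proof -
  have "block J (Suc l) = Suc (num_blocks l J)"
    by (simp add: block_def atLeastLessThanSuc_atLeastAtMost)
  then have "block J j \<le> num_blocks l J \<longleftrightarrow> \<not> block J (Suc l) \<le> block J j" by auto
  then show ?thesis using block_le_iff[OF assms, of J "Suc l"]
    by (simp add: atLeastLessThanSuc_atLeastAtMost)
qed

lemma block_surj:
  assumes "1 \<le> x" "x \<le> num_blocks l J"
  shows "\<exists>i\<in>{1..l}. block J i = x"
  using assms(2)
proof (induction l)
  case (Suc l)
  show ?case
  proof (cases "x \<le> num_blocks l J")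
    case True
    with Suc show ?thesis by fastforce
  next
    case False
    moreover have "num_blocks (Suc l) J \<le> Suc (num_blocks l J)"
      using card_insert_le_m1 by (auto simp: atLeastAtMostSuc_conv insert_Diff_if card_insert_if)
    ultimately have "x = Suc (num_blocks l J)" using Suc by simp
    then have "block J (Suc l) = x" by (simp add: block_def atLeastLessThanSuc_atLeastAtMost)
    then show ?thesis by force
  qed
qed (use assms in simp)

text \<open>The index pairs of the roots \<open>\<epsilon>\<^sub>i + \<epsilon>\<^sub>j\<close> in an ideal of the parabolic subalgebra which contains no other
  roots.\<close>

definition block_ideals :: "nat \<Rightarrow> nat set \<Rightarrow> (nat \<times> nat) set set" where
  "block_ideals l J =
     {S. S \<subseteq> {(i, j). 1 \<le> i \<and> i < j \<and> j \<le> l \<and> block J j \<le> num_blocks l J} \<and>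
         (\<forall>i j i' j'. (i, j) \<in> S \<longrightarrow> 1 \<le> i' \<longrightarrow> i' < j' \<longrightarrow> j' \<le> l \<longrightarrow>
            block J i' \<le> block J i \<longrightarrow> block J j' \<le> block J j \<longrightarrow> (i', j') \<in> S)}"

lemma block_idealsI:
  assumes "\<And>i j. (i, j) \<in> S \<Longrightarrow> 1 \<le> i \<and> i < j \<and> j \<le> l \<and> block J j \<le> num_blocks l J"
    and "\<And>i j i' j'. (i, j) \<in> S \<Longrightarrow> 1 \<le> i' \<Longrightarrow> i' < j' \<Longrightarrow> j' \<le> l \<Longrightarrow>
      block J i' \<le> block J i \<Longrightarrow> block J j' \<le> block J j \<Longrightarrow> (i', j') \<in> S"
  shows "S \<in> block_ideals l J"
  using assms unfolding block_ideals_def by blast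

lemma block_idealsD:
  assumes "S \<in> block_ideals l J" "(i, j) \<in> S"
  shows "1 \<le> i" "i < j" "j \<le> l" "block J j \<le> num_blocks l J"
  using assms unfolding block_ideals_def by blast+

lemma block_ideals_closed:
  assumes "S \<in> block_ideals l J" "(i, j) \<in> S" "1 \<le> i'" "i' < j'" "j' \<le> l"
    "block J i' \<le> block J i" "block J j' \<le> block J j"
  shows "(i', j') \<in> S"
  using assms unfolding block_ideals_def by blast

text \<open>The numbers of the intervals with at least two elements, without the interval that is not closed by a
  cut: an index in \<open>J\<close> other than \<open>l\<close> is in the same interval as its successor.\<close>

definition inner_blocks :: "nat \<Rightarrow> nat set \<Rightarrow> nat set" where
  "inner_blocks l J = {x \<in> block J ` J. x \<le> num_blocks l J}"

text \<open>Membership of \<open>(i, j)\<close> in a block ideal depends only on the blocks of \<open>i\<close> and \<open>j\<close>, and a pair of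
  blocks comes from some \<open>i < j\<close> unless it is a diagonal pair of a block with one element.\<close>

lemma card_block_ideals_upper_sets:
  assumes J: "J \<subseteq> {1..l}"
  shows "card (block_ideals l J) = card (upper_sets (inner_blocks l J) 1 (num_blocks l J))"
proof -
  let ?q = "num_blocks l J" and ?D = "inner_blocks l J"
  let ?f = "\<lambda>S. (\<lambda>(i, j). (block J i, block J j)) ` S"
  let ?g = "\<lambda>T. {(i, j). 1 \<le> i \<and> i < j \<and> j \<le> l \<and> (block J i, block J j) \<in> T}"
  have diag: "block J i \<in> ?D" if "1 \<le> i" "i < j" "j \<le> l" "block J i = block J j" "block J j \<le> ?q" for i j
  proof -
    have "{i..<j} \<subseteq> J" using that block_le_iff[of i J j] by simp
    then have "i \<in> J" using that by auto
    then have "block J i \<in> block J ` J" by blast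
    then show ?thesis using that by (simp add: inner_blocks_def)
  qed
  have lift: "\<exists>i j. 1 \<le> i \<and> i < j \<and> j \<le> l \<and> block J i = x \<and> block J j = y"
    if xy: "1 \<le> x" "x \<le> y" "y \<le> ?q" "x = y \<longrightarrow> x \<in> ?D" for x y
  proof (cases "x = y")
    case True
    then have "x \<in> ?D" using xy by blast
    then obtain i where i: "i \<in> J" "block J i = x" unfolding inner_blocks_def by blast
    have "i \<noteq> l"
      using i xy True J block_le_num_blocks_iff[of i J l] by auto
    then have "1 \<le> i" "i < Suc i" "Suc i \<le> l" using i J by fastforce+
    moreover have "block J (Suc i) = y" using i \<open>1 \<le> i\<close> True by (simp add: block_Suc)
    ultimately show ?thesis using i by blast
  next
    case False
    obtain i where i: "i \<in> {1..l}" "block J i = x" using block_surj[of x l J] xy le_trans[of x y ?q] by blast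
    obtain j where j: "j \<in> {1..l}" "block J j = y" using block_surj[of y l J] xy le_trans[of 1 x y] by blast
    have "i < j" using i j False xy block_mono[of j i J] by force
    then show ?thesis using i j by auto
  qed
  have "bij_betw ?f (block_ideals l J) (upper_sets ?D 1 ?q)"
  proof (rule bij_betw_byWitness[where f' = ?g])
    show "\<forall>S\<in>block_ideals l J. ?g (?f S) = S"
    proof
      fix S assume S: "S \<in> block_ideals l J"
      show "?g (?f S) = S"
      proof (intro equalityI subsetI)
        fix p assume "p \<in> ?g (?f S)"
        then obtain i j i' j' where p: "p = (i, j)" "1 \<le> i" "i < j" "j \<le> l" "(i', j') \<in> S"
          "block J i = block J i'" "block J j = block J j'" by auto
        then show "p \<in> S" using block_ideals_closed[OF S p(5)] by simp
      next
        fix p assume "p \<in> S"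
        then show "p \<in> ?g (?f S)" using block_idealsD[OF S] by (cases p) force
      qed
    qed
    show "\<forall>T\<in>upper_sets ?D 1 ?q. ?f (?g T) = T"
    proof
      fix T assume T: "T \<in> upper_sets ?D 1 ?q"
      show "?f (?g T) = T"
      proof (intro equalityI subsetI)
        fix p assume p: "p \<in> T"
        obtain x y where xy: "p = (x, y)" by (cases p)
        then have "1 \<le> x" "x \<le> y" "y \<le> ?q" "x = y \<longrightarrow> x \<in> ?D"
          using T p by (auto dest: upper_setsD simp del: One_nat_def)
        from lift[OF this] p xy show "p \<in> ?f (?g T)" by force
      qed auto
    qed
    show "?f ` block_ideals l J \<subseteq> upper_sets ?D 1 ?q"
    proof (rule image_subsetI)
      fix S assume S: "S \<in> block_ideals l J"
      show "?f S \<in> upper_sets ?D 1 ?q"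
      proof (rule upper_setsI)
        fix x y assume "(x, y) \<in> ?f S"
        then obtain i j where S': "(i, j) \<in> S" and xy: "x = block J i" "y = block J j" by auto
        then have ij: "1 \<le> i" "i < j" "j \<le> l" "block J j \<le> ?q"
          using block_idealsD[OF S S'] by auto
        then show "1 \<le> x \<and> x \<le> y \<and> y \<le> ?q \<and> (x = y \<longrightarrow> x \<in> ?D)"
          unfolding xy using diag[of i j] block_mono[of i j J] by (auto simp: block_def)
      next
        fix x y x' y'
        assume xy: "(x, y) \<in> ?f S" "1 \<le> x'" "x' \<le> y'" "x' \<le> x" "y' \<le> y" "x' = y' \<longrightarrow> x' \<in> ?D"
        then obtain i j where *: "(i, j) \<in> S" "1 \<le> x'" "x' \<le> y'" "x' \<le> block J i"
          "y' \<le> block J j" "x' = y' \<longrightarrow> x' \<in> ?D" by auto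
        have ij: "1 \<le> i" "i < j" "j \<le> l" "block J j \<le> ?q"
          using block_idealsD[OF S *(1)] by auto
        then have "y' \<le> ?q" using * by simp
        from lift[OF *(2,3) this *(6)] obtain i' j' where
          "1 \<le> i'" "i' < j'" "j' \<le> l" "block J i' = x'" "block J j' = y'" by blast
        moreover from this have "(i', j') \<in> S"
          by (intro block_ideals_closed[OF S *(1)]) (use * in simp_all)
        ultimately show "(x', y') \<in> ?f S" by force
      qed
    qed
    show "?g ` upper_sets ?D 1 ?q \<subseteq> block_ideals l J"
    proof (rule image_subsetI)
      fix T assume T: "T \<in> upper_sets ?D 1 ?q"
      show "?g T \<in> block_ideals l J"
      proof (rule block_idealsI)
        fix i j assume "(i, j) \<in> ?g T"
        then show "1 \<le> i \<and> i < j \<and> j \<le> l \<and> block J j \<le> ?q"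
          using upper_setsD(3)[OF T] by auto
      next
        fix i j i' j'
        assume "(i, j) \<in> ?g T" and **: "1 \<le> i'" "i' < j'" "j' \<le> l"
          "block J i' \<le> block J i" "block J j' \<le> block J j"
        then have *: "1 \<le> i" "i < j" "j \<le> l" "(block J i, block J j) \<in> T" by auto
        have q: "block J j' \<le> ?q" using **(5) upper_setsD(3)[OF T *(4)] by simp
        have "1 \<le> block J i'" by (simp add: block_def)
        moreover have "block J i' \<le> block J j'" using ** by (intro block_mono) simp
        moreover have "block J i' = block J j' \<longrightarrow> block J i' \<in> ?D" using diag[of i' j'] ** q by simp
        ultimately have "(block J i', block J j') \<in> T"
          using ** by (auto intro: upper_sets_closed[OF T *(4)])
        then show "(i', j') \<in> ?g T" using ** by simp
      qed
    qed
  qed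
  then show ?thesis by (rule bij_betw_same_card)
qed

text \<open>Without cuts the empty set is the only block ideal, and the truncated exponent gives the right value 1.\<close>

lemma card_block_ideals:
  assumes J: "J \<subseteq> {1..l}"
  shows "card (block_ideals l J) =
    2 ^ (num_blocks l J - 1) + (\<Sum>x\<in>inner_blocks l J. (num_blocks l J - 1) choose (x - 1))"
proof (cases "num_blocks l J = 0")
  case True
  have "upper_sets (inner_blocks l J) 1 (num_blocks l J) = {{}}"
  proof (intro equalityI subsetI)
    fix T assume T: "T \<in> upper_sets (inner_blocks l J) 1 (num_blocks l J)"
    have "p \<notin> T" for p using upper_setsD(1-3)[OF T, of "fst p" "snd p"] unfolding True by auto
    then show "T \<in> {{}}" by blast
  qed (auto intro: upper_setsI)
  moreover have "inner_blocks l J = {}" unfolding inner_blocks_def True by (auto simp: block_def)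
  ultimately show ?thesis unfolding card_block_ideals_upper_sets[OF J] True by simp
next
  case False
  have "inner_blocks l J \<inter> {1..num_blocks l J} = inner_blocks l J"
    by (auto simp: inner_blocks_def block_def)
  moreover have "1 \<le> num_blocks l J" using False by linarith
  ultimately show ?thesis
    unfolding card_block_ideals_upper_sets[OF J] by (simp only: card_upper_sets)
qed

section \<open>Exponentials of nilpotent derivations\<close>

context complex_lie_algebra
begin

lemma br_zero_left [simp]: "br 0 y = 0"
  using br_add_left[of 0 0 y] by simp

lemma br_zero_right [simp]: "br x 0 = 0"
  using br_add_right[of x 0 0] by simp

lemma br_minus_left [simp]: "br (- x) y = - br x y"
  using br_add_left[of x "- x" y] by (simp add: eq_neg_iff_add_eq_0 add.commute)

lemma br_minus_right [simp]: "br x (- y) = - br x y"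
  using br_add_right[of x y "- y"] by (simp add: eq_neg_iff_add_eq_0 add.commute)

lemma br_anticommute: "br x y = - br y x"
proof -
  have "br y x + br x y = 0"
    using br_self[of "x + y"] unfolding br_add_left br_add_right by (simp add: br_self)
  then show ?thesis by (simp only: eq_neg_iff_add_eq_0 add.commute)
qed

text \<open>The Jacobi identity in the form used throughout: \<open>ad x\<close> is a derivation.\<close>

lemma br_derivation: "br x (br y z) = br (br x y) z + br y (br x z)"
proof -
  have "br (br x y) z = - br z (br x y)" by (rule br_anticommute)
  moreover have "br y (br x z) = - br y (br z x)" by (subst br_anticommute) simp
  moreover have "br x (br y z) = - (br y (br z x) + br z (br x y))"
    using br_jacobi[of x y z] by (simp only: eq_neg_iff_add_eq_0 add.assoc)
  ultimately show ?thesis by simp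
qed

lemma br_sum_left: "br (sum g A) y = (\<Sum>i\<in>A. br (g i) y)"
  by (induction A rule: infinite_finite_induct) (simp_all add: br_add_left)

lemma br_sum_right: "br y (sum g A) = (\<Sum>i\<in>A. br y (g i))"
  by (induction A rule: infinite_finite_induct) (simp_all add: br_add_right)

lemma ad_pow_add: "(br a ^^ n) (x + y) = (br a ^^ n) x + (br a ^^ n) y"
  by (induction n) (simp_all add: br_add_right)

lemma ad_pow_scale: "(br a ^^ n) (scale c x) = scale c ((br a ^^ n) x)"
  by (induction n) (simp_all add: br_scale_right)

lemma ad_pow_zero [simp]: "(br a ^^ n) 0 = 0"
  by (induction n) simp_all

lemma ad_pow_sum: "(br a ^^ n) (sum g A) = (\<Sum>i\<in>A. (br a ^^ n) (g i))"
  by (induction A rule: infinite_finite_induct) (simp_all add: ad_pow_add)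

lemma ad_pow_zero_mono:
  assumes "(br a ^^ n) x = 0" "n \<le> m"
  shows "(br a ^^ m) x = 0"
proof -
  have "(br a ^^ m) x = (br a ^^ (m - n)) ((br a ^^ n) x)"
    using assms(2) by (metis comp_apply funpow_add le_add_diff_inverse2)
  then show ?thesis by (simp add: assms(1))
qed

definition ad_nilpotent :: "nat \<Rightarrow> 'g \<Rightarrow> bool" where
  "ad_nilpotent N a \<longleftrightarrow> (\<forall>x. (br a ^^ N) x = 0)"

text \<open>The truncation is the full exponential series as soon as \<open>N\<close> bounds the nilpotency index of \<open>ad a\<close>.\<close>

definition ad_exp :: "nat \<Rightarrow> 'g \<Rightarrow> 'g \<Rightarrow> 'g" where
  "ad_exp N a x = (\<Sum>n<N. scale (inverse (fact n)) ((br a ^^ n) x))"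

lemma ad_exp_add: "ad_exp N a (x + y) = ad_exp N a x + ad_exp N a y"
  by (simp add: ad_exp_def ad_pow_add scale_right_distrib sum.distrib)

lemma ad_exp_scale: "ad_exp N a (scale c x) = scale c (ad_exp N a x)"
  by (simp add: ad_exp_def ad_pow_scale scale_sum_right mult.commute)

lemma ad_exp_eq:
  assumes "(br a ^^ m) x = 0" "m \<le> N"
  shows "ad_exp N a x = (\<Sum>n<m. scale (inverse (fact n)) ((br a ^^ n) x))"
  unfolding ad_exp_def using assms
  by (intro sum.mono_neutral_right) (auto simp: ad_pow_zero_mono[OF assms(1)])

lemma ad_exp_quadratic:
  assumes "br a (br a (br a x)) = 0" "3 \<le> N"
  shows "ad_exp N a x = x + br a x + scale (1 / 2) (br a (br a x))"
proof -
  have "ad_exp N a x = (\<Sum>n<3. scale (inverse (fact n)) ((br a ^^ n) x))"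
    by (rule ad_exp_eq) (use assms in \<open>simp_all add: eval_nat_numeral\<close>)
  then show ?thesis by (simp add: eval_nat_numeral inverse_eq_divide)
qed

lemma last_nonzero_ad_pow:
  assumes nil: "ad_nilpotent N a" and "x \<noteq> 0"
  obtains k where "(br a ^^ k) x \<noteq> 0" "(br a ^^ Suc k) x = 0" "Suc k \<le> N"
proof -
  let ?P = "\<lambda>m. (br a ^^ m) x = 0"
  have N: "?P N" using nil unfolding ad_nilpotent_def by blast
  have m: "?P (LEAST m. ?P m)" by (rule LeastI[of ?P, OF N])
  then have "(LEAST m. ?P m) \<noteq> 0" using \<open>x \<noteq> 0\<close> by (intro notI) simp
  then obtain k where k: "(LEAST m. ?P m) = Suc k" by (cases "LEAST m. ?P m") auto
  show thesis
  proof (rule that)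
    show "(br a ^^ k) x \<noteq> 0" using not_less_Least[of k ?P] k by simp
    show "(br a ^^ Suc k) x = 0" using m unfolding k .
    show "Suc k \<le> N" using Least_le[of ?P, OF N] k by simp
  qed
qed

text \<open>If \<open>(ad a)\<^sup>k x\<close> is the last nonzero power, applying \<open>(ad a)\<^sup>k\<close> to the exponential leaves just this term.\<close>

lemma ad_exp_inj:
  assumes nil: "ad_nilpotent N a" and zero: "ad_exp N a x = 0"
  shows "x = 0"
proof (rule ccontr)
  assume "x \<noteq> 0"
  from last_nonzero_ad_pow[OF nil this] obtain k
    where k': "(br a ^^ k) x \<noteq> 0" and m: "(br a ^^ Suc k) x = 0" and le: "Suc k \<le> N" .
  have "(br a ^^ k) (ad_exp N a x) = (\<Sum>n<Suc k. scale (inverse (fact n)) ((br a ^^ (k + n)) x))"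
    by (simp only: ad_exp_eq[OF m le] ad_pow_sum ad_pow_scale funpow_add comp_apply)
  also have "\<dots> = (\<Sum>n\<in>{0}. scale (inverse (fact n)) ((br a ^^ (k + n)) x))"
  proof (rule sum.mono_neutral_right)
    show "\<forall>n\<in>{..<Suc k} - {0}. scale (inverse (fact n)) ((br a ^^ (k + n)) x) = 0"
    proof
      fix n assume "n \<in> {..<Suc k} - {0}"
      then have "Suc k \<le> k + n" by simp
      then show "scale (inverse (fact n)) ((br a ^^ (k + n)) x) = 0"
        by (simp add: ad_pow_zero_mono[OF m])
    qed
  qed simp_all
  also have "\<dots> = (br a ^^ k) x" by simp
  finally show False using zero k' by simp
qed

lemma ad_pow_leibniz:
  "scale (inverse (fact n)) ((br a ^^ n) (br x y)) =
    (\<Sum>i\<le>n. br (scale (inverse (fact i)) ((br a ^^ i) x))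
      (scale (inverse (fact (n - i))) ((br a ^^ (n - i)) y)))"
proof -
  have "(br a ^^ n) (br x y) =
      (\<Sum>i\<le>n. scale (of_nat (n choose i)) (br ((br a ^^ i) x) ((br a ^^ (n - i)) y)))"
  proof (induction n)
    case (Suc n)
    let ?t = "\<lambda>i j. br ((br a ^^ i) x) ((br a ^^ j) y)"
    have "(br a ^^ Suc n) (br x y) =
        (\<Sum>i\<le>n. scale (of_nat (n choose i)) (?t (Suc i) (n - i))) +
        (\<Sum>i\<le>n. scale (of_nat (n choose i)) (?t i (Suc (n - i))))"
      by (simp add: Suc br_sum_right br_scale_right br_derivation[of a] scale_right_distrib sum.distrib)
    also have "(\<Sum>i\<le>n. scale (of_nat (n choose i)) (?t i (Suc (n - i)))) =
        (\<Sum>i\<le>Suc n. scale (of_nat (n choose i)) (?t i (Suc n - i)))"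
      by (simp add: binomial_eq_0) (intro sum.cong; simp add: Suc_diff_le)
    also have "\<dots> = ?t 0 (Suc n) + (\<Sum>i\<le>n. scale (of_nat (n choose Suc i)) (?t (Suc i) (n - i)))"
      by (subst sum.atMost_Suc_shift) simp
    also have "(\<Sum>i\<le>n. scale (of_nat (n choose i)) (?t (Suc i) (n - i))) + \<dots> =
        ?t 0 (Suc n) + (\<Sum>i\<le>n. scale (of_nat (Suc n choose Suc i)) (?t (Suc i) (n - i)))"
      by (simp add: sum.distrib[symmetric] scale_left_distrib[symmetric] add.commute add.left_commute)
    also have "\<dots> = (\<Sum>i\<le>Suc n. scale (of_nat (Suc n choose i)) (?t i (Suc n - i)))"
      by (subst sum.atMost_Suc_shift) simp
    finally show ?case .
  qed simp
  then show ?thesis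
    by (simp add: scale_sum_right br_scale_left br_scale_right)
      (intro sum.cong refl, simp add: binomial_fact field_simps)
qed

text \<open>The exponential of a nilpotent derivation preserves brackets: by Leibniz' rule both sides are sums of the
  same terms, on the left over a triangle of exponents and on the right over a square inside it, and the
  terms outside the square vanish.\<close>

lemma ad_exp_br:
  assumes nil: "ad_nilpotent N a"
  shows "ad_exp N a (br x y) = br (ad_exp N a x) (ad_exp N a y)"
proof -
  let ?u = "\<lambda>n x. scale (inverse (fact n)) ((br a ^^ n) x)"
  have zero: "(br a ^^ n) z = 0" if "N \<le> n" for n z
    using nil that by (auto simp: ad_nilpotent_def intro: ad_pow_zero_mono)
  \<comment> \<open>With \<open>2 N\<close> terms the triangle of exponents contains the square with side \<open>N\<close>.\<close>
  have ext: "ad_exp N a z = (\<Sum>n<2 * N. ?u n z)" for z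
    unfolding ad_exp_def by (intro sum.mono_neutral_left) (auto simp: zero)
  have "ad_exp N a (br x y) = (\<Sum>n<2 * N. \<Sum>i\<le>n. br (?u i x) (?u (n - i) y))"
    unfolding ext by (simp only: ad_pow_leibniz)
  also have "\<dots> = (\<Sum>(i, j)\<in>{(i, j). i + j < 2 * N}. br (?u i x) (?u j y))"
    by (rule sum.triangle_reindex[symmetric])
  also have "\<dots> = (\<Sum>(i, j)\<in>{..<N} \<times> {..<N}. br (?u i x) (?u j y))"
  proof (rule sum.mono_neutral_right)
    have "{(i, j). i + j < 2 * N} \<subseteq> {..<2 * N} \<times> {..<2 * N}" by auto
    then show "finite {(i, j). i + j < 2 * N}" by (rule finite_subset) simp
    have "br (?u i x) (?u j y) = 0" if "\<not> (i < N \<and> j < N)" for i j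
      using that zero[of i x] zero[of j y] by (cases "i < N") simp_all
    then show "\<forall>p\<in>{(i, j). i + j < 2 * N} - {..<N} \<times> {..<N}.
        (case p of (i, j) \<Rightarrow> br (?u i x) (?u j y)) = 0" by auto
  qed auto
  also have "\<dots> = br (ad_exp N a x) (ad_exp N a y)"
    by (simp add: ad_exp_def br_sum_left br_sum_right sum.cartesian_product[symmetric])
      (rule sum.swap)
  finally show ?thesis .
qed

text \<open>The commutation relations give \<open>f e\<^sup>n\<^sup>+\<^sup>1 x = - (n + 1) (m + n) e\<^sup>n x\<close> with a nonzero factor.  So if \<open>x\<close>
  were nonzero, no power of \<open>e\<close> could kill it, against the nilpotency of \<open>ad e\<close>.\<close>

lemma sl2_positive_weight_zero:
  assumes he: "br h e = scale 2 e" and ef: "br e f = h" and nil: "ad_nilpotent N e"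
    and hx: "br h x = scale (of_nat m) x" and m: "0 < m" and efx: "br e (br f x) = 0"
  shows "x = 0"
proof (rule ccontr)
  assume "x \<noteq> 0"
  from last_nonzero_ad_pow[OF nil this] obtain k
    where k': "(br e ^^ k) x \<noteq> 0" and p: "(br e ^^ Suc k) x = 0" and "Suc k \<le> N" .
  have weight: "br h ((br e ^^ n) x) = scale (of_nat (m + 2 * n)) ((br e ^^ n) x)" for n
  proof (induction n)
    case (Suc n)
    have "br h ((br e ^^ Suc n) x) = br (br h e) ((br e ^^ n) x) + br e (br h ((br e ^^ n) x))"
      by (simp add: br_derivation[of h e])
    then show ?case
      by (simp add: he Suc br_scale_left br_scale_right scale_left_distrib[symmetric])
  qed (simp add: hx)
  have f_e: "br f (br e z) = br e (br f z) - br h z" for z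
    using br_derivation[of e f z] by (simp add: ef)
  have "br f ((br e ^^ Suc n) x) = scale (- of_nat ((n + 1) * (m + n))) ((br e ^^ n) x)" for n
  proof (induction n)
    case 0
    then show ?case using hx by (simp add: f_e efx)
  next
    case (Suc n)
    have "br f ((br e ^^ Suc (Suc n)) x) =
        br e (br f ((br e ^^ Suc n) x)) - br h ((br e ^^ Suc n) x)"
      by (simp add: f_e)
    also have "\<dots> = scale (- of_nat ((n + 1) * (m + n)) - of_nat (m + 2 * Suc n)) ((br e ^^ Suc n) x)"
      by (simp only: Suc weight br_scale_right scale_left_diff_distrib) simp
    also have "- of_nat ((n + 1) * (m + n)) - of_nat (m + 2 * Suc n) =
        (- of_nat ((Suc n + 1) * (m + Suc n)) :: complex)"
      by (simp add: algebra_simps)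
    finally show ?case .
  qed
  from this[of k] have "scale (- of_nat ((k + 1) * (m + k))) ((br e ^^ k) x) = 0"
    unfolding p by simp
  then show False using k' m by (simp del: of_nat_mult of_nat_add)
qed

end

text \<open>Applying \<open>e\<close> to an eigenvector of \<open>ad h\<close> shifts the eigenvalue by \<open>k\<close>, and \<open>ad h\<close> has only finitely many
  eigenvalues, so every vector of an eigenbasis is killed by a power of \<open>ad e\<close>.\<close>

lemma (in complex_simple_lie_algebra) diagonalizable_ad_nilpotent:
  assumes diag: "ad_diagonalizable scale br h" and he: "br h e = scale k e" and k: "k \<noteq> 0"
  shows "\<exists>N. ad_nilpotent N e"
proof -
  from diag obtain B where indep: "\<not> dependent B" and span: "span B = UNIV"
    and eig: "\<forall>x\<in>B. \<exists>c. br h x = scale c x"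
    unfolding ad_diagonalizable_def by blast
  from finite_dim obtain A where "finite A" "span A = UNIV" by blast
  then have fin: "finite B" using independent_span_bound[of A B] indep by simp
  from eig obtain c where c: "\<And>x. x \<in> B \<Longrightarrow> br h x = scale (c x) x" by metis
  \<comment> \<open>Every eigenvalue already occurs in the eigenbasis, so there are only finitely many.\<close>
  have eigenvalue: "\<mu> \<in> c ` B" if y: "y \<noteq> 0" "br h y = scale \<mu> y" for y \<mu>
  proof -
    have "y \<in> span B" using span by simp
    then obtain u where u: "y = (\<Sum>x\<in>B. scale (u x) x)" using span_finite[OF fin] by auto
    have "(\<Sum>x\<in>B. scale (u x * (c x - \<mu>)) x) = br h y - scale \<mu> y"
      by (simp add: u br_sum_right br_scale_right c scale_sum_right algebra_simps sum_subtractf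
          scale_left_diff_distrib)
    then have "(\<Sum>x\<in>B. scale (u x * (c x - \<mu>)) x) = 0" using y by simp
    then have "u x * (c x - \<mu>) = 0" if "x \<in> B" for x
      using independentD[OF indep fin subset_refl _ that, of "\<lambda>x. u x * (c x - \<mu>)"] by simp
    moreover obtain x where "x \<in> B" "u x \<noteq> 0"
    proof (rule ccontr)
      assume "\<not> thesis"
      then have "y = 0" unfolding u using that by (intro sum.neutral) auto
      with y show False by simp
    qed
    ultimately have "c x = \<mu>" by fastforce
    with \<open>x \<in> B\<close> show ?thesis by blast
  qed
  have "\<exists>n. (br e ^^ n) x = 0" if x: "x \<in> B" for x
  proof (rule ccontr)
    assume nz: "\<nexists>n. (br e ^^ n) x = 0"
    have "br h ((br e ^^ n) x) = scale (c x + of_nat n * k) ((br e ^^ n) x)" for n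
    proof (induction n)
      case (Suc n)
      have "br h ((br e ^^ Suc n) x) = br (br h e) ((br e ^^ n) x) + br e (br h ((br e ^^ n) x))"
        by (simp add: br_derivation[of h e])
      also have "\<dots> = scale (k + (c x + of_nat n * k)) ((br e ^^ Suc n) x)"
        by (simp add: he Suc br_scale_left br_scale_right scale_left_distrib[symmetric])
      also have "k + (c x + of_nat n * k) = c x + of_nat (Suc n) * k" by (simp add: algebra_simps)
      finally show ?case .
    qed (simp add: c x)
    then have "range (\<lambda>n. c x + of_nat n * k) \<subseteq> c ` B" using eigenvalue nz by blast
    moreover have "inj (\<lambda>n::nat. c x + of_nat n * k)" using k by (auto intro: injI)
    ultimately show False using fin finite_subset finite_imageD[of _ "UNIV :: nat set"] infinite_UNIV_nat by blast
  qed
  then obtain n where n: "\<And>x. x \<in> B \<Longrightarrow> (br e ^^ n x) x = 0" by metis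
  define N where "N = (\<Sum>x\<in>B. n x)"
  have "(br e ^^ N) x = 0" if "x \<in> B" for x
    using n[OF that] by (rule ad_pow_zero_mono) (simp add: N_def member_le_sum fin that)
  moreover have "subspace {x. (br e ^^ N) x = 0}"
    by (rule subspaceI) (simp_all add: ad_pow_add ad_pow_scale)
  ultimately have "(br e ^^ N) x = 0" for x
    using span_subspace_induct[of x B "{x. (br e ^^ N) x = 0}"] span by simp
  then show ?thesis unfolding ad_nilpotent_def by blast
qed

section \<open>Root spaces, sl2 triples and reflections\<close>

locale simple_lie_with_cartan = complex_simple_lie_algebra scale br
  for scale :: "complex \<Rightarrow> 'g::ab_group_add \<Rightarrow> 'g" and br :: "'g \<Rightarrow> 'g \<Rightarrow> 'g" +
  fixes H :: "'g set"
  assumes cartan: "cartan_subalgebra scale br H"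
begin

abbreviation dual :: "('g \<Rightarrow> complex) set" where "dual \<equiv> dual_on scale H"
abbreviation wt :: "('g \<Rightarrow> complex) \<Rightarrow> 'g set" where "wt \<equiv> root_space scale br H"

lemma H_subspace: "subspace H"
  and H_centralizer: "\<And>x. (\<And>h. h \<in> H \<Longrightarrow> br h x = 0) \<Longrightarrow> x \<in> H"
  and H_diag: "\<And>h. h \<in> H \<Longrightarrow> ad_diagonalizable scale br h"
  using cartan unfolding cartan_subalgebra_def lie_abelian_def by blast+

lemma dual_add: "\<alpha> \<in> dual \<Longrightarrow> x \<in> H \<Longrightarrow> y \<in> H \<Longrightarrow> \<alpha> (x + y) = \<alpha> x + \<alpha> y"
  and dual_scale: "\<alpha> \<in> dual \<Longrightarrow> x \<in> H \<Longrightarrow> \<alpha> (scale c x) = c * \<alpha> x"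
  and dual_outside: "\<alpha> \<in> dual \<Longrightarrow> x \<notin> H \<Longrightarrow> \<alpha> x = 0"
  unfolding dual_on_def by blast+

lemma dual_minus: "\<alpha> \<in> dual \<Longrightarrow> x \<in> H \<Longrightarrow> \<alpha> (- x) = - \<alpha> x"
  using dual_scale[of \<alpha> x "-1"] by simp

lemma dual_diff: "\<alpha> \<in> dual \<Longrightarrow> x \<in> H \<Longrightarrow> y \<in> H \<Longrightarrow> \<alpha> (x - y) = \<alpha> x - \<alpha> y"
  using dual_add[of \<alpha> x "- y"] dual_minus[of \<alpha> y] subspace_neg[OF H_subspace, of y] by simp

lemma wtD: "x \<in> wt \<alpha> \<Longrightarrow> t \<in> H \<Longrightarrow> br t x = scale (\<alpha> t) x"
  unfolding root_space_def by blast

lemma wt_zero [simp]: "0 \<in> wt \<alpha>"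
  by (simp add: root_space_def)

lemma wt_scale: "x \<in> wt \<alpha> \<Longrightarrow> scale c x \<in> wt \<alpha>"
  by (simp add: root_space_def br_scale_right mult.commute)

lemma wt_add: "x \<in> wt \<alpha> \<Longrightarrow> y \<in> wt \<alpha> \<Longrightarrow> x + y \<in> wt \<alpha>"
  by (simp add: root_space_def br_add_right scale_right_distrib)

lemma wt_br: "x \<in> wt \<alpha> \<Longrightarrow> y \<in> wt \<beta> \<Longrightarrow> br x y \<in> wt (\<lambda>t. \<alpha> t + \<beta> t)"
  by (simp add: root_space_def br_derivation[of _ x y] br_scale_left br_scale_right scale_left_distrib)

lemma wt_br_opposite: "x \<in> wt \<alpha> \<Longrightarrow> y \<in> wt (- \<alpha>) \<Longrightarrow> br x y \<in> H"
  using wt_br[of x \<alpha> y "- \<alpha>"] by (intro H_centralizer) (simp add: root_space_def)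

lemma rootsI: "\<alpha> \<in> dual \<Longrightarrow> \<alpha> \<noteq> 0 \<Longrightarrow> x \<in> wt \<alpha> \<Longrightarrow> x \<noteq> 0 \<Longrightarrow> \<alpha> \<in> roots scale br H"
  unfolding roots_def by blast

definition sl2_triple :: "('g \<Rightarrow> complex) \<Rightarrow> 'g \<Rightarrow> 'g \<Rightarrow> 'g \<Rightarrow> bool" where
  "sl2_triple \<alpha> e f h \<longleftrightarrow> \<alpha> \<in> dual \<and> e \<in> wt \<alpha> \<and> f \<in> wt (- \<alpha>) \<and> br e f = h \<and> h \<in> H \<and> \<alpha> h = 2"

lemma sl2_tripleD:
  assumes "sl2_triple \<alpha> e f h"
  shows "\<alpha> \<in> dual" "e \<in> wt \<alpha>" "f \<in> wt (- \<alpha>)" "br e f = h" "h \<in> H" "\<alpha> h = 2"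
    "br h e = scale 2 e" "br h f = scale (- 2) f" "br f e = - h"
proof -
  show *: "\<alpha> \<in> dual" "e \<in> wt \<alpha>" "f \<in> wt (- \<alpha>)" "br e f = h" "h \<in> H" "\<alpha> h = 2"
    using assms unfolding sl2_triple_def by blast+
  show "br h e = scale 2 e" using wtD[OF *(2,5)] *(6) by simp
  show "br h f = scale (- 2) f" using wtD[OF *(3,5)] *(6) by simp
  show "br f e = - h" using *(4) br_anticommute[of f e] by simp
qed

lemma sl2_triple_swap:
  assumes "sl2_triple \<alpha> e f h"
  shows "sl2_triple (- \<alpha>) f e (- h)"
proof -
  note t = sl2_tripleD[OF assms]
  have "- \<alpha> \<in> dual" using t(1) by (auto simp: dual_on_def)
  then show ?thesis
    using t dual_minus[OF t(1,5)] subspace_neg[OF H_subspace t(5)] by (simp add: sl2_triple_def)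
qed

lemma sl2_triple_nilpotent:
  assumes "sl2_triple \<alpha> e f h"
  shows "\<exists>N. ad_nilpotent N e"
  using diagonalizable_ad_nilpotent[OF H_diag] sl2_tripleD[OF assms] by (metis zero_neq_numeral)

lemma sl2_wt_zero:
  assumes "sl2_triple \<alpha> e f h" "x \<in> wt \<beta>" "\<beta> h = of_nat m" "0 < m" "br e (br f x) = 0"
  shows "x = 0"
proof -
  note t = sl2_tripleD[OF assms(1)]
  obtain N where "ad_nilpotent N e" using sl2_triple_nilpotent[OF assms(1)] by blast
  from sl2_positive_weight_zero[OF t(7,4) this _ assms(4,5)] wtD[OF assms(2) t(5)] assms(3)
  show ?thesis by simp
qed

text \<open>Change \<open>x\<close> by the multiple of \<open>e\<close> for which \<open>\<alpha>\<close> vanishes on \<open>[f, x]\<close>.  Then \<open>[f, x] \<in> H\<close> commutes with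
  \<open>e\<close>, so \<open>x\<close> is a vector of weight 2 with \<open>[e, [f, x]] = 0\<close> and vanishes.\<close>

lemma root_space_one_dim:
  assumes tr: "sl2_triple \<alpha> e f h" and x: "x \<in> wt \<alpha>"
  shows "\<exists>c. x = scale c e"
proof -
  note t = sl2_tripleD[OF tr]
  define c where "c = \<alpha> (br f x) / 2"
  let ?x = "x + scale c e"
  have fx: "br f x \<in> H" using wt_br_opposite[OF x t(3)] br_anticommute[of f x] subspace_neg[OF H_subspace] by simp
  have x': "?x \<in> wt \<alpha>" using x t(2) by (intro wt_add wt_scale)
  have eq: "br f ?x = br f x - scale c h"
    by (simp add: br_add_right br_scale_right t(9))
  have ch: "scale c h \<in> H" using H_subspace t(5) by (rule subspace_scale)
  have "\<alpha> (br f ?x) = 0"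
    unfolding eq dual_diff[OF t(1) fx ch] by (simp add: dual_scale[OF t(1,5)] t(6) c_def)
  moreover have "br f ?x \<in> H"
    unfolding eq using fx ch H_subspace by (intro subspace_diff)
  ultimately have "br (br f ?x) e = 0" using wtD[OF t(2)] by simp
  then have "br e (br f ?x) = 0" using br_anticommute[of e] by simp
  then have "?x = 0" using sl2_wt_zero[OF tr x', of 2] t(6) by simp
  then have "x = scale (- c) e" by (simp add: eq_neg_iff_add_eq_0)
  then show ?thesis by blast
qed

text \<open>The coroot is given only as a linear combination of brackets.  Some bracket \<open>[x, y]\<close> has
  \<open>\<alpha>([x, y]) \<noteq> 0\<close> and can be scaled to an sl2 triple; then both root spaces are lines, so all brackets are
  multiples of this one.\<close>

lemma coroot_sl2_triple:
  assumes \<alpha>: "\<alpha> \<in> dual" and co: "is_coroot scale br H \<alpha> h"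
  shows "\<exists>e f. sl2_triple \<alpha> e f h"
proof -
  let ?G = "{br x y | x y. x \<in> wt \<alpha> \<and> y \<in> wt (- \<alpha>)}"
  have h: "h \<in> H" "h \<in> span ?G" "\<alpha> h = 2" using co unfolding is_coroot_def by blast+
  have "\<exists>x y. x \<in> wt \<alpha> \<and> y \<in> wt (- \<alpha>) \<and> \<alpha> (br x y) \<noteq> 0"
  proof (rule ccontr)
    assume *: "\<not> ?thesis"
    have "subspace {z \<in> H. \<alpha> z = 0}"
      using H_subspace dual_scale[OF \<alpha>, of 0 0] subspace_0[OF H_subspace]
      by (auto intro!: subspaceI simp: dual_add[OF \<alpha>] dual_scale[OF \<alpha>] subspace_add subspace_scale)
    moreover have "z \<in> {z \<in> H. \<alpha> z = 0}" if "z \<in> ?G" for z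
      using that * wt_br_opposite by blast
    ultimately have "h \<in> {z \<in> H. \<alpha> z = 0}" by (rule span_subspace_induct[OF h(2)])
    then show False using h by simp
  qed
  then obtain x y where xy: "x \<in> wt \<alpha>" "y \<in> wt (- \<alpha>)" "\<alpha> (br x y) \<noteq> 0" by blast
  define f where "f = scale (2 / \<alpha> (br x y)) y"
  have f: "f \<in> wt (- \<alpha>)" unfolding f_def using xy by (intro wt_scale)
  have "\<alpha> (br x f) = 2"
    using xy wt_br_opposite[OF xy(1,2)] by (simp add: f_def br_scale_right dual_scale[OF \<alpha>])
  then have tr: "sl2_triple \<alpha> x f (br x f)"
    unfolding sl2_triple_def using \<alpha> xy f wt_br_opposite by simp
  have "z \<in> span {br x f}" if z: "z \<in> ?G" for z
  proof -
    from z obtain x' y' where z': "z = br x' y'" "x' \<in> wt \<alpha>" "y' \<in> wt (- \<alpha>)" by blast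
    obtain c where "x' = scale c x" using root_space_one_dim[OF tr z'(2)] by blast
    moreover obtain d where "y' = scale d f"
      using root_space_one_dim[OF sl2_triple_swap[OF tr] z'(3)] by blast
    ultimately show ?thesis
      by (simp add: z' br_scale_left br_scale_right span_base span_scale)
  qed
  then have "h \<in> span {br x f}" using span_subspace_induct[OF h(2) subspace_span] by blast
  then obtain c where c: "h = scale c (br x f)" by (auto simp: span_singleton)
  have "c = 1"
    using h(3) \<open>\<alpha> (br x f) = 2\<close> sl2_tripleD(5)[OF tr] by (simp add: c dual_scale[OF \<alpha>])
  then show ?thesis using tr c by auto
qed

lemma coroot_unique:
  assumes "\<alpha> \<in> dual" "is_coroot scale br H \<alpha> h" "is_coroot scale br H \<alpha> h'"
  shows "h = h'"
proof -
  obtain e f where tr: "sl2_triple \<alpha> e f h" using coroot_sl2_triple assms by blast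
  obtain e' f' where tr': "sl2_triple \<alpha> e' f' h'" using coroot_sl2_triple assms by blast
  note t = sl2_tripleD[OF tr] and t' = sl2_tripleD[OF tr']
  obtain c where c: "e' = scale c e" using root_space_one_dim[OF tr t'(2)] by blast
  obtain d where d: "f' = scale d f" using root_space_one_dim[OF sl2_triple_swap[OF tr] t'(3)] by blast
  have "h' = scale (c * d) h"
    using t(4) t'(4) by (auto simp: c d br_scale_left br_scale_right mult.commute)
  moreover from this have "c * d = 1" using t t' dual_scale[OF t(1,5)] by simp
  ultimately show ?thesis by simp
qed

text \<open>Lowering a vector of weight \<open>2 \<alpha>\<close> gives a multiple of \<open>e\<close>, which commutes with \<open>e\<close>; lowering a vector of
  weight \<open>(k + 1) \<alpha>\<close> gives zero by induction.  In both cases a vector of positive weight is excluded.\<close>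

lemma multiple_wt_zero:
  assumes tr: "sl2_triple \<alpha> e f h" and k: "2 \<le> k" and x: "x \<in> wt (\<lambda>t. of_nat k * \<alpha> t)"
  shows "x = 0"
  using k x
proof (induction k arbitrary: x rule: dec_induct)
  case base
  note t = sl2_tripleD[OF tr]
  have "br f x \<in> wt (\<lambda>t. (- \<alpha>) t + of_nat 2 * \<alpha> t)" using wt_br[OF t(3) base] .
  then have "br f x \<in> wt \<alpha>" by simp
  then obtain c where "br f x = scale c e" using root_space_one_dim[OF tr] by blast
  then have "br e (br f x) = 0" by (simp add: br_scale_right br_self)
  then show ?case using sl2_wt_zero[OF tr base, of 4] t(6) by simp
next
  case (step k)
  note t = sl2_tripleD[OF tr]
  have "br f x \<in> wt (\<lambda>t. (- \<alpha>) t + of_nat (Suc k) * \<alpha> t)" using wt_br[OF t(3) step.prems] .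
  then have "br f x \<in> wt (\<lambda>t. of_nat k * \<alpha> t)" by (simp add: algebra_simps)
  then have "br f x = 0" by (rule step.IH)
  then show ?case using sl2_wt_zero[OF tr step.prems, of "2 * Suc k"] t(6) by (simp add: algebra_simps)
qed

text \<open>The next two lemmas produce nonzero brackets: a vector killed by \<open>f\<close> of weight \<open>\<noteq> 0\<close> can be raised once,
  one of weight \<open>- 2\<close> can be raised twice.\<close>

lemma sl2_raise_nonzero:
  assumes tr: "sl2_triple \<alpha> e f h" and x: "x \<in> wt \<beta>" "x \<noteq> 0" and low: "br f x = 0" and "\<beta> h \<noteq> 0"
  shows "br e x \<noteq> 0"
proof
  note t = sl2_tripleD[OF tr]
  assume "br e x = 0"
  then have "br h x = 0" using br_derivation[of e f x] low t(4) by simp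
  then show False using wtD[OF x(1) t(5)] x(2) assms(5) by simp
qed

lemma sl2_raise_twice_nonzero:
  assumes tr: "sl2_triple \<alpha> e f h" and z: "z \<in> wt \<gamma>" "z \<noteq> 0" and low: "br f z = 0" and "\<gamma> h = - 2"
  shows "br e (br e z) \<noteq> 0"
proof
  note t = sl2_tripleD[OF tr]
  assume 0: "br e (br e z) = 0"
  have hz: "br h z = scale (- 2) z" using wtD[OF z(1) t(5)] assms(5) by simp
  have "br h (br e z) = 0"
    using br_derivation[of h e z] by (simp add: hz t(7) br_scale_left br_scale_right)
  moreover have "br f (br e z) = scale 2 z"
    using br_derivation[of e f z] low hz t(4) by (simp add: eq_neg_iff_add_eq_0[symmetric] add_eq_0_iff)
  ultimately have "scale 2 (br e z) = 0"
    using br_derivation[of e f "br e z"] 0 t(4) by (simp add: br_scale_right)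
  then have "br e z = 0" by simp
  moreover have "br e z \<noteq> 0" using sl2_raise_nonzero[OF tr z low] assms(5) by simp
  ultimately show False by simp
qed

text \<open>The automorphism is \<open>exp(ad e) exp(- ad f) exp(ad e)\<close>.  On the span of \<open>H\<close>, \<open>e\<close> and \<open>f\<close> each of the
  exponential series stops after the quadratic term, so its effect on \<open>H\<close> can be computed directly.\<close>

lemma reflection_automorphism:
  assumes tr: "sl2_triple \<alpha> e f h"
  shows "\<exists>\<theta>. (\<forall>c x. \<theta> (scale c x) = scale c (\<theta> x)) \<and> (\<forall>x y. \<theta> (br x y) = br (\<theta> x) (\<theta> y)) \<and>
    (\<forall>x. \<theta> x = 0 \<longrightarrow> x = 0) \<and> (\<forall>t\<in>H. \<theta> t = t - scale (\<alpha> t) h)"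
proof -
  note t = sl2_tripleD[OF tr]
  obtain N1 where N1: "ad_nilpotent N1 e" using sl2_triple_nilpotent[OF tr] by blast
  obtain N2 where N2: "ad_nilpotent N2 f" using sl2_triple_nilpotent[OF sl2_triple_swap[OF tr]] by blast
  define N where "N = N1 + N2 + 3"
  have "ad_nilpotent N e"
    using N1 unfolding ad_nilpotent_def N_def by (auto intro: ad_pow_zero_mono[of N1 e])
  have "ad_nilpotent N f"
    using N2 unfolding ad_nilpotent_def N_def by (auto intro: ad_pow_zero_mono[of N2 f])
  have "(br (- f) ^^ n) x = scale ((- 1) ^ n) ((br f ^^ n) x)" for n x
    by (induction n) (simp_all add: br_scale_right)
  with \<open>ad_nilpotent N f\<close> have "ad_nilpotent N (- f)" by (simp add: ad_nilpotent_def)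
  have N: "3 \<le> N" by (simp add: N_def)
  define \<theta> where "\<theta> x = ad_exp N e (ad_exp N (- f) (ad_exp N e x))" for x
  have "\<theta> k = k - scale (\<alpha> k) h" if k: "k \<in> H" for k
  proof -
    have ek: "br e k = - scale (\<alpha> k) e" using wtD[OF t(2) k] br_anticommute[of e k] by simp
    have fk: "br f k = scale (\<alpha> k) f" using wtD[OF t(3) k] br_anticommute[of f k] by simp
    have eh: "br e h = - scale 2 e" using t(7) br_anticommute[of e h] by simp
    have fh: "br f h = scale 2 f" using t(8) br_anticommute[of f h] by simp
    have exp_e: "ad_exp N e j = j - scale (\<alpha> j) e" if "j \<in> H" for j
    proof -
      have "br e j = - scale (\<alpha> j) e" using wtD[OF t(2) that] br_anticommute[of e j] by simp
      then show ?thesis by (subst ad_exp_quadratic) (simp_all add: N br_scale_right br_self)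
    qed
    have exp_f: "ad_exp N (- f) k = k - scale (\<alpha> k) f"
      by (subst ad_exp_quadratic) (simp_all add: N fk br_scale_right br_self)
    have exp_fe: "ad_exp N (- f) e = e + h - f"
      by (subst ad_exp_quadratic) (simp_all add: N t(9) fh br_scale_right br_self)
    have exp_ef: "ad_exp N e f = f + h - e"
      by (subst ad_exp_quadratic) (simp_all add: N t(4) eh br_scale_right br_self)
    have exp_ee: "ad_exp N e e = e"
      by (subst ad_exp_quadratic) (simp_all add: N br_self)
    have diff: "ad_exp N a (x - y) = ad_exp N a x - ad_exp N a y" for a x y
      using ad_exp_add[of N a x "- y"] ad_exp_scale[of N a "- 1" y] by simp
    show ?thesis
      unfolding \<theta>_def
      by (simp add: exp_e[OF k] exp_e[OF t(5)] diff ad_exp_add ad_exp_scale exp_f exp_fe exp_ef exp_ee t(6)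
          scale_right_distrib scale_right_diff_distrib scale_left_distrib algebra_simps
          flip: scale_left_distrib)
  qed
  moreover have "\<theta> x = 0 \<longrightarrow> x = 0" for x
    using ad_exp_inj \<open>ad_nilpotent N e\<close> \<open>ad_nilpotent N (- f)\<close> unfolding \<theta>_def by blast
  moreover have "\<theta> (br x y) = br (\<theta> x) (\<theta> y)" for x y
    unfolding \<theta>_def by (simp add: ad_exp_br \<open>ad_nilpotent N e\<close> \<open>ad_nilpotent N (- f)\<close>)
  moreover have "\<theta> (scale c x) = scale c (\<theta> x)" for c x
    unfolding \<theta>_def by (simp add: ad_exp_scale)
  ultimately show ?thesis by (intro exI[of _ \<theta>]) blast
qed

definition noncommuting :: "('g \<Rightarrow> complex) \<Rightarrow> ('g \<Rightarrow> complex) \<Rightarrow> bool" where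
  "noncommuting \<beta> \<gamma> \<longleftrightarrow> (\<exists>x\<in>wt \<beta>. \<exists>y\<in>wt \<gamma>. br x y \<noteq> 0)"

text \<open>The automorphism realizes the reflection at \<open>\<alpha>\<close> on \<open>H\<close>, so it carries the root space of \<open>\<beta>\<close> into that
  of the reflected root; since it is injective and preserves brackets, roots go to roots and root spaces
  with nonzero bracket to root spaces with nonzero bracket.\<close>

lemma reflection:
  assumes tr: "sl2_triple \<alpha> e f h"
  defines "s \<equiv> \<lambda>\<beta> t. \<beta> t - \<beta> h * \<alpha> t"
  shows reflection_roots: "\<beta> \<in> roots scale br H \<Longrightarrow> s \<beta> \<in> roots scale br H"
    and reflection_noncommuting: "\<beta> \<in> dual \<Longrightarrow> \<gamma> \<in> dual \<Longrightarrow> noncommuting \<beta> \<gamma> \<Longrightarrow>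
      noncommuting (s \<beta>) (s \<gamma>)"
proof -
  note t = sl2_tripleD[OF tr]
  obtain \<theta> where \<theta>: "\<And>c x. \<theta> (scale c x) = scale c (\<theta> x)" "\<And>x y. \<theta> (br x y) = br (\<theta> x) (\<theta> y)"
    "\<And>x. \<theta> x = 0 \<Longrightarrow> x = 0" "\<And>t. t \<in> H \<Longrightarrow> \<theta> t = t - scale (\<alpha> t) h"
    using reflection_automorphism[OF tr] by blast
  have wt: "\<theta> x \<in> wt (s \<beta>)" if x: "x \<in> wt \<beta>" and \<beta>: "\<beta> \<in> dual" for x \<beta>
    unfolding root_space_def
  proof (rule CollectI, rule ballI)
    fix k assume k: "k \<in> H"
    \<comment> \<open>The reflection of \<open>k\<close>, which the automorphism sends back to \<open>k\<close>.\<close>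
    define k' where "k' = k - scale (\<alpha> k) h"
    have sh: "scale (\<alpha> k) h \<in> H" using H_subspace t(5) by (rule subspace_scale)
    then have k': "k' \<in> H" unfolding k'_def using H_subspace k by (intro subspace_diff)
    have "\<alpha> k' = - \<alpha> k"
      by (simp add: k'_def dual_diff[OF t(1) k sh] dual_scale[OF t(1,5)] t(6))
    then have "\<theta> k' = k" using \<theta>(4)[OF k'] by (simp add: k'_def)
    then have "br k (\<theta> x) = \<theta> (br k' x)" by (simp add: \<theta>(2))
    also have "\<dots> = scale (\<beta> k') (\<theta> x)" by (simp add: wtD[OF x k'] \<theta>(1))
    also have "\<beta> k' = s \<beta> k"
      by (simp add: k'_def s_def dual_diff[OF \<beta> k sh] dual_scale[OF \<beta> t(5)] mult.commute)
    finally show "br k (\<theta> x) = scale (s \<beta> k) (\<theta> x)" .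
  qed
  show "s \<beta> \<in> roots scale br H" if root: "\<beta> \<in> roots scale br H"
  proof -
    have \<beta>: "\<beta> \<in> dual" "\<beta> \<noteq> 0" "wt \<beta> \<noteq> {0}" using root unfolding roots_def by blast+
    then obtain x where x: "x \<in> wt \<beta>" "x \<noteq> 0" using wt_zero by blast
    have "s \<beta> \<in> dual"
      using \<beta>(1) t(1) unfolding s_def dual_on_def by (auto simp: algebra_simps)
    moreover have "s \<beta> \<noteq> 0"
    proof
      assume 0: "s \<beta> = 0"
      then have "s \<beta> h = 0" by simp
      then have "\<beta> h = 0" by (simp add: s_def t(6))
      with 0 have "\<beta> k = 0" for k using fun_cong[OF 0, of k] by (simp add: s_def)
      with \<beta>(2) show False by (auto simp: fun_eq_iff)
    qed
    ultimately show ?thesis using wt[OF x(1) \<beta>(1)] x(2) \<theta>(3) by (blast intro: rootsI)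
  qed
  show "noncommuting (s \<beta>) (s \<gamma>)" if "\<beta> \<in> dual" "\<gamma> \<in> dual" "noncommuting \<beta> \<gamma>"
  proof -
    from that(3) obtain x y where xy: "x \<in> wt \<beta>" "y \<in> wt \<gamma>" "br x y \<noteq> 0"
      unfolding noncommuting_def by blast
    then have "br (\<theta> x) (\<theta> y) \<noteq> 0" using \<theta>(2,3) by metis
    then show ?thesis unfolding noncommuting_def using wt xy that by blast
  qed
qed

end

declare One_nat_def [simp del]

section \<open>Parabolic ideals of positive roots in coordinates\<close>

text \<open>Roots of type B are integer vectors \<open>b\<close> indexed by \<open>1, \<dots>, l\<close>, standing for \<open>\<Sum>\<^sub>i b\<^sub>i \<epsilon>\<^sub>i\<close>; here
  \<open>\<alpha>\<^sub>i = \<epsilon>\<^sub>i - \<epsilon>\<^sub>i\<^sub>+\<^sub>1\<close> for \<open>i < l\<close> and \<open>\<alpha>\<^sub>l = \<epsilon>\<^sub>l\<close>.\<close>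

definition unit_vec :: "nat \<Rightarrow> nat \<Rightarrow> int" where
  "unit_vec i = (\<lambda>k. if k = i then 1 else 0)"

text \<open>The coefficient of the simple root \<open>\<alpha>\<^sub>t\<close> in the combination given by \<open>b\<close>.\<close>

definition psum :: "(nat \<Rightarrow> int) \<Rightarrow> nat \<Rightarrow> int" where
  "psum b t = (\<Sum>k=1..t. b k)"

lemma psum_add [simp]: "psum (b + b') t = psum b t + psum b' t"
  and psum_diff [simp]: "psum (b - b') t = psum b t - psum b' t"
  and psum_uminus [simp]: "psum (- b) t = - psum b t"
  by (simp_all add: psum_def sum.distrib sum_subtractf sum_negf)

lemma psum_unit_vec [simp]: "psum (unit_vec i) t = (if 1 \<le> i \<and> i \<le> t then 1 else 0)"
  by (auto simp: psum_def unit_vec_def)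

definition B_pos :: "nat \<Rightarrow> (nat \<Rightarrow> int) set" where
  "B_pos l = {unit_vec i | i. 1 \<le> i \<and> i \<le> l}
     \<union> {unit_vec i + unit_vec j | i j. 1 \<le> i \<and> i < j \<and> j \<le> l}
     \<union> {unit_vec i - unit_vec j | i j. 1 \<le> i \<and> i < j \<and> j \<le> l}"

definition B_roots :: "nat \<Rightarrow> (nat \<Rightarrow> int) set" where
  "B_roots l = B_pos l \<union> uminus ` B_pos l"

lemma B_pos_cases [consumes 1, case_names short sum diff]:
  assumes "b \<in> B_pos l"
  obtains i where "1 \<le> i" "i \<le> l" "b = unit_vec i"
  | i j where "1 \<le> i" "i < j" "j \<le> l" "b = unit_vec i + unit_vec j"
  | i j where "1 \<le> i" "i < j" "j \<le> l" "b = unit_vec i - unit_vec j"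
  using assms unfolding B_pos_def by blast

lemma unit_vec_in_B_pos: "1 \<le> i \<Longrightarrow> i \<le> l \<Longrightarrow> unit_vec i \<in> B_pos l"
  and unit_vec_diff_in_B_pos: "1 \<le> i \<Longrightarrow> i < j \<Longrightarrow> j \<le> l \<Longrightarrow> unit_vec i - unit_vec j \<in> B_pos l"
  unfolding B_pos_def by blast+

lemma unit_vec_sum_in_B_pos:
  assumes "1 \<le> i" "1 \<le> j" "i \<le> l" "j \<le> l" "i \<noteq> j"
  shows "unit_vec i + unit_vec j \<in> B_pos l"
proof (cases "i < j")
  case True
  then show ?thesis using assms unfolding B_pos_def by blast
next
  case False
  then have "j < i" using assms by simp
  moreover have "unit_vec i + unit_vec j = unit_vec j + unit_vec i" by (simp add: add.commute)
  ultimately show ?thesis using assms unfolding B_pos_def by blast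
qed

lemma psum_B_pos_nonneg: "b \<in> B_pos l \<Longrightarrow> 0 \<le> psum b t"
  by (erule B_pos_cases) auto

lemma psum_B_pos_le_2: "b \<in> B_pos l \<Longrightarrow> psum b t \<le> 2"
  by (erule B_pos_cases) auto

lemma psum_B_pos_1_le_1: "b \<in> B_pos l \<Longrightarrow> psum b 1 \<le> 1"
  by (erule B_pos_cases) auto

lemma unit_vec_sum_eq:
  assumes "unit_vec i + unit_vec j = unit_vec i' + unit_vec j'" "i < j" "i' < j'"
  shows "i = i' \<and> j = j'"
proof -
  have at: "unit_vec i k + unit_vec j k = unit_vec i' k + unit_vec j' k" for k
    using fun_cong[OF assms(1), of k] by simp
  show ?thesis using at[of i] at[of j] assms(2,3) by (auto simp: unit_vec_def split: if_splits)
qed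

lemma unit_vec_diff_eq:
  assumes "unit_vec i - unit_vec j = unit_vec i' - unit_vec j'" "i < j" "i' < j'"
  shows "i = i' \<and> j = j'"
proof -
  have at: "unit_vec i k - unit_vec j k = unit_vec i' k - unit_vec j' k" for k
    using fun_cong[OF assms(1), of k] by simp
  show ?thesis using at[of i] at[of j] assms(2,3) by (auto simp: unit_vec_def split: if_splits)
qed

definition levi_roots :: "nat \<Rightarrow> nat set \<Rightarrow> (nat \<Rightarrow> int) set" where
  "levi_roots l J = {b \<in> B_roots l. \<forall>t \<in> {1..l} - J. psum b t = 0}"

text \<open>The sets of positive roots in \<open>\<F>\<^sub>I\<close>, in coordinates.\<close>

definition par_ideals :: "nat \<Rightarrow> nat set \<Rightarrow> (nat \<Rightarrow> int) set set" where
  "par_ideals l J =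
     {\<Phi>. \<Phi> \<subseteq> B_pos l - levi_roots l J \<and>
         (\<forall>\<beta>\<in>\<Phi>. \<forall>\<gamma> \<in> B_pos l \<union> levi_roots l J. \<beta> + \<gamma> \<in> B_pos l \<longrightarrow> \<beta> + \<gamma> \<in> \<Phi>)}"

lemma par_ideals_closed:
  assumes "\<Phi> \<in> par_ideals l J" "\<beta> \<in> \<Phi>" "\<gamma> \<in> B_pos l \<union> levi_roots l J" "\<delta> \<in> B_pos l" "\<delta> = \<beta> + \<gamma>"
  shows "\<delta> \<in> \<Phi>"
  using assms unfolding par_ideals_def by blast

lemma par_ideals_sub: "\<Phi> \<in> par_ideals l J \<Longrightarrow> \<beta> \<in> \<Phi> \<Longrightarrow> \<beta> \<in> B_pos l"
  unfolding par_ideals_def by blast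

lemma psum_parabolic_nonneg:
  assumes "\<gamma> \<in> B_pos l \<union> levi_roots l J" "t \<in> {1..l} - J"
  shows "0 \<le> psum \<gamma> t"
  using assms psum_B_pos_nonneg unfolding levi_roots_def by fastforce

text \<open>Either the difference is a positive root, or both indices are in the same block and it is a Levi root.
  So adding it moves an index of a root to any block that is at most as large.\<close>

lemma unit_vec_diff_parabolic:
  assumes "i \<in> {1..l}" "j \<in> {1..l}" "i \<noteq> j" "block J i \<le> block J j"
  shows "unit_vec i - unit_vec j \<in> B_pos l \<union> levi_roots l J"
proof (cases "i < j")
  case True
  then show ?thesis using assms unit_vec_diff_in_B_pos by simp
next
  case False
  then have "j < i" using assms by simp
  then have "unit_vec j - unit_vec i \<in> B_pos l" using assms unit_vec_diff_in_B_pos by simp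
  then have "- (unit_vec j - unit_vec i) \<in> B_roots l" unfolding B_roots_def by blast
  then have "unit_vec i - unit_vec j \<in> B_roots l" by simp
  moreover have "{j..<i} \<subseteq> J" using assms block_le_iff[of j J i] by simp
  then have "j \<le> t \<longleftrightarrow> i \<le> t" if "t \<in> {1..l} - J" for t
    using that \<open>j < i\<close> by (meson DiffD2 atLeastLessThan_iff leD leI less_imp_le_nat order.trans subsetD)
  then have "psum (unit_vec i - unit_vec j) t = 0" if "t \<in> {1..l} - J" for t
    using that assms by auto
  ultimately show ?thesis unfolding levi_roots_def by blast
qed

lemma minus_unit_vec_levi:
  assumes "1 \<le> j" "j \<le> l" "{j..l} \<subseteq> J"
  shows "- unit_vec j \<in> levi_roots l J"
proof -
  have "- unit_vec j \<in> B_roots l" using unit_vec_in_B_pos[of j l] assms unfolding B_roots_def by blast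
  moreover have "psum (- unit_vec j) t = 0" if "t \<in> {1..l} - J" for t
    using that assms by auto
  ultimately show ?thesis unfolding levi_roots_def by blast
qed

lemma par_ideals_move_index:
  assumes \<Phi>: "\<Phi> \<in> par_ideals l J" and mem: "unit_vec i + unit_vec j \<in> \<Phi>"
    and rng: "i \<in> {1..l}" "j \<in> {1..l}" "k \<in> {1..l}" and "k \<noteq> j" "block J k \<le> block J i"
  shows "unit_vec k + unit_vec j \<in> \<Phi>"
proof (cases "k = i")
  case False
  have "unit_vec k + unit_vec j = (unit_vec i + unit_vec j) + (unit_vec k - unit_vec i)" by simp
  then show ?thesis
    using assms False unit_vec_diff_parabolic[of k l i J] unit_vec_sum_in_B_pos[of k j l]
    by (intro par_ideals_closed[OF \<Phi> mem]) auto
qed (use mem in simp)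

text \<open>The two indices are moved one after the other; the order has to be chosen such that they never meet.\<close>

lemma par_ideals_sum_closed:
  assumes \<Phi>: "\<Phi> \<in> par_ideals l J" and mem: "unit_vec i + unit_vec j \<in> \<Phi>"
    and "1 \<le> i" "i < j" "j \<le> l" "1 \<le> i'" "i' < j'" "j' \<le> l"
    and "block J i' \<le> block J i" "block J j' \<le> block J j"
  shows "unit_vec i' + unit_vec j' \<in> \<Phi>"
proof (cases "i' = j")
  case False
  have "unit_vec i' + unit_vec j \<in> \<Phi>"
    by (rule par_ideals_move_index[OF \<Phi> mem]) (use assms False in auto)
  then have "unit_vec j + unit_vec i' \<in> \<Phi>" by (simp add: add.commute)
  then have "unit_vec j' + unit_vec i' \<in> \<Phi>"
    by (rule par_ideals_move_index[OF \<Phi>]) (use assms in auto)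
  then show ?thesis by (simp add: add.commute)
next
  case True
  from mem have "unit_vec j + unit_vec i \<in> \<Phi>" by (simp add: add.commute)
  then have "unit_vec j' + unit_vec i \<in> \<Phi>"
    by (rule par_ideals_move_index[OF \<Phi>]) (use assms True in auto)
  then have "unit_vec i + unit_vec j' \<in> \<Phi>" by (simp add: add.commute)
  then show ?thesis
    by (rule par_ideals_move_index[OF \<Phi>]) (use assms True in auto)
qed

text \<open>Coefficients at simple roots outside \<open>J\<close> never decrease when a root of the parabolic subalgebra is added.
  The coefficient of \<open>\<epsilon>\<^sub>i + \<epsilon>\<^sub>j\<close> is 2 at a cut behind \<open>j\<close>, which forces the shape \<open>\<epsilon>\<^sub>i' + \<epsilon>\<^sub>j'\<close>, and
  comparing coefficients at the other cuts shows that blocks of indices only go down.\<close>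

lemma block_ideal_sum_upper:
  assumes S: "S \<in> block_ideals l J" and ij: "(i, j) \<in> S" and \<delta>: "\<delta> \<in> B_pos l"
    and le: "\<And>t. t \<in> {1..l} - J \<Longrightarrow> psum (unit_vec i + unit_vec j) t \<le> psum \<delta> t"
  shows "\<exists>i' j'. (i', j') \<in> S \<and> \<delta> = unit_vec i' + unit_vec j'"
proof -
  note rng = block_idealsD[OF S ij]
  have "\<not> {j..l} \<subseteq> J" using rng block_le_num_blocks_iff[of j J l] by simp
  then obtain t where t: "t \<in> {j..l}" "t \<notin> J" by blast
  then have "2 \<le> psum \<delta> t" using le[of t] rng by simp
  with \<delta> obtain i' j' where \<delta>': "1 \<le> i'" "i' < j'" "j' \<le> l" "\<delta> = unit_vec i' + unit_vec j'"
    by (cases rule: B_pos_cases) (auto split: if_splits)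
  have "{i..<i'} \<subseteq> J"
  proof
    fix t assume t: "t \<in> {i..<i'}"
    show "t \<in> J" using le[of t] t rng \<delta>' by (cases "t \<in> J") (auto split: if_splits)
  qed
  moreover have "{j..<j'} \<subseteq> J"
  proof
    fix t assume t: "t \<in> {j..<j'}"
    show "t \<in> J" using le[of t] t rng \<delta>' by (cases "t \<in> J") (auto split: if_splits)
  qed
  ultimately have "(i', j') \<in> S"
    using rng \<delta>' by (intro block_ideals_closed[OF S ij]) (simp_all add: block_le_iff)
  then show ?thesis using \<delta>' by blast
qed

lemma sum_root_notin_levi:
  assumes "1 \<le> i" "i < j" "j \<le> l" "block J j \<le> num_blocks l J"
  shows "unit_vec i + unit_vec j \<notin> levi_roots l J"
proof -
  have "\<not> {j..l} \<subseteq> J" using assms block_le_num_blocks_iff[of j J l] by simp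
  then obtain t where "t \<in> {j..l}" "t \<notin> J" by blast
  then have "t \<in> {1..l} - J" "psum (unit_vec i + unit_vec j) t = 2" using assms by auto
  then show ?thesis unfolding levi_roots_def by force
qed

section \<open>Abelian ideals\<close>

text \<open>The two shapes of an abelian ideal, depending on whether it contains \<open>\<epsilon>\<^sub>1\<close>.  The second one arises from the
  first: the row of the roots \<open>\<epsilon>\<^sub>1 + \<epsilon>\<^sub>j\<close> is completed, and \<open>\<epsilon>\<^sub>1 - \<epsilon>\<^sub>j\<close> is present iff \<open>\<epsilon>\<^sub>1 + \<epsilon>\<^sub>j\<close> was
  absent.\<close>

definition sum_roots :: "(nat \<times> nat) set \<Rightarrow> (nat \<Rightarrow> int) set" where
  "sum_roots S = {unit_vec i + unit_vec j | i j. (i, j) \<in> S}"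

definition hook_roots :: "nat \<Rightarrow> (nat \<times> nat) set \<Rightarrow> (nat \<Rightarrow> int) set" where
  "hook_roots l S = {unit_vec 1} \<union> {unit_vec 1 + unit_vec j | j. 2 \<le> j \<and> j \<le> l}
     \<union> {unit_vec 1 - unit_vec j | j. 2 \<le> j \<and> j \<le> l \<and> (1, j) \<notin> S}
     \<union> {unit_vec i + unit_vec j | i j. 2 \<le> i \<and> (i, j) \<in> S}"

lemma hook_roots_cases [consumes 1, case_names short first_sum first_diff sum]:
  assumes "b \<in> hook_roots l S"
  obtains "b = unit_vec 1"
  | j where "2 \<le> j" "j \<le> l" "b = unit_vec 1 + unit_vec j"
  | j where "2 \<le> j" "j \<le> l" "(1, j) \<notin> S" "b = unit_vec 1 - unit_vec j"
  | i j where "2 \<le> i" "(i, j) \<in> S" "b = unit_vec i + unit_vec j"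
  using assms unfolding hook_roots_def by blast

text \<open>The predicate \<open>commute\<close> stands for root spaces with zero bracket.  An ideal is abelian iff the root spaces
  of its roots commute pairwise, and the classification rests on the three properties assumed here:
  root spaces commute if the sum of the roots is no root, and two kinds of pairs do not commute.\<close>

locale B_ideal_count =
  fixes l :: nat and J :: "nat set" and commute :: "(nat \<Rightarrow> int) \<Rightarrow> (nat \<Rightarrow> int) \<Rightarrow> bool"
  assumes l_pos: "1 \<le> l" and J_sub: "J \<subseteq> {1..l}"
    and commuteI: "\<And>b c. b \<in> B_pos l \<Longrightarrow> c \<in> B_pos l \<Longrightarrow> b + c \<notin> B_pos l \<Longrightarrow> commute b c"
    and short_not_commute: "\<And>i j. i \<in> {1..l} \<Longrightarrow> j \<in> {1..l} \<Longrightarrow> i \<noteq> j \<Longrightarrow>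
      \<not> commute (unit_vec i) (unit_vec j)"
    and hook_not_commute: "\<And>i j. i \<in> {2..l} \<Longrightarrow> j \<in> {2..l} \<Longrightarrow> i \<noteq> j \<Longrightarrow>
      \<not> commute (unit_vec 1 - unit_vec j) (unit_vec j + unit_vec i)"
begin

definition ab_ideals :: "(nat \<Rightarrow> int) set set" where
  "ab_ideals = {\<Phi> \<in> par_ideals l J. \<forall>\<beta>\<in>\<Phi>. \<forall>\<gamma>\<in>\<Phi>. commute \<beta> \<gamma>}"

lemma sum_roots_in_ab_ideals:
  assumes S: "S \<in> block_ideals l J"
  shows "sum_roots S \<in> ab_ideals" "unit_vec 1 \<notin> sum_roots S"
proof -
  have pos: "\<beta> \<in> B_pos l \<and> \<beta> \<notin> levi_roots l J \<and> psum \<beta> l = 2" if "\<beta> \<in> sum_roots S" for \<beta>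
  proof -
    from that obtain i j where ij: "(i, j) \<in> S" "\<beta> = unit_vec i + unit_vec j"
      unfolding sum_roots_def by blast
    note rng = block_idealsD[OF S ij(1)]
    show ?thesis using ij rng sum_root_notin_levi[OF rng] by (auto intro: unit_vec_sum_in_B_pos)
  qed
  show "unit_vec 1 \<notin> sum_roots S"
  proof
    assume "unit_vec 1 \<in> sum_roots S"
    then have "psum (unit_vec 1) l = 2" using pos by blast
    then show False by (simp split: if_splits)
  qed
  have "\<beta> + \<gamma> \<in> sum_roots S"
    if "\<beta> \<in> sum_roots S" "\<gamma> \<in> B_pos l \<union> levi_roots l J" "\<beta> + \<gamma> \<in> B_pos l" for \<beta> \<gamma>
  proof -
    from that obtain i j where ij: "(i, j) \<in> S" "\<beta> = unit_vec i + unit_vec j"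
      unfolding sum_roots_def by blast
    have "psum (unit_vec i + unit_vec j) t \<le> psum (\<beta> + \<gamma>) t" if "t \<in> {1..l} - J" for t
      using psum_parabolic_nonneg[OF \<open>\<gamma> \<in> _\<close> that] by (simp add: ij)
    then show ?thesis
      using block_ideal_sum_upper[OF S ij(1) that(3)] unfolding sum_roots_def by blast
  qed
  then have "sum_roots S \<in> par_ideals l J" using pos unfolding par_ideals_def by blast
  moreover have "commute \<beta> \<gamma>" if "\<beta> \<in> sum_roots S" "\<gamma> \<in> sum_roots S" for \<beta> \<gamma>
  proof (rule commuteI)
    show "\<beta> + \<gamma> \<notin> B_pos l" using pos[OF that(1)] pos[OF that(2)] psum_B_pos_le_2[of "\<beta> + \<gamma>" l l] by auto
  qed (use that pos in blast)+
  ultimately show "sum_roots S \<in> ab_ideals" unfolding ab_ideals_def by blast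
qed

lemma sum_mem_not_last_block:
  assumes \<Phi>: "\<Phi> \<in> ab_ideals" and mem: "unit_vec i + unit_vec j \<in> \<Phi>"
    and ij: "1 \<le> i" "i < j" "j \<le> l" and short: "unit_vec i \<notin> \<Phi>"
  shows "block J j \<le> num_blocks l J"
proof (rule ccontr)
  assume "\<not> ?thesis"
  then have "{j..l} \<subseteq> J" using ij block_le_num_blocks_iff[of j J l] by simp
  then have "- unit_vec j \<in> levi_roots l J" using ij minus_unit_vec_levi by simp
  moreover have "unit_vec i = (unit_vec i + unit_vec j) + (- unit_vec j)" by simp
  ultimately have "unit_vec i \<in> \<Phi>"
    using \<Phi> mem ij unit_vec_in_B_pos[of i l] unfolding ab_ideals_def
    by (blast intro: par_ideals_closed less_imp_le order.trans less_imp_le_nat)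
  with short show False by blast
qed

text \<open>An ideal with \<open>\<epsilon>\<^sub>i\<close> contains \<open>\<epsilon>\<^sub>1\<close> as well, and the two root spaces do not commute for \<open>i \<noteq> 1\<close>.\<close>

lemma short_mem:
  assumes \<Phi>: "\<Phi> \<in> ab_ideals" and mem: "unit_vec i \<in> \<Phi>" and i: "i \<in> {1..l}"
  shows "i = 1"
proof (rule ccontr)
  assume "i \<noteq> 1"
  then have "unit_vec 1 - unit_vec i \<in> B_pos l" using i by (intro unit_vec_diff_in_B_pos) auto
  moreover have "unit_vec 1 = unit_vec i + (unit_vec 1 - unit_vec i)" by simp
  ultimately have "unit_vec 1 \<in> \<Phi>"
    using \<Phi> mem l_pos unit_vec_in_B_pos[of 1 l] unfolding ab_ideals_def
    by (blast intro: par_ideals_closed)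
  with \<Phi> mem short_not_commute[of 1 i] i \<open>i \<noteq> 1\<close> show False
    unfolding ab_ideals_def by auto
qed

lemma diff_mem:
  assumes \<Phi>: "\<Phi> \<in> ab_ideals" and mem: "unit_vec i - unit_vec j \<in> \<Phi>" and "1 \<le> i" "i < j" "j \<le> l"
  shows "i = 1" "unit_vec 1 \<in> \<Phi>"
proof -
  have "unit_vec i = (unit_vec i - unit_vec j) + unit_vec j" by simp
  then have "unit_vec i \<in> \<Phi>"
    using \<Phi> assms unit_vec_in_B_pos[of i l] unit_vec_in_B_pos[of j l] unfolding ab_ideals_def
    by (auto intro: par_ideals_closed)
  then show "i = 1" "unit_vec 1 \<in> \<Phi>" using short_mem[OF \<Phi>, of i] assms by auto
qed

lemma ab_ideals_without_short:
  assumes \<Phi>: "\<Phi> \<in> ab_ideals" and no: "unit_vec 1 \<notin> \<Phi>"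
  shows "\<Phi> \<in> sum_roots ` block_ideals l J"
proof -
  define S where "S = {(i, j). 1 \<le> i \<and> i < j \<and> j \<le> l \<and> unit_vec i + unit_vec j \<in> \<Phi>}"
  have par: "\<Phi> \<in> par_ideals l J" using \<Phi> unfolding ab_ideals_def by blast
  have short: "unit_vec i \<notin> \<Phi>" if "i \<in> {1..l}" for i
    using short_mem[OF \<Phi> _ that] no by blast
  have "\<Phi> = sum_roots S"
  proof (intro equalityI subsetI)
    fix b assume b: "b \<in> \<Phi>"
    with par have "b \<in> B_pos l" by (blast intro: par_ideals_sub)
    then show "b \<in> sum_roots S"
    proof (cases rule: B_pos_cases)
      case (short i)
      with b \<open>\<And>i. i \<in> {1..l} \<Longrightarrow> unit_vec i \<notin> \<Phi>\<close> show ?thesis by auto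
    next
      case (sum i j)
      with b show ?thesis unfolding sum_roots_def S_def by blast
    next
      case (diff i j)
      with b diff_mem(2)[OF \<Phi>] no show ?thesis by blast
    qed
  qed (auto simp: sum_roots_def S_def)
  moreover have "S \<in> block_ideals l J"
  proof (rule block_idealsI)
    fix i j assume "(i, j) \<in> S"
    then show "1 \<le> i \<and> i < j \<and> j \<le> l \<and> block J j \<le> num_blocks l J"
      using sum_mem_not_last_block[OF \<Phi>, of i j] short[of i] unfolding S_def by auto
  next
    fix i j i' j'
    assume "(i, j) \<in> S" "1 \<le> i'" "i' < j'" "j' \<le> l" "block J i' \<le> block J i" "block J j' \<le> block J j"
    then show "(i', j') \<in> S" using par_ideals_sum_closed[OF par, of i j i' j'] unfolding S_def by auto
  qed
  ultimately show ?thesis by blast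
qed

lemma inj_on_sum_roots: "inj_on sum_roots (block_ideals l J)"
proof (rule inj_onI)
  have "S \<subseteq> T" if S: "S \<in> block_ideals l J" and T: "T \<in> block_ideals l J" and "sum_roots S = sum_roots T" for S T
  proof
    fix p assume "p \<in> S"
    then obtain i j where p: "p = (i, j)" "(i, j) \<in> S" by (cases p) auto
    then have "unit_vec i + unit_vec j \<in> sum_roots T"
      using that(3) unfolding sum_roots_def by blast
    then obtain i' j' where q: "(i', j') \<in> T" "unit_vec i + unit_vec j = unit_vec i' + unit_vec j'"
      unfolding sum_roots_def by blast
    then show "p \<in> T"
      using unit_vec_sum_eq[OF q(2)] block_idealsD(2)[OF S p(2)] block_idealsD(2)[OF T q(1)] p by simp
  qed
  then show "S = T" if "S \<in> block_ideals l J" "T \<in> block_ideals l J" "sum_roots S = sum_roots T" for S T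
    using that by (metis subset_antisym)
qed

lemma card_without_short: "card {\<Phi> \<in> ab_ideals. unit_vec 1 \<notin> \<Phi>} = card (block_ideals l J)"
proof -
  have "{\<Phi> \<in> ab_ideals. unit_vec 1 \<notin> \<Phi>} = sum_roots ` block_ideals l J"
    using sum_roots_in_ab_ideals ab_ideals_without_short by blast
  then show ?thesis by (simp add: card_image inj_on_sum_roots)
qed

lemma first_diff_closed:
  assumes \<Phi>: "\<Phi> \<in> par_ideals l J" and mem: "unit_vec 1 - unit_vec j' \<in> \<Phi>"
    and "j \<in> {2..l}" "j' \<in> {2..l}" "block J j' \<le> block J j"
  shows "unit_vec 1 - unit_vec j \<in> \<Phi>"
proof (cases "j = j'")
  case False
  have "unit_vec 1 - unit_vec j = (unit_vec 1 - unit_vec j') + (unit_vec j' - unit_vec j)" by simp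
  then show ?thesis
    using assms False unit_vec_diff_parabolic[of j' l j J] unit_vec_diff_in_B_pos[of 1 j l]
    by (intro par_ideals_closed[OF \<Phi> mem]) auto
qed (use mem in simp)

text \<open>Let the first row of \<open>S\<close> record which \<open>\<epsilon>\<^sub>1 - \<epsilon>\<^sub>j\<close> are missing.  If \<open>\<epsilon>\<^sub>i + \<epsilon>\<^sub>j\<close> with \<open>i \<ge> 2\<close> is in the
  ideal, then \<open>\<epsilon>\<^sub>1 - \<epsilon>\<^sub>j\<close> is missing because the two do not commute: this makes \<open>S\<close> closed.\<close>

lemma ab_ideals_with_short:
  assumes \<Phi>: "\<Phi> \<in> ab_ideals" and yes: "unit_vec 1 \<in> \<Phi>" and J1: "1 \<notin> J"
  shows "\<Phi> \<in> hook_roots l ` block_ideals l J"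
proof -
  define S where "S = {(i, j). 2 \<le> i \<and> i < j \<and> j \<le> l \<and> unit_vec i + unit_vec j \<in> \<Phi>}
    \<union> {(1, j) | j. 2 \<le> j \<and> j \<le> l \<and> unit_vec 1 - unit_vec j \<notin> \<Phi>}"
  have S1: "(1, j) \<in> S \<longleftrightarrow> 2 \<le> j \<and> j \<le> l \<and> unit_vec 1 - unit_vec j \<notin> \<Phi>" for j
    by (auto simp: S_def)
  have S2: "(i, j) \<in> S \<longleftrightarrow> i < j \<and> j \<le> l \<and> unit_vec i + unit_vec j \<in> \<Phi>" if "2 \<le> i" for i j
    using that by (auto simp: S_def)
  have S0: "1 \<le> i \<and> i < j \<and> j \<le> l" if "(i, j) \<in> S" for i j
    using that by (auto simp: S_def)
  have par: "\<Phi> \<in> par_ideals l J" and comm: "\<And>b c. b \<in> \<Phi> \<Longrightarrow> c \<in> \<Phi> \<Longrightarrow> commute b c"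
    using \<Phi> unfolding ab_ideals_def by blast+
  have first_sum: "unit_vec 1 + unit_vec j \<in> \<Phi>" if "2 \<le> j" "j \<le> l" for j
    using that by (intro par_ideals_closed[OF par yes, of "unit_vec j"])
      (auto intro: unit_vec_in_B_pos unit_vec_sum_in_B_pos)
  have short: "unit_vec i \<notin> \<Phi>" if "i \<in> {2..l}" for i
    using short_mem[OF \<Phi>, of i] that by auto
  have "\<Phi> = hook_roots l S"
  proof (intro equalityI subsetI)
    fix b assume b: "b \<in> \<Phi>"
    with par have "b \<in> B_pos l" by (blast intro: par_ideals_sub)
    then show "b \<in> hook_roots l S"
    proof (cases rule: B_pos_cases)
      case (short i)
      with b short_mem[OF \<Phi>, of i] show ?thesis by (auto simp: hook_roots_def)
    next
      case (sum i j)
      show ?thesis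
      proof (cases "i = 1")
        case True
        with sum show ?thesis unfolding hook_roots_def by auto
      next
        case False
        with sum b S2[of i j] have "2 \<le> i" "(i, j) \<in> S" by auto
        with sum show ?thesis unfolding hook_roots_def by blast
      qed
    next
      case (diff i j)
      with b diff_mem(1)[OF \<Phi>, of i j] have "i = 1" by simp
      with diff b S1[of j] show ?thesis unfolding hook_roots_def by auto
    qed
  next
    fix b assume "b \<in> hook_roots l S"
    then show "b \<in> \<Phi>"
      by (cases rule: hook_roots_cases) (auto simp: yes first_sum S1 S2)
  qed
  moreover have "S \<in> block_ideals l J"
  proof (rule block_idealsI)
    fix i j assume ij: "(i, j) \<in> S"
    have "block J j \<le> num_blocks l J"
    proof (cases "i = 1")
      case False
      then have "2 \<le> i" using S0[OF ij] by simp
      then show ?thesis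
        using sum_mem_not_last_block[OF \<Phi>, of i j] short[of i] S0[OF ij] S2 ij by auto
    next
      case True
      show ?thesis
      proof (rule ccontr)
        assume "\<not> ?thesis"
        then have "{j..l} \<subseteq> J" using S0[OF ij] block_le_num_blocks_iff[of j J l] by simp
        then have "- unit_vec j \<in> levi_roots l J" using S0[OF ij] minus_unit_vec_levi by simp
        then have "unit_vec 1 - unit_vec j \<in> \<Phi>"
          using S0[OF ij] True
          by (intro par_ideals_closed[OF par yes]) (auto intro: unit_vec_diff_in_B_pos)
        with S1 ij True show False by blast
      qed
    qed
    with S0[OF ij] show "1 \<le> i \<and> i < j \<and> j \<le> l \<and> block J j \<le> num_blocks l J" by blast
  next
    fix i j i' j'
    assume ij: "(i, j) \<in> S" and rng: "1 \<le> i'" "i' < j'" "j' \<le> l"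
      and le: "block J i' \<le> block J i" "block J j' \<le> block J j"
    note ij' = S0[OF ij]
    have diff: "unit_vec 1 - unit_vec j \<in> \<Phi>" if "unit_vec 1 - unit_vec j' \<in> \<Phi>"
      using first_diff_closed[OF par that, of j] rng ij' le by auto
    show "(i', j') \<in> S"
    proof (cases "i = 1")
      case True
      \<comment> \<open>There is a cut behind 1, so the first block is \<open>{1}\<close>.\<close>
      have "i' = 1"
      proof (rule ccontr)
        assume "i' \<noteq> 1"
        then have "1 \<in> {i..<i'}" using True rng by simp
        moreover have "{i..<i'} \<subseteq> J" using le(1) block_le_iff[of i J i'] True by simp
        ultimately show False using J1 by blast
      qed
      then show ?thesis using diff S1 ij True rng by auto
    next
      case False
      then have i: "2 \<le> i" using ij' by simp
      then have mem: "unit_vec i + unit_vec j \<in> \<Phi>" using S2 ij by blast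
      show ?thesis
      proof (cases "i' = 1")
        case True
        have "\<not> commute (unit_vec 1 - unit_vec j) (unit_vec j + unit_vec i)"
          using hook_not_commute[of i j] i ij' by simp
        then have "unit_vec 1 - unit_vec j \<notin> \<Phi>"
          using comm mem by (metis add.commute)
        then show ?thesis using diff S1 True rng by auto
      next
        case False
        then have "2 \<le> i'" using rng by simp
        then show ?thesis
          using par_ideals_sum_closed[OF par mem, of i' j'] ij' rng le S2 by simp
      qed
    qed
  qed
  ultimately show ?thesis by blast
qed

lemma hook_roots_first_diff:
  assumes S: "S \<in> block_ideals l J" and j: "j \<in> {2..l}"
  shows "unit_vec 1 - unit_vec j \<in> hook_roots l S \<longleftrightarrow> (1, j) \<notin> S"
proof
  have c: "psum (unit_vec 1 - unit_vec j) l = 0" "psum (unit_vec 1 - unit_vec j) 1 = 1" using j by auto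
  assume "unit_vec 1 - unit_vec j \<in> hook_roots l S"
  then show "(1, j) \<notin> S"
  proof (cases rule: hook_roots_cases)
    case short
    from arg_cong[OF short, of "\<lambda>b. psum b l"] c l_pos show ?thesis by simp
  next
    case (first_sum k)
    from arg_cong[OF first_sum(3), of "\<lambda>b. psum b l"] c first_sum show ?thesis by (auto split: if_splits)
  next
    case (first_diff k)
    then show ?thesis using unit_vec_diff_eq[of 1 j 1 k] j by simp
  next
    case (sum i k)
    from arg_cong[OF sum(3), of "\<lambda>b. psum b 1"] c block_idealsD[OF S sum(2)] sum show ?thesis by simp
  qed
qed (use j in \<open>auto simp: hook_roots_def\<close>)

text \<open>Closure is again read off from coefficients at cuts.  For commutativity, the coefficient of \<open>\<alpha>\<^sub>1\<close> or
  \<open>\<alpha>\<^sub>l\<close> in a sum of two of the roots is too large for a root, except for \<open>(\<epsilon>\<^sub>1 - \<epsilon>\<^sub>k) + (\<epsilon>\<^sub>i + \<epsilon>\<^sub>j)\<close> with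
  \<open>i \<ge> 2\<close>.  This could be a root only if \<open>k\<close> is \<open>i\<close> or \<open>j\<close>; but then \<open>(1, k) \<in> S\<close>, so \<open>\<epsilon>\<^sub>1 - \<epsilon>\<^sub>k\<close> is absent.\<close>

lemma hook_roots_in_ab_ideals:
  assumes S: "S \<in> block_ideals l J" and J1: "1 \<notin> J"
  shows "hook_roots l S \<in> ab_ideals"
proof -
  have one: "1 \<in> {1..l} - J" using l_pos J1 by simp
  have pos: "\<beta> \<in> B_pos l" if "\<beta> \<in> hook_roots l S" for \<beta>
    using that
  proof (cases rule: hook_roots_cases)
    case (sum i j)
    then show ?thesis using block_idealsD[OF S sum(2)] by (auto intro: unit_vec_sum_in_B_pos)
  qed (use l_pos in \<open>auto intro: unit_vec_in_B_pos unit_vec_sum_in_B_pos unit_vec_diff_in_B_pos\<close>)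
  have notlevi: "\<beta> \<notin> levi_roots l J" if "\<beta> \<in> hook_roots l S" for \<beta>
    using that
  proof (cases rule: hook_roots_cases)
    case (sum i j)
    then show ?thesis using sum_root_notin_levi[OF block_idealsD[OF S sum(2)]] by simp
  qed (use one in \<open>auto simp: levi_roots_def intro!: bexI[of _ 1]\<close>)
  have closed: "\<beta> + \<gamma> \<in> hook_roots l S"
    if \<beta>: "\<beta> \<in> hook_roots l S" and \<gamma>: "\<gamma> \<in> B_pos l \<union> levi_roots l J" and \<delta>: "\<beta> + \<gamma> \<in> B_pos l" for \<beta> \<gamma>
  proof -
    have le: "psum \<beta> t \<le> psum (\<beta> + \<gamma>) t" if "t \<in> {1..l} - J" for t
      using psum_parabolic_nonneg[OF \<gamma> that] by simp
    \<comment> \<open>A positive root with coefficient 1 at \<open>\<alpha>\<^sub>1\<close> can only fail to be in the set as \<open>\<epsilon>\<^sub>1 - \<epsilon>\<^sub>j\<close>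
      with \<open>(1, j) \<in> S\<close>.\<close>
    have first: "\<beta> + \<gamma> \<in> hook_roots l S"
      if c: "psum \<beta> 1 = 1" and d: "\<And>j. j \<in> {2..l} \<Longrightarrow> \<beta> + \<gamma> = unit_vec 1 - unit_vec j \<Longrightarrow> (1, j) \<notin> S"
    proof -
      have c1: "1 \<le> psum (\<beta> + \<gamma>) 1" using le[OF one] c by simp
      from \<delta> show ?thesis
      proof (cases rule: B_pos_cases)
        case (short i)
        with c1 have "i = 1" by (auto split: if_splits)
        with short show ?thesis by (simp add: hook_roots_def)
      next
        case (sum i j)
        with c1 have "i = 1" by (auto split: if_splits)
        with sum show ?thesis unfolding hook_roots_def by auto
      next
        case (diff i j)
        with c1 have "i = 1" by (auto split: if_splits)
        with diff d[of j] show ?thesis unfolding hook_roots_def by auto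
      qed
    qed
    \<comment> \<open>If \<open>(1, j)\<close> were in \<open>S\<close>, there would be a cut behind \<open>j\<close>, where \<open>\<epsilon>\<^sub>1 - \<epsilon>\<^sub>j\<close> has coefficient 0.\<close>
    have last: "(1, j) \<notin> S"
      if "j \<in> {2..l}" "\<beta> + \<gamma> = unit_vec 1 - unit_vec j" "\<And>t. t \<in> {1..l} \<Longrightarrow> 1 \<le> psum \<beta> t" for j
    proof
      assume "(1, j) \<in> S"
      from block_idealsD[OF S this] have "\<not> {j..l} \<subseteq> J"
        using block_le_num_blocks_iff[of j J l] by simp
      then obtain t where t: "t \<in> {j..l}" "t \<notin> J" by blast
      then have "psum (\<beta> + \<gamma>) t = 0" using that(1,2) by simp
      moreover have "t \<in> {1..l} - J" using that(1) t by auto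
      ultimately show False using le[of t] that(3)[of t] by auto
    qed
    from \<beta> show ?thesis
    proof (cases rule: hook_roots_cases)
      case short
      then show ?thesis using last by (intro first) auto
    next
      case (first_sum k)
      then show ?thesis using last by (intro first) auto
    next
      case (first_diff k)
      show ?thesis
      proof (rule first)
        fix j assume j: "j \<in> {2..l}" "\<beta> + \<gamma> = unit_vec 1 - unit_vec j"
        have "{j..<k} \<subseteq> J"
        proof
          fix t assume t: "t \<in> {j..<k}"
          show "t \<in> J"
          proof (rule ccontr)
            assume "t \<notin> J"
            then have "t \<in> {1..l} - J" using t j(1) first_diff(2) by auto
            from le[OF this] have "psum (unit_vec 1 - unit_vec k) t \<le> psum (unit_vec 1 - unit_vec j) t"
              unfolding j(2) unfolding first_diff(4) .
            then show False using t j(1) first_diff(1,2) by simp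
          qed
        qed
        then have "block J k \<le> block J j" using block_le_iff[of j J k] j by simp
        then show "(1, j) \<notin> S"
          using block_ideals_closed[OF S, of 1 j 1 k] first_diff by auto
      qed (use first_diff in simp)
    next
      case (sum i j)
      then have "\<exists>i' j'. (i', j') \<in> S \<and> \<beta> + \<gamma> = unit_vec i' + unit_vec j'"
        using le by (intro block_ideal_sum_upper[OF S sum(2) \<delta>]) simp
      then obtain i' j' where ij': "(i', j') \<in> S" "\<beta> + \<gamma> = unit_vec i' + unit_vec j'" by blast
      show ?thesis
      proof (cases "i' = 1")
        case True
        then show ?thesis using ij' block_idealsD[OF S ij'(1)] unfolding hook_roots_def by auto
      next
        case False
        then have "2 \<le> i'" using block_idealsD[OF S ij'(1)] by simp
        then show ?thesis using ij' unfolding hook_roots_def by blast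
      qed
    qed
  qed
  have first_other: "\<beta> + (unit_vec i + unit_vec j) \<notin> B_pos l"
    if \<beta>: "\<beta> \<in> hook_roots l S" and ij: "2 \<le> i" "(i, j) \<in> S" for \<beta> i j
  proof
    assume sum_pos: "\<beta> + (unit_vec i + unit_vec j) \<in> B_pos l"
    note rng = block_idealsD[OF S ij(2)]
    have bound: "psum \<beta> l \<le> 0" using psum_B_pos_le_2[OF sum_pos, of l] rng by simp
    from \<beta> show False
    proof (cases rule: hook_roots_cases)
      case (first_diff k)
      let ?d = "\<beta> + (unit_vec i + unit_vec j)"
      have "psum ?d l = 2" using first_diff rng by simp
      with sum_pos obtain a b where ab: "?d = unit_vec a + unit_vec b"
        by (cases rule: B_pos_cases) (auto split: if_splits)
      \<comment> \<open>The entry \<open>- 1\<close> at \<open>k\<close> has to be compensated.\<close>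
      have "0 \<le> ?d k" unfolding ab by (simp add: unit_vec_def)
      then have "k = i \<or> k = j" using first_diff rng by (auto simp: unit_vec_def split: if_splits)
      moreover have "(1, i) \<in> S" "(1, j) \<in> S"
        using ij rng by (auto intro!: block_ideals_closed[OF S ij(2)] block_mono)
      ultimately show False using first_diff by blast
    next
      case (sum i' j')
      then show False using bound block_idealsD[OF S sum(2)] by simp
    qed (use bound l_pos in \<open>auto split: if_splits\<close>)
  qed
  have "commute \<beta> \<gamma>" if \<beta>: "\<beta> \<in> hook_roots l S" and \<gamma>: "\<gamma> \<in> hook_roots l S" for \<beta> \<gamma>
  proof (rule commuteI[OF pos[OF \<beta>] pos[OF \<gamma>]])
    have first: "psum b 1 = 1 \<or> (\<exists>i j. 2 \<le> i \<and> (i, j) \<in> S \<and> b = unit_vec i + unit_vec j)"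
      if "b \<in> hook_roots l S" for b
      using that by (cases rule: hook_roots_cases) auto
    from first[OF \<beta>] show "\<beta> + \<gamma> \<notin> B_pos l"
    proof
      assume \<beta>1: "psum \<beta> 1 = 1"
      from first[OF \<gamma>] show ?thesis
      proof
        assume "psum \<gamma> 1 = 1"
        with \<beta>1 show ?thesis using psum_B_pos_1_le_1[of "\<beta> + \<gamma>" l] by auto
      next
        assume "\<exists>i j. 2 \<le> i \<and> (i, j) \<in> S \<and> \<gamma> = unit_vec i + unit_vec j"
        then show ?thesis using first_other[OF \<beta>] by blast
      qed
    next
      assume "\<exists>i j. 2 \<le> i \<and> (i, j) \<in> S \<and> \<beta> = unit_vec i + unit_vec j"
      then show ?thesis using first_other[OF \<gamma>] by (metis add.commute)
    qed
  qed
  then show ?thesis using pos notlevi closed unfolding ab_ideals_def par_ideals_def by blast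
qed

lemma inj_on_hook_roots: "inj_on (hook_roots l) (block_ideals l J)"
proof (rule inj_onI)
  have "S \<subseteq> T" if S: "S \<in> block_ideals l J" and T: "T \<in> block_ideals l J"
    and eq: "hook_roots l S = hook_roots l T" for S T
  proof
    fix p assume "p \<in> S"
    then obtain i j where p: "p = (i, j)" "(i, j) \<in> S" by (cases p) auto
    note rng = block_idealsD[OF S p(2)]
    show "p \<in> T"
    proof (cases "i = 1")
      case True
      then show ?thesis
        using hook_roots_first_diff[OF S, of j] hook_roots_first_diff[OF T, of j] eq p rng by auto
    next
      case False
      then have i: "2 \<le> i" using rng by simp
      then have "unit_vec i + unit_vec j \<in> hook_roots l S"
        using p unfolding hook_roots_def by blast
      then have "unit_vec i + unit_vec j \<in> hook_roots l T" by (simp add: eq)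
      then show ?thesis
      proof (cases rule: hook_roots_cases)
        case (sum i' j')
        then show ?thesis
          using unit_vec_sum_eq[OF sum(3)] rng block_idealsD[OF T sum(2)] p by simp
      next
        case short
        from arg_cong[OF this, of "\<lambda>b. psum b 1"] i rng show ?thesis by simp
      next
        case (first_sum k)
        then show ?thesis using unit_vec_sum_eq[OF first_sum(3)] i rng by simp
      next
        case (first_diff k)
        from arg_cong[OF this(4), of "\<lambda>b. psum b 1"] i rng \<open>2 \<le> k\<close> show ?thesis by simp
      qed
    qed
  qed
  then show "S = T" if "S \<in> block_ideals l J" "T \<in> block_ideals l J" "hook_roots l S = hook_roots l T" for S T
    using that by (metis subset_antisym)
qed

text \<open>For \<open>1 \<in> J\<close> the Levi root \<open>- \<alpha>\<^sub>1\<close> moves \<open>\<epsilon>\<^sub>1\<close> to \<open>\<epsilon>\<^sub>2\<close>, which is excluded in an abelian ideal; if \<open>l = 1\<close>,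
  then \<open>\<epsilon>\<^sub>1\<close> itself is a Levi root.\<close>

lemma card_with_short:
  "card {\<Phi> \<in> ab_ideals. unit_vec 1 \<in> \<Phi>} = (if 1 \<in> J then 0 else card (block_ideals l J))"
proof (cases "1 \<in> J")
  case False
  have "unit_vec 1 \<in> hook_roots l S" for S by (simp add: hook_roots_def)
  then have "{\<Phi> \<in> ab_ideals. unit_vec 1 \<in> \<Phi>} = hook_roots l ` block_ideals l J"
    using hook_roots_in_ab_ideals[OF _ False] ab_ideals_with_short[OF _ _ False] by blast
  then show ?thesis using False by (simp add: card_image inj_on_hook_roots)
next
  case True
  have "unit_vec 1 \<notin> \<Phi>" if \<Phi>: "\<Phi> \<in> ab_ideals" for \<Phi>
  proof
    assume mem: "unit_vec 1 \<in> \<Phi>"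
    have par: "\<Phi> \<in> par_ideals l J" using \<Phi> unfolding ab_ideals_def by blast
    show False
    proof (cases "l = 1")
      case l: True
      have "unit_vec 1 \<in> B_roots l" using unit_vec_in_B_pos[of 1 l] l by (simp add: B_roots_def)
      then have "unit_vec 1 \<in> levi_roots l J" using True l by (simp add: levi_roots_def)
      then show False using par mem unfolding par_ideals_def by blast
    next
      case False
      then have l: "2 \<le> l" using l_pos by simp
      have "block J 2 \<le> block J 1" using True block_Suc[of 1 J] by (simp add: numeral_2_eq_2)
      then have "unit_vec 2 - unit_vec 1 \<in> B_pos l \<union> levi_roots l J"
        using l by (intro unit_vec_diff_parabolic) auto
      moreover have "unit_vec 2 \<in> B_pos l" using l by (intro unit_vec_in_B_pos) auto
      ultimately have "unit_vec 2 \<in> \<Phi>" by (rule par_ideals_closed[OF par mem]) simp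
      then show False using short_mem[OF \<Phi>, of 2] l by simp
    qed
  qed
  then have "{\<Phi> \<in> ab_ideals. unit_vec 1 \<in> \<Phi>} = {}" by blast
  then show ?thesis using True by (simp only: card.empty if_True)
qed

lemma finite_ab_ideals: "finite ab_ideals"
proof (rule finite_subset)
  show "ab_ideals \<subseteq> Pow (B_pos l)" unfolding ab_ideals_def par_ideals_def by blast
  have "B_pos l \<subseteq> unit_vec ` {1..l} \<union> (\<lambda>(i, j). unit_vec i + unit_vec j) ` ({1..l} \<times> {1..l})
      \<union> (\<lambda>(i, j). unit_vec i - unit_vec j) ` ({1..l} \<times> {1..l})"
    unfolding B_pos_def by force
  then have "finite (B_pos l)" by (rule finite_subset) blast
  then show "finite (Pow (B_pos l))" by simp
qed

lemma card_ab_ideals: "card ab_ideals = (if 1 \<in> J then 1 else 2) * card (block_ideals l J)"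
proof -
  have "ab_ideals = {\<Phi> \<in> ab_ideals. unit_vec 1 \<notin> \<Phi>} \<union> {\<Phi> \<in> ab_ideals. unit_vec 1 \<in> \<Phi>}" by blast
  then have "card ab_ideals =
      card {\<Phi> \<in> ab_ideals. unit_vec 1 \<notin> \<Phi>} + card {\<Phi> \<in> ab_ideals. unit_vec 1 \<in> \<Phi>}"
    using finite_ab_ideals by (subst card_Un_disjoint[symmetric]) auto
  then show ?thesis by (simp add: card_without_short card_with_short)
qed

end

section \<open>Sets of vectors closed under signed permutations\<close>

text \<open>Stated for vectors over any group, so that it also applies to pairs of integer vectors, which are vectors
  of integer pairs.\<close>

definition signed_perm_closed :: "nat \<Rightarrow> (nat \<Rightarrow> 'a::group_add) set \<Rightarrow> bool" where
  "signed_perm_closed l R \<longleftrightarrow>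
     (\<forall>v\<in>R. \<forall>i. 1 \<le> i \<longrightarrow> i < l \<longrightarrow> v \<circ> transpose i (Suc i) \<in> R) \<and>
     (\<forall>v\<in>R. v(l := - v l) \<in> R)"

text \<open>Induction on the distance, conjugating with the adjacent transposition at the right end.\<close>

lemma signed_perm_closed_transpose:
  assumes R: "signed_perm_closed l R" and v: "v \<in> R" and "i \<in> {1..l}" "j \<in> {1..l}"
  shows "v \<circ> transpose i j \<in> R"
proof -
  have adj: "v \<circ> transpose i (Suc i) \<in> R" if "v \<in> R" "1 \<le> i" "i < l" for v i
    using R that unfolding signed_perm_closed_def by blast
  have less: "v \<circ> transpose i j \<in> R" if "v \<in> R" "1 \<le> i" "i < j" "j \<le> l" for v i j
    using Suc_leI[OF that(3)] that(4,1,2)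
  proof (induction j arbitrary: v rule: dec_induct)
    case base
    show ?case by (rule adj) (use base in simp_all)
  next
    case (step j)
    let ?t = "transpose j (Suc j)"
    have t: "w \<circ> ?t \<in> R" if "w \<in> R" for w
      by (rule adj) (use that step in simp_all)
    have "(v \<circ> ?t) \<circ> transpose i j \<in> R"
      by (rule step.IH[OF _ t[OF step.prems(2)]]) (use step.prems in simp_all)
    then have "((v \<circ> ?t) \<circ> transpose i j) \<circ> ?t \<in> R" by (rule t)
    moreover have "((v \<circ> ?t) \<circ> transpose i j) \<circ> ?t = v \<circ> transpose i (Suc j)"
      using step by (auto simp: fun_eq_iff transpose_def)
    ultimately show ?case by (simp only:)
  qed
  show ?thesis
  proof (cases i j rule: linorder_cases)
    case greater
    then have "v \<circ> transpose j i \<in> R" using assms less by simp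
    then show ?thesis by (simp add: transpose_commute)
  qed (use assms less in simp_all)
qed

lemma signed_perm_closed_permutes:
  assumes R: "signed_perm_closed l R" and v: "v \<in> R" and \<pi>: "\<pi> permutes {1..l}"
  shows "v \<circ> \<pi> \<in> R"
  using \<pi> finite_atLeastAtMost[of 1 l] v
proof (induction arbitrary: v rule: permutes_induct)
  case (swap a b p)
  then have "(v \<circ> transpose a b) \<circ> p \<in> R" using signed_perm_closed_transpose[OF R] by blast
  then show ?case by (simp only: comp_assoc)
qed simp_all

lemma signed_perm_closed_negate:
  assumes R: "signed_perm_closed l R" and v: "v \<in> R" and i: "i \<in> {1..l}"
  shows "v(i := - v i) \<in> R"
proof -
  have l: "l \<in> {1..l}" using i by simp
  let ?w = "v \<circ> transpose i l"
  have "?w(l := - ?w l) \<in> R"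
    using R signed_perm_closed_transpose[OF R v i l] unfolding signed_perm_closed_def by blast
  then have "?w(l := - ?w l) \<circ> transpose i l \<in> R" by (rule signed_perm_closed_transpose[OF R _ i l])
  moreover have "?w(l := - ?w l) \<circ> transpose i l = v(i := - v i)"
    by (auto simp: fun_eq_iff transpose_def)
  ultimately show ?thesis by simp
qed

lemma inj_on_extends_to_permutation:
  assumes "finite A" "inj_on f A" "A \<subseteq> S" "f ` A \<subseteq> S"
  shows "\<exists>\<pi>. \<pi> permutes S \<and> (\<forall>a\<in>A. \<pi> a = f a)"
  using assms
proof (induction A)
  case empty
  then show ?case by (intro exI[of _ id] conjI permutes_id) simp
next
  case (insert x F)
  then have "inj_on f F" "F \<subseteq> S" "f ` F \<subseteq> S" by auto
  from insert.IH[OF this] obtain \<pi> where \<pi>: "\<pi> permutes S" "\<forall>a\<in>F. \<pi> a = f a" by blast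
  let ?\<sigma> = "transpose (\<pi> x) (f x) \<circ> \<pi>"
  have "\<pi> x \<in> S" "f x \<in> S" using \<pi>(1) insert.prems by (auto simp: permutes_in_image)
  then have "?\<sigma> permutes S" by (intro permutes_compose[OF \<pi>(1)] permutes_swap_id)
  moreover have "?\<sigma> a = f a" if "a \<in> insert x F" for a
  proof (cases "a = x")
    case False
    then have a: "a \<in> F" using that by simp
    then have "\<pi> a \<noteq> \<pi> x" using False permutes_inj[OF \<pi>(1)] by (simp add: inj_eq)
    moreover have "f a \<noteq> f x" using insert.prems(1) insert.hyps(2) a by (auto simp: inj_on_def)
    ultimately show ?thesis using \<pi>(2) a by (simp add: transpose_def)
  qed simp
  ultimately show ?case by blast
qed

lemma permutation_two:
  assumes "distinct [i, j]" "set [i, j] \<subseteq> S" "distinct [i', j']" "set [i', j'] \<subseteq> S"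
  shows "\<exists>\<pi>. \<pi> permutes S \<and> \<pi> i = i' \<and> \<pi> j = j'"
proof -
  have "\<exists>\<pi>. \<pi> permutes S \<and> (\<forall>a\<in>{i, j}. \<pi> a = (if a = i then i' else j'))"
    by (rule inj_on_extends_to_permutation) (use assms in \<open>auto simp: inj_on_def\<close>)
  then show ?thesis using assms by force
qed

lemma permutation_three:
  assumes "distinct [i, j, k]" "set [i, j, k] \<subseteq> S" "distinct [i', j', k']" "set [i', j', k'] \<subseteq> S"
  shows "\<exists>\<pi>. \<pi> permutes S \<and> \<pi> i = i' \<and> \<pi> j = j' \<and> \<pi> k = k'"
proof -
  have "\<exists>\<pi>. \<pi> permutes S \<and> (\<forall>a\<in>{i, j, k}. \<pi> a = (if a = i then i' else if a = j then j' else k'))"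
    by (rule inj_on_extends_to_permutation) (use assms in \<open>auto simp: inj_on_def\<close>)
  then show ?thesis using assms by force
qed

lemma unit_vec_permute:
  assumes "\<pi> permutes S" "\<pi> i = a"
  shows "unit_vec a \<circ> \<pi> = unit_vec i"
proof
  fix k
  have "\<pi> k = a \<longleftrightarrow> k = i"
    using inj_eq[OF permutes_inj[OF assms(1)], of k i] assms(2) by simp
  then show "(unit_vec a \<circ> \<pi>) k = unit_vec i k" by (simp add: unit_vec_def)
qed

lemma psum_Suc [simp]: "psum b (Suc t) = psum b t + b (Suc t)"
  by (simp add: psum_def)

lemma psum_0 [simp]: "psum b 0 = 0"
  by (simp add: psum_def)

lemma B_root_if_two_entries:
  assumes "i \<in> {1..l}" "j \<in> {1..l}" "i \<noteq> j" "\<bar>b i\<bar> = 1" "\<bar>b j\<bar> = 1"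
    and "\<And>k. k \<noteq> i \<Longrightarrow> k \<noteq> j \<Longrightarrow> b k = 0"
  shows "b \<in> B_roots l"
proof -
  have *: "b \<in> B_roots l"
    if ij: "i < j" "i \<in> {1..l}" "j \<in> {1..l}" "\<bar>b i\<bar> = 1" "\<bar>b j\<bar> = 1"
      and zero: "\<And>k. k \<noteq> i \<Longrightarrow> k \<noteq> j \<Longrightarrow> b k = 0" for i j
  proof -
    have sum: "unit_vec i + unit_vec j \<in> B_pos l" and diff: "unit_vec i - unit_vec j \<in> B_pos l"
      using ij unit_vec_sum_in_B_pos unit_vec_diff_in_B_pos by auto
    consider "b i = 1" "b j = 1" | "b i = 1" "b j = - 1" | "b i = - 1" "b j = 1" | "b i = - 1" "b j = - 1"
      using ij(4,5) by linarith
    then have "b = unit_vec i + unit_vec j \<or> b = unit_vec i - unit_vec j \<or>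
        b = - (unit_vec i - unit_vec j) \<or> b = - (unit_vec i + unit_vec j)"
      using ij(1) zero by cases (auto simp: fun_eq_iff unit_vec_def)
    then show ?thesis using sum diff unfolding B_roots_def by blast
  qed
  show ?thesis
  proof (cases "i < j")
    case True
    then show ?thesis using * assms by blast
  next
    case False
    then have "j < i" using assms by simp
    then show ?thesis using *[of j i] assms by blast
  qed
qed

text \<open>A vector and all its signed permutations have partial sums of constant sign.  Move two nonzero entries to
  the front and give them opposite signs: the first must dominate the second in absolute value, so by
  symmetry all nonzero entries have the same absolute value \<open>p\<close>.  Three of them, arranged as
  \<open>p, - p, - p\<close>, would give partial sums of both signs.  So there are at most two, and the vector is \<open>p\<close>
  times a signed permutation of a simple root, which leaves \<open>p = 1\<close>.\<close>

lemma signed_perm_closed_subset_B_roots: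
  assumes R: "signed_perm_closed l R"
    and sign: "\<And>b. b \<in> R \<Longrightarrow> (\<forall>t\<in>{1..l}. 0 \<le> psum b t) \<or> (\<forall>t\<in>{1..l}. psum b t \<le> 0)"
    and supp: "\<And>b k. b \<in> R \<Longrightarrow> k \<notin> {1..l} \<Longrightarrow> b k = 0"
    and nonzero: "0 \<notin> R"
    and short_multiple: "\<And>p. 2 \<le> p \<Longrightarrow> (\<lambda>k. p * unit_vec l k) \<notin> R"
    and long_multiple: "\<And>p. 2 \<le> p \<Longrightarrow> 2 \<le> l \<Longrightarrow> (\<lambda>k. p * (unit_vec 1 - unit_vec 2) k) \<notin> R"
  shows "R \<subseteq> B_roots l"
proof
  fix b assume b: "b \<in> R"
  have signed: "\<exists>w\<in>R. w i = c \<and> (\<forall>k. k \<noteq> i \<longrightarrow> w k = v k)"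
    if "v \<in> R" "i \<in> {1..l}" "\<bar>c\<bar> = \<bar>v i\<bar>" for v i c
  proof (cases "c = v i")
    case False
    then have "c = - v i" using that(3) by linarith
    then show ?thesis using signed_perm_closed_negate[OF R that(1,2)]
      by (intro bexI[of _ "v(i := - v i)"]) simp_all
  qed (use that in blast)
  \<comment> \<open>The arrangement \<open>\<bar>b\<^sub>i\<bar>, - \<bar>b\<^sub>j\<bar>, \<dots>\<close> has partial sums \<open>\<bar>b\<^sub>i\<bar> > 0\<close> and \<open>\<bar>b\<^sub>i\<bar> - \<bar>b\<^sub>j\<bar>\<close>.\<close>
  have le: "\<bar>b j\<bar> \<le> \<bar>b i\<bar>" if ij: "i \<in> {1..l}" "j \<in> {1..l}" "i \<noteq> j" "b i \<noteq> 0" for i j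
  proof -
    have l: "2 \<le> l" using ij by auto
    obtain \<pi> where \<pi>: "\<pi> permutes {1..l}" "\<pi> 1 = i" "\<pi> 2 = j"
      using permutation_two[of 1 2 "{1..l}" i j] ij l by auto
    have "b \<circ> \<pi> \<in> R" by (rule signed_perm_closed_permutes[OF R b \<pi>(1)])
    from signed[OF this, of 1 "\<bar>b i\<bar>"] obtain v where
      v: "v \<in> R" "v 1 = \<bar>b i\<bar>" "\<forall>k. k \<noteq> 1 \<longrightarrow> v k = b (\<pi> k)" using \<pi> l by auto
    from signed[OF this(1), of 2 "- \<bar>b j\<bar>"] obtain w where
      w: "w \<in> R" "w 2 = - \<bar>b j\<bar>" "\<forall>k. k \<noteq> 2 \<longrightarrow> w k = v k" using \<pi> l v(3) by auto
    have "psum w 1 = \<bar>b i\<bar>" "psum w 2 = \<bar>b i\<bar> - \<bar>b j\<bar>"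
      using v w by (simp_all add: eval_nat_numeral One_nat_def)
    moreover have "0 \<le> psum w 1 \<and> 0 \<le> psum w 2 \<or> psum w 1 \<le> 0"
      using sign[OF w(1)] l by (elim disjE) simp_all
    ultimately show ?thesis using ij(4) by linarith
  qed
  \<comment> \<open>The arrangement \<open>p, - p, - p, \<dots>\<close> has partial sums \<open>p\<close> and \<open>- p\<close>.\<close>
  have two: "b k = 0"
    if ijk: "i \<in> {1..l}" "j \<in> {1..l}" "k \<in> {1..l}" "i \<noteq> j" "i \<noteq> k" "j \<noteq> k" "b i \<noteq> 0" "b j \<noteq> 0" for i j k
  proof (rule ccontr)
    assume bk: "b k \<noteq> 0"
    have l: "3 \<le> l" using card_mono[of "{1..l}" "{i, j, k}"] ijk by simp
    obtain \<pi> where \<pi>: "\<pi> permutes {1..l}" "\<pi> 1 = i" "\<pi> 2 = j" "\<pi> 3 = k"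
      using permutation_three[of 1 2 3 "{1..l}" i j k] ijk l by auto
    have "b \<circ> \<pi> \<in> R" by (rule signed_perm_closed_permutes[OF R b \<pi>(1)])
    from signed[OF this, of 1 "\<bar>b i\<bar>"] obtain v where
      v: "v \<in> R" "v 1 = \<bar>b i\<bar>" "\<forall>k. k \<noteq> 1 \<longrightarrow> v k = b (\<pi> k)" using \<pi> l by auto
    from signed[OF this(1), of 2 "- \<bar>b j\<bar>"] obtain w where
      w: "w \<in> R" "w 2 = - \<bar>b j\<bar>" "\<forall>k. k \<noteq> 2 \<longrightarrow> w k = v k" using \<pi> l v(3) by auto
    from signed[OF this(1), of 3 "- \<bar>b k\<bar>"] obtain x where
      x: "x \<in> R" "x 3 = - \<bar>b k\<bar>" "\<forall>k. k \<noteq> 3 \<longrightarrow> x k = w k" using \<pi> l v(3) w(3) by auto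
    have "psum x 1 = \<bar>b i\<bar>" "psum x 3 = \<bar>b i\<bar> - \<bar>b j\<bar> - \<bar>b k\<bar>"
      using v w x by (simp_all add: eval_nat_numeral One_nat_def)
    moreover have "\<bar>b i\<bar> \<le> \<bar>b j\<bar>" using le[of j i] ijk by simp
    moreover have "0 \<le> psum x 1 \<and> 0 \<le> psum x 3 \<or> psum x 1 \<le> 0"
      using sign[OF x(1)] l by (elim disjE) simp_all
    ultimately show False using ijk(7) bk by linarith
  qed
  have "b \<noteq> 0" using nonzero b by blast
  then obtain i where i: "b i \<noteq> 0" by (auto simp: fun_eq_iff)
  then have il: "i \<in> {1..l}" using supp[OF b] by blast
  show "b \<in> B_roots l"
  proof (cases "\<exists>j\<in>{1..l}. j \<noteq> i \<and> b j \<noteq> 0")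
    case False
    then have zero: "b k = 0" if "k \<noteq> i" for k using supp[OF b, of k] that by blast
    obtain v where v: "v \<in> R" "v i = \<bar>b i\<bar>" "\<forall>k. k \<noteq> i \<longrightarrow> v k = b k"
      using signed[OF b il, of "\<bar>b i\<bar>"] by auto
    have "v \<circ> transpose i l \<in> R" using signed_perm_closed_transpose[OF R v(1) il, of l] il by simp
    moreover have "v \<circ> transpose i l = (\<lambda>k. \<bar>b i\<bar> * unit_vec l k)"
      using v zero by (auto simp: fun_eq_iff transpose_def unit_vec_def)
    ultimately have "\<bar>b i\<bar> < 2" using short_multiple[of "\<bar>b i\<bar>"] by force
    then have "b i = 1 \<or> b i = - 1" using i by linarith
    then have "b = unit_vec i \<or> b = - unit_vec i" using zero by (auto simp: fun_eq_iff unit_vec_def)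
    then show ?thesis using unit_vec_in_B_pos[of i l] il unfolding B_roots_def by auto
  next
    case True
    then obtain j where j: "j \<in> {1..l}" "j \<noteq> i" "b j \<noteq> 0" by blast
    have l: "2 \<le> l" using il j by auto
    have zero: "b k = 0" if "k \<noteq> i" "k \<noteq> j" for k
      using two[of i j k] supp[OF b, of k] that il j i by blast
    have abs: "\<bar>b j\<bar> = \<bar>b i\<bar>" using le[of i j] le[of j i] i j il by simp
    obtain v where v: "v \<in> R" "v i = \<bar>b i\<bar>" "\<forall>k. k \<noteq> i \<longrightarrow> v k = b k"
      using signed[OF b il, of "\<bar>b i\<bar>"] by auto
    from signed[OF v(1) j(1), of "- \<bar>b i\<bar>"] obtain w where
      w: "w \<in> R" "w j = - \<bar>b i\<bar>" "\<forall>k. k \<noteq> j \<longrightarrow> w k = v k" using j v(3) abs by auto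
    obtain \<pi> where \<pi>: "\<pi> permutes {1..l}" "\<pi> 1 = i" "\<pi> 2 = j"
      using permutation_two[of 1 2 "{1..l}" i j] il j l by auto
    have "w \<circ> \<pi> \<in> R" by (rule signed_perm_closed_permutes[OF R w(1) \<pi>(1)])
    moreover have "w \<circ> \<pi> = (\<lambda>k. \<bar>b i\<bar> * (unit_vec 1 - unit_vec 2) k)"
    proof
      fix k
      have "w = (\<lambda>k. \<bar>b i\<bar> * (unit_vec i - unit_vec j) k)"
        using v w zero j(2) by (auto simp: fun_eq_iff unit_vec_def)
      then have "(w \<circ> \<pi>) k = \<bar>b i\<bar> * ((unit_vec i \<circ> \<pi>) k - (unit_vec j \<circ> \<pi>) k)" by simp
      then show "(w \<circ> \<pi>) k = \<bar>b i\<bar> * (unit_vec 1 - unit_vec 2) k"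
        by (simp only: unit_vec_permute[OF \<pi>(1,2)] unit_vec_permute[OF \<pi>(1,3)] minus_apply fun_diff_def)
    qed
    ultimately have "\<bar>b i\<bar> < 2" using long_multiple[of "\<bar>b i\<bar>"] l by force
    then have "\<bar>b i\<bar> = 1" using i by linarith
    then show ?thesis using B_root_if_two_entries[of i l j b] il j zero abs by simp
  qed
qed

text \<open>Signed permutations act transitively on the short and on the long roots.\<close>

lemma B_roots_subset_signed_perm_closed:
  assumes R: "signed_perm_closed l R" and short: "unit_vec l \<in> R"
    and long: "2 \<le> l \<Longrightarrow> unit_vec 1 - unit_vec 2 \<in> R"
  shows "B_roots l \<subseteq> R"
proof
  fix b assume "b \<in> B_roots l"
  then obtain c where c: "c \<in> B_pos l" "b = c \<or> b = - c" unfolding B_roots_def by blast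
  note neg = signed_perm_closed_negate[OF R]
  have pair: "unit_vec i - unit_vec j \<in> R" if ij: "1 \<le> i" "i < j" "j \<le> l" for i j
  proof -
    obtain \<pi> where \<pi>: "\<pi> permutes {1..l}" "\<pi> i = 1" "\<pi> j = 2"
      using permutation_two[of i j "{1..l}" 1 2] ij by auto
    have "(unit_vec 1 - unit_vec 2) \<circ> \<pi> \<in> R"
      using ij by (intro signed_perm_closed_permutes[OF R _ \<pi>(1)] long) simp
    moreover have "(unit_vec 1 - unit_vec 2) \<circ> \<pi> = (unit_vec 1 \<circ> \<pi>) - (unit_vec 2 \<circ> \<pi>)"
      by (simp add: fun_eq_iff)
    ultimately show ?thesis
      by (simp only: unit_vec_permute[OF \<pi>(1,2)] unit_vec_permute[OF \<pi>(1,3)])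
  qed
  from c(1) show "b \<in> R"
  proof (cases rule: B_pos_cases)
    case (short i)
    have "unit_vec l \<circ> transpose i l \<in> R"
      using signed_perm_closed_transpose[OF R \<open>unit_vec l \<in> R\<close>] short by simp
    moreover have "unit_vec l \<circ> transpose i l = unit_vec i"
      by (auto simp: fun_eq_iff transpose_def unit_vec_def)
    ultimately have i: "unit_vec i \<in> R" by simp
    moreover have "(unit_vec i)(i := - unit_vec i i) = - unit_vec i"
      by (auto simp: fun_eq_iff unit_vec_def)
    ultimately show ?thesis using c(2) short neg[OF i, of i] by auto
  next
    case (sum i j)
    have d: "unit_vec i - unit_vec j \<in> R" using pair sum by simp
    have "(unit_vec i - unit_vec j)(j := - (unit_vec i - unit_vec j) j) = unit_vec i + unit_vec j"
      using sum by (auto simp: fun_eq_iff unit_vec_def)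
    with neg[OF d, of j] sum have "unit_vec i + unit_vec j \<in> R" by simp
    moreover have "(unit_vec i - unit_vec j)(i := - (unit_vec i - unit_vec j) i) = - (unit_vec i + unit_vec j)"
      using sum by (auto simp: fun_eq_iff unit_vec_def)
    with neg[OF d, of i] sum have "- (unit_vec i + unit_vec j) \<in> R" by simp
    ultimately show ?thesis using c(2) sum(4) by auto
  next
    case (diff i j)
    have d: "unit_vec i - unit_vec j \<in> R" using pair diff by simp
    let ?w = "(unit_vec i - unit_vec j)(j := - (unit_vec i - unit_vec j) j)"
    have "?w \<in> R" using neg[OF d, of j] diff by simp
    then have "?w(i := - ?w i) \<in> R" using neg[of ?w i] diff by simp
    moreover have "?w(i := - ?w i) = - (unit_vec i - unit_vec j)"
      using diff by (auto simp: fun_eq_iff unit_vec_def)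
    ultimately show ?thesis using c(2) d diff(4) by auto
  qed
qed

section \<open>The roots of a Lie algebra of type B\<close>

locale type_B_lie = simple_lie_with_cartan scale br H
  for scale :: "complex \<Rightarrow> 'g::ab_group_add \<Rightarrow> 'g" and br :: "'g \<Rightarrow> 'g \<Rightarrow> 'g" and H :: "'g set" +
  fixes l :: nat and \<alpha> :: "nat \<Rightarrow> 'g \<Rightarrow> complex"
  assumes l_pos: "1 \<le> l" and simple: "simple_system scale br H l \<alpha>" and type: "type_B scale br H l \<alpha>"
begin

abbreviation root_set :: "('g \<Rightarrow> complex) set" where "root_set \<equiv> roots scale br H"

lemma simple_roots: "i \<in> {1..l} \<Longrightarrow> \<alpha> i \<in> root_set"
  using simple unfolding simple_system_def by blast

lemma simple_dual: "i \<in> {1..l} \<Longrightarrow> \<alpha> i \<in> dual"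
  using simple_roots unfolding roots_def by blast

lemma simple_independent:
  fixes c d :: "nat \<Rightarrow> complex"
  assumes "\<And>x. (\<Sum>i=1..l. c i * \<alpha> i x) = (\<Sum>i=1..l. d i * \<alpha> i x)" "i \<in> {1..l}"
  shows "c i = d i"
proof -
  have "(\<Sum>i=1..l. (c i - d i) * \<alpha> i x) = 0" for x
    using assms(1)[of x] by (simp add: left_diff_distrib sum_subtractf)
  then have "\<forall>i\<in>{1..l}. c i - d i = 0"
    using simple unfolding simple_system_def by (elim conjE allE[of _ "\<lambda>i. c i - d i"]) blast
  then show ?thesis using assms(2) by simp
qed

lemma simple_independent_int:
  fixes c d :: "nat \<Rightarrow> int"
  assumes "\<And>x. (\<Sum>i=1..l. of_int (c i) * \<alpha> i x) = (\<Sum>i=1..l. of_int (d i) * \<alpha> i x)"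
    and "i \<in> {1..l}"
  shows "c i = d i"
  using simple_independent[OF assms] by (simp only: of_int_eq_iff)

lemma simple_inj: "inj_on \<alpha> {1..l}"
proof (rule inj_onI)
  fix i j assume ij: "i \<in> {1..l}" "j \<in> {1..l}" "\<alpha> i = \<alpha> j"
  have "(\<Sum>k=1..l. (if k = i then 1 else 0) * \<alpha> k x) = (\<Sum>k=1..l. (if k = j then 1 else 0) * \<alpha> k x)" for x
    using ij by (simp add: if_distrib[of "\<lambda>c. c * _"] sum.delta cong: if_cong)
  from simple_independent[OF this ij(1)] show "i = j" by (simp split: if_splits)
qed

definition coroot :: "nat \<Rightarrow> 'g" where
  "coroot j = (SOME h. is_coroot scale br H (\<alpha> j) h \<and>
     (\<forall>i\<in>{1..l}. \<alpha> i h = of_int (cartan_matrix_B l i j)))"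

lemma coroot:
  assumes "j \<in> {1..l}"
  shows "is_coroot scale br H (\<alpha> j) (coroot j)"
    and "i \<in> {1..l} \<Longrightarrow> \<alpha> i (coroot j) = of_int (cartan_matrix_B l i j)"
proof -
  have "\<exists>h. is_coroot scale br H (\<alpha> j) h \<and> (\<forall>i\<in>{1..l}. \<alpha> i h = of_int (cartan_matrix_B l i j))"
    using type assms unfolding type_B_def by blast
  from someI_ex[OF this]
  show "is_coroot scale br H (\<alpha> j) (coroot j)"
    "i \<in> {1..l} \<Longrightarrow> \<alpha> i (coroot j) = of_int (cartan_matrix_B l i j)"
    unfolding coroot_def by blast+
qed

lemma simple_sl2_triple: "j \<in> {1..l} \<Longrightarrow> \<exists>e f. sl2_triple (\<alpha> j) e f (coroot j)"
  using coroot_sl2_triple simple_dual coroot(1) by blast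

text \<open>Since \<open>\<epsilon>\<^sub>i = \<alpha>\<^sub>i + \<dots> + \<alpha>\<^sub>l\<close>, this is the functional \<open>\<Sum>\<^sub>i b\<^sub>i \<epsilon>\<^sub>i\<close>.\<close>

definition phi :: "(nat \<Rightarrow> int) \<Rightarrow> 'g \<Rightarrow> complex" where
  "phi b = (\<lambda>x. \<Sum>t=1..l. of_int (psum b t) * \<alpha> t x)"

lemma phi_add: "phi (b + c) = phi b + phi c"
  by (simp add: phi_def fun_eq_iff distrib_right sum.distrib)

lemma phi_uminus: "phi (- b) = - phi b"
  by (simp add: phi_def fun_eq_iff sum_negf)

lemma phi_diff: "phi (b - c) = phi b - phi c"
  by (simp add: phi_def fun_eq_iff left_diff_distrib sum_subtractf)

lemma phi_mult: "phi (\<lambda>k. m * b k) x = of_int m * phi b x"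
  by (simp add: phi_def psum_def sum_distrib_left mult.assoc flip: sum_distrib_left)

lemma phi_dual: "phi b \<in> dual"
proof -
  have add: "\<alpha> t (x + y) = \<alpha> t x + \<alpha> t y" and sc: "\<alpha> t (scale c x) = c * \<alpha> t x"
    if "t \<in> {1..l}" "x \<in> H" "y \<in> H" for t x y c
    using that dual_add dual_scale simple_dual by blast+
  have out: "\<alpha> t x = 0" if "t \<in> {1..l}" "x \<notin> H" for t x
    using that dual_outside simple_dual by blast
  have "phi b (x + y) = phi b x + phi b y" if "x \<in> H" "y \<in> H" for x y
    unfolding phi_def sum.distrib[symmetric] using that
    by (intro sum.cong refl) (simp add: add algebra_simps)
  moreover have "phi b (scale c x) = c * phi b x" if "x \<in> H" for c x
    unfolding phi_def sum_distrib_left using that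
    by (intro sum.cong refl) (simp add: sc[OF _ that that])
  moreover have "phi b x = 0" if "x \<notin> H" for x
    unfolding phi_def using that by (intro sum.neutral) (simp add: out)
  ultimately show ?thesis unfolding dual_on_def by blast
qed

lemma phi_eq_iff: "phi b = phi c \<longleftrightarrow> (\<forall>t\<in>{1..l}. psum b t = psum c t)"
proof
  assume eq: "phi b = phi c"
  have "(\<Sum>t=1..l. complex_of_int (psum b t) * \<alpha> t x) = (\<Sum>t=1..l. complex_of_int (psum c t) * \<alpha> t x)" for x
    using fun_cong[OF eq, of x] by (simp add: phi_def)
  from simple_independent_int[OF this] show "\<forall>t\<in>{1..l}. psum b t = psum c t" by auto
qed (simp add: phi_def)

lemma psum_inj:
  assumes "\<And>t. t \<in> {1..l} \<Longrightarrow> psum b t = psum c t" "k \<in> {1..l}"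
  shows "b k = c k"
proof -
  obtain m where m: "k = Suc m" using assms(2) by (cases k) auto
  have "psum b m = psum c m" using assms m by (cases "m = 0") auto
  then show ?thesis using assms(1)[OF assms(2)] by (simp add: m)
qed

definition simple_vec :: "nat \<Rightarrow> nat \<Rightarrow> int" where
  "simple_vec j = (if j = l then unit_vec l else unit_vec j - unit_vec (Suc j))"

lemma psum_simple_vec:
  assumes "j \<in> {1..l}" "t \<in> {1..l}"
  shows "psum (simple_vec j) t = (if t = j then 1 else 0)"
  using assms by (auto simp: simple_vec_def)

lemma phi_simple_vec: "j \<in> {1..l} \<Longrightarrow> phi (simple_vec j) = \<alpha> j"
proof -
  assume j: "j \<in> {1..l}"
  have "phi (simple_vec j) x = (\<Sum>t=1..l. if t = j then \<alpha> t x else 0)" for x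
    unfolding phi_def by (intro sum.cong) (simp_all add: psum_simple_vec[OF j])
  then show ?thesis using j by (simp add: fun_eq_iff)
qed

lemma phi_coroot:
  assumes j: "j \<in> {1..l}"
  shows "phi b (coroot j) = (if j = l then 2 * of_int (b l) else of_int (b j - b (Suc j)))"
proof -
  \<comment> \<open>For \<open>j = 1\<close> the neighbour \<open>i\<close> is 0, which is harmless because \<open>psum b 0 = 0\<close>.\<close>
  obtain i where i: "j = Suc i" using j by (cases j) auto
  let ?p = "\<lambda>t. complex_of_int (psum b t)"
  have "phi b (coroot j) = (\<Sum>t=1..l. ?p t * of_int (cartan_matrix_B l t j))"
    unfolding phi_def by (intro sum.cong refl) (simp add: coroot(2)[OF j])
  also have "\<dots> = (\<Sum>t=1..l. (if t = j then 2 * ?p t else 0) +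
      (if t = i then (if j = l then - 2 else - 1) * ?p t else 0) +
      (if t = Suc j then - ?p t else 0))"
    by (intro sum.cong refl) (auto simp: cartan_matrix_B_def i)
  also have "\<dots> = 2 * ?p j + (if j = l then - 2 else - 1) * ?p i + (if j = l then 0 else - ?p (Suc j))"
    using j by (cases "i = 0") (auto simp: sum.distrib sum.delta i)
  also have "\<dots> = (if j = l then 2 * of_int (b l) else of_int (b j - b (Suc j)))"
    using i by auto
  finally show ?thesis .
qed

text \<open>The simple reflections act on coordinates as adjacent transpositions and as the sign change of the last
  coordinate.\<close>

lemma phi_reflect:
  assumes j: "j \<in> {1..l}"
  shows "(\<lambda>x. phi b x - phi b (coroot j) * \<alpha> j x) =
    phi (if j = l then b(l := - b l) else b \<circ> transpose j (Suc j))"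
proof -
  define m where "m = (if j = l then 2 * b l else b j - b (Suc j))"
  have "(\<lambda>x. phi b x - phi b (coroot j) * \<alpha> j x) = (\<lambda>x. phi b x - of_int m * phi (simple_vec j) x)"
    by (simp add: phi_coroot[OF j] phi_simple_vec[OF j] m_def)
  also have "\<dots> = phi (b - (\<lambda>k. m * simple_vec j k))"
    by (simp add: phi_diff phi_mult fun_eq_iff)
  also have "b - (\<lambda>k. m * simple_vec j k) = (if j = l then b(l := - b l) else b \<circ> transpose j (Suc j))"
    by (auto simp: fun_eq_iff m_def simple_vec_def unit_vec_def transpose_def)
  finally show ?thesis .
qed

text \<open>The condition on the support makes the coordinates of a root unique.\<close>

definition root_vecs :: "(nat \<Rightarrow> int) set" where
  "root_vecs = {b. phi b \<in> root_set \<and> (\<forall>k. k \<notin> {1..l} \<longrightarrow> b k = 0)}"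

lemma signed_perm_closed_root_vecs: "signed_perm_closed l root_vecs"
proof -
  have step: "(if j = l then b(l := - b l) else b \<circ> transpose j (Suc j)) \<in> root_vecs"
    if b: "b \<in> root_vecs" and j: "j \<in> {1..l}" for b j
  proof -
    obtain e f where "sl2_triple (\<alpha> j) e f (coroot j)" using simple_sl2_triple[OF j] by blast
    from reflection_roots[OF this, of "phi b"] b
    have "phi (if j = l then b(l := - b l) else b \<circ> transpose j (Suc j)) \<in> root_set"
      unfolding phi_reflect[OF j] root_vecs_def by blast
    then show ?thesis using b j by (auto simp: root_vecs_def transpose_def)
  qed
  show ?thesis
    unfolding signed_perm_closed_def
  proof (intro conjI ballI allI impI)
    fix v i assume "v \<in> root_vecs" "1 \<le> i" "i < l"
    with step[of v i] show "v \<circ> transpose i (Suc i) \<in> root_vecs" by simp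
  next
    fix v assume "v \<in> root_vecs"
    with step[of v l] l_pos show "v(l := - v l) \<in> root_vecs" by simp
  qed
qed

lemma root_psum_sign:
  assumes "phi b \<in> root_set"
  shows "(\<forall>t\<in>{1..l}. 0 \<le> psum b t) \<or> (\<forall>t\<in>{1..l}. psum b t \<le> 0)"
proof -
  obtain c :: "nat \<Rightarrow> nat" where "phi b = (\<lambda>x. \<Sum>i=1..l. of_nat (c i) * \<alpha> i x) \<or>
      phi b = (\<lambda>x. - (\<Sum>i=1..l. of_nat (c i) * \<alpha> i x))"
    using assms simple unfolding simple_system_def by blast
  then show ?thesis
  proof
    assume eq: "phi b = (\<lambda>x. \<Sum>i=1..l. of_nat (c i) * \<alpha> i x)"
    have "(\<Sum>t=1..l. complex_of_int (psum b t) * \<alpha> t x) = (\<Sum>t=1..l. of_int (int (c t)) * \<alpha> t x)" for x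
      using fun_cong[OF eq, of x] by (simp add: phi_def)
    from simple_independent_int[OF this] have "psum b t = int (c t)" if "t \<in> {1..l}" for t
      using that by blast
    then show ?thesis by simp
  next
    assume eq: "phi b = (\<lambda>x. - (\<Sum>i=1..l. of_nat (c i) * \<alpha> i x))"
    have "(\<Sum>t=1..l. complex_of_int (psum b t) * \<alpha> t x) = (\<Sum>t=1..l. of_int (- int (c t)) * \<alpha> t x)" for x
      using fun_cong[OF eq, of x] by (simp add: phi_def sum_negf)
    from simple_independent_int[OF this] have "psum b t = - int (c t)" if "t \<in> {1..l}" for t
      using that by blast
    then show ?thesis by simp
  qed
qed

lemma simple_multiple_not_root:
  assumes j: "j \<in> {1..l}" and p: "2 \<le> p"
  shows "phi (\<lambda>k. p * simple_vec j k) \<notin> root_set"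
proof
  assume root: "phi (\<lambda>k. p * simple_vec j k) \<in> root_set"
  obtain e f where tr: "sl2_triple (\<alpha> j) e f (coroot j)" using simple_sl2_triple[OF j] by blast
  have "phi (\<lambda>k. p * simple_vec j k) = (\<lambda>x. of_nat (nat p) * \<alpha> j x)"
    using p by (simp add: fun_eq_iff phi_mult phi_simple_vec[OF j])
  with root have "wt (\<lambda>x. of_nat (nat p) * \<alpha> j x) \<noteq> {0}" unfolding roots_def by simp
  moreover have "wt (\<lambda>x. of_nat (nat p) * \<alpha> j x) \<subseteq> {0}"
    using multiple_wt_zero[OF tr, of "nat p"] p by auto
  ultimately show False using wt_zero by blast
qed

lemma simple_vec_root_vecs: "j \<in> {1..l} \<Longrightarrow> simple_vec j \<in> root_vecs"
proof -
  assume j: "j \<in> {1..l}"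
  then have "phi (simple_vec j) \<in> root_set" by (simp add: phi_simple_vec simple_roots)
  moreover have "simple_vec j k = 0" if "k \<notin> {1..l}" for k
    using that j by (auto simp: simple_vec_def unit_vec_def)
  ultimately show ?thesis unfolding root_vecs_def by blast
qed

text \<open>The set of root vectors is closed under signed permutations by the reflection automorphisms, it has
  partial sums of constant sign by the definition of a simple system, and it contains the simple roots but
  not their multiples by any \<open>p \<ge> 2\<close>.  This determines it.\<close>

lemma root_vecs_eq: "root_vecs = B_roots l"
proof
  have l: "l \<in> {1..l}" using l_pos by simp
  have short: "simple_vec l = unit_vec l" and
    long: "simple_vec 1 = unit_vec 1 - unit_vec 2" if "2 \<le> l"
    using that by (auto simp: simple_vec_def numeral_2_eq_2 One_nat_def)
  show "root_vecs \<subseteq> B_roots l"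
  proof (rule signed_perm_closed_subset_B_roots[OF signed_perm_closed_root_vecs])
    have "phi 0 = 0" using phi_diff[of 0 0] by simp
    then show "0 \<notin> root_vecs" by (simp add: root_vecs_def roots_def)
  next
    fix p :: int assume "2 \<le> p"
    then show "(\<lambda>k. p * unit_vec l k) \<notin> root_vecs"
      using simple_multiple_not_root[OF l] by (auto simp: root_vecs_def simple_vec_def)
  next
    fix p :: int assume "2 \<le> p" "2 \<le> l"
    then show "(\<lambda>k. p * (unit_vec 1 - unit_vec 2) k) \<notin> root_vecs"
      using simple_multiple_not_root[of 1 p] long by (auto simp: root_vecs_def)
  qed (use root_psum_sign in \<open>auto simp: root_vecs_def\<close>)
  show "B_roots l \<subseteq> root_vecs"
  proof (rule B_roots_subset_signed_perm_closed[OF signed_perm_closed_root_vecs])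
    show "unit_vec l \<in> root_vecs" using simple_vec_root_vecs[OF l] by (simp add: simple_vec_def)
    show "unit_vec 1 - unit_vec 2 \<in> root_vecs" if "2 \<le> l"
      using simple_vec_root_vecs[of 1] long[OF that] that by simp
  qed
qed

lemma B_roots_support: "b \<in> B_roots l \<Longrightarrow> k \<notin> {1..l} \<Longrightarrow> b k = 0"
  unfolding root_vecs_eq[symmetric] root_vecs_def by blast

lemma phi_inj_on: "inj_on phi {b. \<forall>k. k \<notin> {1..l} \<longrightarrow> b k = 0}"
proof (rule inj_onI)
  fix b c assume bc: "b \<in> {b. \<forall>k. k \<notin> {1..l} \<longrightarrow> b k = 0}" "c \<in> {b. \<forall>k. k \<notin> {1..l} \<longrightarrow> b k = 0}"
    and "phi b = phi c"
  then have "psum b t = psum c t" if "t \<in> {1..l}" for t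
    using that by (simp add: phi_eq_iff)
  then have "b k = c k" if "k \<in> {1..l}" for k
    using psum_inj that by blast
  moreover have "b k = c k" if "k \<notin> {1..l}" for k
    using bc that by simp
  ultimately show "b = c" by (intro ext) blast
qed

lemma combination_phi:
  fixes c :: "nat \<Rightarrow> int"
  shows "\<exists>b. (\<forall>k. k \<notin> {1..l} \<longrightarrow> b k = 0) \<and> (\<forall>t\<in>{1..l}. psum b t = c t) \<and>
    phi b = (\<lambda>x. \<Sum>i=1..l. of_int (c i) * \<alpha> i x)"
proof -
  \<comment> \<open>The vector of differences; the value of \<open>c\<close> at 0 is arbitrary and replaced by 0.\<close>
  define d where "d k = (if k = 0 then 0 else c k)" for k
  define b where "b k = (if k \<in> {1..l} then d k - d (k - 1) else 0)" for k
  have "psum b t = d t" if "t \<le> l" for t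
    using that by (induction t) (auto simp: b_def d_def One_nat_def)
  then have "\<forall>t\<in>{1..l}. psum b t = c t" by (auto simp: d_def)
  then show ?thesis
    by (intro exI[of _ b]) (auto simp: phi_def b_def intro!: sum.cong)
qed

lemma roots_eq: "root_set = phi ` B_roots l"
proof
  show "phi ` B_roots l \<subseteq> root_set" unfolding root_vecs_eq[symmetric] root_vecs_def by blast
  show "root_set \<subseteq> phi ` B_roots l"
  proof
    fix \<beta> assume \<beta>: "\<beta> \<in> root_set"
    then obtain c :: "nat \<Rightarrow> nat" where "\<beta> = (\<lambda>x. \<Sum>i=1..l. of_nat (c i) * \<alpha> i x) \<or>
        \<beta> = (\<lambda>x. - (\<Sum>i=1..l. of_nat (c i) * \<alpha> i x))"
      using simple unfolding simple_system_def by blast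
    then have "\<exists>d :: nat \<Rightarrow> int. \<beta> = (\<lambda>x. \<Sum>i=1..l. of_int (d i) * \<alpha> i x)"
    proof
      assume "\<beta> = (\<lambda>x. \<Sum>i=1..l. of_nat (c i) * \<alpha> i x)"
      then show ?thesis by (intro exI[of _ "\<lambda>i. int (c i)"]) simp
    next
      assume "\<beta> = (\<lambda>x. - (\<Sum>i=1..l. of_nat (c i) * \<alpha> i x))"
      then show ?thesis by (intro exI[of _ "\<lambda>i. - int (c i)"]) (simp add: sum_negf)
    qed
    then obtain d :: "nat \<Rightarrow> int" where d: "\<beta> = (\<lambda>x. \<Sum>i=1..l. of_int (d i) * \<alpha> i x)" by blast
    obtain b where "\<forall>k. k \<notin> {1..l} \<longrightarrow> b k = 0" "phi b = \<beta>"
      using combination_phi[of d] unfolding d by blast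
    then have "b \<in> root_vecs" using \<beta> unfolding root_vecs_def by blast
    then show "\<beta> \<in> phi ` B_roots l" using \<open>phi b = \<beta>\<close> unfolding root_vecs_eq by blast
  qed
qed

lemma wt_br_phi:
  assumes "x \<in> wt (phi b)" "y \<in> wt (phi c)"
  shows "br x y \<in> wt (phi (b + c))"
proof -
  have "phi (b + c) = (\<lambda>t. phi b t + phi c t)" by (simp add: phi_add fun_eq_iff)
  then show ?thesis using wt_br[OF assms] by simp
qed

lemma simple_wt:
  assumes "j \<in> {1..l}"
  shows "x \<in> wt (\<alpha> j) \<Longrightarrow> x \<in> wt (phi (simple_vec j))"
    and "x \<in> wt (- \<alpha> j) \<Longrightarrow> x \<in> wt (phi (- simple_vec j))"
  by (simp_all add: phi_simple_vec[OF assms] phi_uminus)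

lemma phi_root_iff:
  assumes "\<And>k. k \<notin> {1..l} \<Longrightarrow> b k = 0"
  shows "phi b \<in> root_set \<longleftrightarrow> b \<in> B_roots l"
  using assms unfolding root_vecs_eq[symmetric] root_vecs_def by blast

lemma B_pos_psum_positive:
  assumes "b \<in> B_pos l"
  shows "\<exists>t\<in>{1..l}. 0 < psum b t"
  using assms
proof (cases rule: B_pos_cases)
  case (diff i j)
  then show ?thesis by (intro bexI[of _ i]) auto
qed (use l_pos in \<open>auto intro!: bexI[of _ l]\<close>)

lemma positive_roots_eq: "positive_roots scale br H l \<alpha> = phi ` B_pos l"
proof
  show "positive_roots scale br H l \<alpha> \<subseteq> phi ` B_pos l"
  proof
    fix \<beta> assume "\<beta> \<in> positive_roots scale br H l \<alpha>"
    then obtain c :: "nat \<Rightarrow> nat" where root: "\<beta> \<in> root_set" and c: "\<beta> = (\<lambda>x. \<Sum>i=1..l. of_nat (c i) * \<alpha> i x)"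
      unfolding positive_roots_def by blast
    from root obtain b where b: "b \<in> B_roots l" "\<beta> = phi b" unfolding roots_eq by blast
    obtain b' where "phi b' = \<beta>" "\<forall>t\<in>{1..l}. psum b' t = int (c t)"
      using combination_phi[of "\<lambda>i. int (c i)"] c by auto
    then have nonneg: "0 \<le> psum b t" if "t \<in> {1..l}" for t
      using that b(2) phi_eq_iff[of b b'] by simp
    have "b \<in> B_pos l"
    proof (rule ccontr)
      assume "b \<notin> B_pos l"
      then obtain d where d: "d \<in> B_pos l" "b = - d" using b(1) unfolding B_roots_def by blast
      then show False using nonneg B_pos_psum_positive[OF d(1)] by force
    qed
    then show "\<beta> \<in> phi ` B_pos l" using b(2) by blast
  qed
  show "phi ` B_pos l \<subseteq> positive_roots scale br H l \<alpha>"
  proof (rule image_subsetI)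
    fix b assume b: "b \<in> B_pos l"
    have "phi b = (\<lambda>x. \<Sum>i=1..l. of_nat (nat (psum b i)) * \<alpha> i x)"
      unfolding phi_def using psum_B_pos_nonneg[OF b] by simp
    moreover have "phi b \<in> root_set" unfolding roots_eq B_roots_def using b by blast
    ultimately show "phi b \<in> positive_roots scale br H l \<alpha>"
      unfolding positive_roots_def by (intro CollectI conjI exI[of _ "\<lambda>i. nat (psum b i)"])
  qed
qed

lemma roots_gen_eq:
  assumes J: "J \<subseteq> {1..l}"
  shows "roots_gen scale br H (\<alpha> ` J) = phi ` levi_roots l J"
proof
  have inj: "inj_on \<alpha> J" using simple_inj J by (rule inj_on_subset)
  have fin: "finite J" using J finite_subset by blast
  show "roots_gen scale br H (\<alpha> ` J) \<subseteq> phi ` levi_roots l J"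
  proof
    fix \<beta> assume "\<beta> \<in> roots_gen scale br H (\<alpha> ` J)"
    then obtain c :: "('g \<Rightarrow> complex) \<Rightarrow> int" where root: "\<beta> \<in> root_set"
      and c: "\<beta> = (\<lambda>x. \<Sum>\<gamma>\<in>\<alpha> ` J. of_int (c \<gamma>) * \<gamma> x)"
      unfolding roots_gen_def by blast
    from root obtain b where b: "b \<in> B_roots l" "\<beta> = phi b" unfolding roots_eq by blast
    have "(\<Sum>t=1..l. complex_of_int (psum b t) * \<alpha> t x) =
        (\<Sum>t=1..l. of_int (if t \<in> J then c (\<alpha> t) else 0) * \<alpha> t x)" for x
    proof -
      have "(\<Sum>t=1..l. complex_of_int (psum b t) * \<alpha> t x) = (\<Sum>t\<in>J. of_int (c (\<alpha> t)) * \<alpha> t x)"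
        using fun_cong[OF b(2), of x] c by (simp add: phi_def sum.reindex[OF inj])
      also have "\<dots> = (\<Sum>t=1..l. of_int (if t \<in> J then c (\<alpha> t) else 0) * \<alpha> t x)"
        using J by (intro sum.mono_neutral_cong_left) auto
      finally show ?thesis .
    qed
    from simple_independent_int[OF this] have "psum b t = (if t \<in> J then c (\<alpha> t) else 0)" if "t \<in> {1..l}" for t
      using that by blast
    then have "b \<in> levi_roots l J" using b(1) unfolding levi_roots_def by auto
    then show "\<beta> \<in> phi ` levi_roots l J" using b(2) by blast
  qed
  show "phi ` levi_roots l J \<subseteq> roots_gen scale br H (\<alpha> ` J)"
  proof (rule image_subsetI)
    fix b assume b: "b \<in> levi_roots l J"
    then have root: "phi b \<in> root_set" unfolding roots_eq levi_roots_def by blast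
    define c where "c \<gamma> = psum b (the_inv_into J \<alpha> \<gamma>)" for \<gamma>
    have "phi b x = (\<Sum>\<gamma>\<in>\<alpha> ` J. of_int (c \<gamma>) * \<gamma> x)" for x
    proof -
      have "phi b x = (\<Sum>t\<in>J. of_int (psum b t) * \<alpha> t x)"
        unfolding phi_def using J b by (intro sum.mono_neutral_right) (auto simp: levi_roots_def)
      also have "\<dots> = (\<Sum>\<gamma>\<in>\<alpha> ` J. of_int (c \<gamma>) * \<gamma> x)"
        by (simp add: sum.reindex[OF inj] c_def the_inv_into_f_f[OF inj])
      finally show ?thesis .
    qed
    then have "phi b = (\<lambda>x. \<Sum>\<gamma>\<in>\<alpha> ` J. of_int (c \<gamma>) * \<gamma> x)" by blast
    with root show "phi b \<in> roots_gen scale br H (\<alpha> ` J)" unfolding roots_gen_def by blast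
  qed
qed

subsection \<open>Root spaces with nonzero bracket\<close>

text \<open>A nonzero coefficient makes the functional nonzero, and among the nonzero functionals only the roots have
  nontrivial root spaces.\<close>

lemma nonroot_wt_zero:
  assumes "phi b \<notin> root_set" "t \<in> {1..l}" "psum b t \<noteq> 0" "x \<in> wt (phi b)"
  shows "x = 0"
proof (rule ccontr)
  assume "x \<noteq> 0"
  have "phi 0 = 0" using phi_diff[of 0 0] by simp
  moreover have "phi b \<noteq> phi 0" unfolding phi_eq_iff using assms(2,3) by (force simp: psum_def)
  ultimately have "phi b \<noteq> 0" by simp
  from rootsI[OF phi_dual this assms(4) \<open>x \<noteq> 0\<close>] assms(1) show False by blast
qed

lemma mixed_sign_wt_zero:
  assumes "s \<in> {1..l}" "t \<in> {1..l}" "psum b s < 0" "0 < psum b t" "x \<in> wt (phi b)"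
  shows "x = 0"
  using root_psum_sign[of b] assms by (intro nonroot_wt_zero[OF _ assms(1) _ assms(5)]) force+

lemma wt_nonzero_vector:
  assumes "b \<in> B_roots l"
  obtains x where "x \<in> wt (phi b)" "x \<noteq> 0"
proof -
  have "phi b \<in> root_set" using assms unfolding roots_eq by blast
  then have "wt (phi b) \<noteq> {0}" unfolding roots_def by blast
  then show thesis using that wt_zero by blast
qed

abbreviation noncommuting_vecs :: "(nat \<Rightarrow> int) \<Rightarrow> (nat \<Rightarrow> int) \<Rightarrow> bool" where
  "noncommuting_vecs b c \<equiv> noncommuting (phi b) (phi c)"

lemma signed_perm_closed_noncommuting:
  "signed_perm_closed l {v. noncommuting_vecs (fst \<circ> v) (snd \<circ> v)}"
proof -
  have step: "noncommuting_vecs (if j = l then b(l := - b l) else b \<circ> transpose j (Suc j))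
      (if j = l then c(l := - c l) else c \<circ> transpose j (Suc j))"
    if bc: "noncommuting_vecs b c" and j: "j \<in> {1..l}" for b c j
  proof -
    obtain e f where "sl2_triple (\<alpha> j) e f (coroot j)" using simple_sl2_triple[OF j] by blast
    from reflection_noncommuting[OF this phi_dual phi_dual bc] show ?thesis
      unfolding phi_reflect[OF j] .
  qed
  show ?thesis
    unfolding signed_perm_closed_def
  proof (intro conjI ballI allI impI; clarsimp)
    fix v :: "nat \<Rightarrow> int \<times> int" and i
    assume "noncommuting_vecs (fst \<circ> v) (snd \<circ> v)" "1 \<le> i" "i < l"
    then show "noncommuting_vecs (fst \<circ> (v \<circ> transpose i (Suc i))) (snd \<circ> (v \<circ> transpose i (Suc i)))"
      using step[of "fst \<circ> v" "snd \<circ> v" i] by (simp add: comp_assoc)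
  next
    fix v :: "nat \<Rightarrow> int \<times> int"
    assume "noncommuting_vecs (fst \<circ> v) (snd \<circ> v)"
    moreover have "fst \<circ> v(l := - v l) = (fst \<circ> v)(l := - (fst \<circ> v) l)"
      "snd \<circ> v(l := - v l) = (snd \<circ> v)(l := - (snd \<circ> v) l)" by auto
    ultimately show "noncommuting_vecs (fst \<circ> v(l := - v l)) (snd \<circ> v(l := - v l))"
      using step[of "fst \<circ> v" "snd \<circ> v" l] l_pos by simp
  qed
qed

lemma noncommuting_permute:
  assumes "noncommuting_vecs b c" "\<pi> permutes {1..l}"
  shows "noncommuting_vecs (b \<circ> \<pi>) (c \<circ> \<pi>)"
  using signed_perm_closed_permutes[OF signed_perm_closed_noncommuting _ assms(2), of "\<lambda>k. (b k, c k)"]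
    assms(1) by (simp add: comp_def)

lemma noncommuting_negate:
  assumes "noncommuting_vecs b c" "i \<in> {1..l}"
  shows "noncommuting_vecs (b(i := - b i)) (c(i := - c i))"
proof -
  let ?v = "\<lambda>k. (b k, c k)"
  have "fst \<circ> ?v(i := - ?v i) = b(i := - b i)" "snd \<circ> ?v(i := - ?v i) = c(i := - c i)" by auto
  then show ?thesis
    using signed_perm_closed_negate[OF signed_perm_closed_noncommuting _ assms(2), of ?v] assms(1)
    by (simp add: comp_def)
qed

text \<open>By signed permutations it is enough to treat one pair, \<open>\<epsilon>\<^sub>l = \<alpha>\<^sub>l\<close> and \<open>\<epsilon>\<^sub>l\<^sub>-\<^sub>1 = \<alpha>\<^sub>l\<^sub>-\<^sub>1 + \<alpha>\<^sub>l\<close>.  A root vector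
  of \<open>\<alpha>\<^sub>l\<^sub>-\<^sub>1\<close> is killed by \<open>f\<^sub>l\<close> and has weight \<open>- 2\<close>, so it can be raised twice by \<open>e\<^sub>l\<close>.\<close>

lemma noncommuting_short:
  assumes ij: "i \<in> {1..l}" "j \<in> {1..l}" "i \<noteq> j"
  shows "noncommuting_vecs (unit_vec i) (unit_vec j)"
proof -
  define k where "k = l - 1"
  have k: "1 \<le> k" "l = Suc k" "k \<in> {1..l}" "l \<in> {1..l}" using ij by (auto simp: k_def)
  then have kl: "k \<noteq> l" by simp
  obtain e f where tr: "sl2_triple (\<alpha> l) e f (coroot l)" using simple_sl2_triple[OF k(4)] by blast
  note t = sl2_tripleD[OF tr]
  obtain z where z: "z \<in> wt (phi (simple_vec k))" "z \<noteq> 0"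
    using wt_nonzero_vector[of "simple_vec k"] simple_vec_root_vecs[OF k(3)] root_vecs_eq by blast
  have "br f z \<in> wt (phi (- simple_vec l + simple_vec k))"
    by (rule wt_br_phi[OF simple_wt(2)[OF k(4) t(3)] z(1)])
  then have "br f z = 0"
    by (rule mixed_sign_wt_zero[OF k(4,3), rotated 2]) (use kl in \<open>simp_all add: psum_simple_vec[OF k(3,3)] psum_simple_vec[OF k(3,4)]
      psum_simple_vec[OF k(4,3)] psum_simple_vec[OF k(4,4)]\<close>)
  moreover have "phi (simple_vec k) (coroot l) = - 2"
    unfolding phi_coroot[OF k(4)] using kl k(2)[symmetric] by (simp add: simple_vec_def unit_vec_def)
  ultimately have "br e (br e z) \<noteq> 0" by (intro sl2_raise_twice_nonzero[OF tr z]) simp_all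
  moreover have "br e z \<in> wt (phi (unit_vec k))"
  proof -
    have "simple_vec l + simple_vec k = unit_vec k" using kl k(2)[symmetric] by (simp add: simple_vec_def)
    moreover have "br e z \<in> wt (phi (simple_vec l + simple_vec k))"
      by (rule wt_br_phi[OF simple_wt(1)[OF k(4) t(2)] z(1)])
    ultimately show ?thesis by simp
  qed
  moreover have "e \<in> wt (phi (unit_vec l))"
    using t(2) phi_simple_vec[OF k(4)] by (simp add: simple_vec_def)
  ultimately have base: "noncommuting_vecs (unit_vec l) (unit_vec k)"
    unfolding noncommuting_def by blast
  obtain \<pi> where \<pi>: "\<pi> permutes {1..l}" "\<pi> i = l" "\<pi> j = k"
    using permutation_two[of i j "{1..l}" l k] ij k by auto
  from noncommuting_permute[OF base \<pi>(1)] show ?thesis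
    by (simp add: unit_vec_permute[OF \<pi>(1,2)] unit_vec_permute[OF \<pi>(1,3)])
qed

text \<open>By signed permutations the claim reduces to \<open>\<alpha>\<^sub>1\<close> and \<open>\<alpha>\<^sub>2\<close>, where the root vector of \<open>\<alpha>\<^sub>2\<close> is killed by
  \<open>f\<^sub>1\<close> and has nonzero weight.\<close>

lemma noncommuting_hook:
  assumes ij: "i \<in> {2..l}" "j \<in> {2..l}" "i \<noteq> j"
  shows "noncommuting_vecs (unit_vec 1 - unit_vec j) (unit_vec j + unit_vec i)"
proof -
  have l: "3 \<le> l" using ij by auto
  then have rng: "1 \<in> {1..l}" "2 \<in> {1..l}" by auto
  have sv: "simple_vec 1 = unit_vec 1 - unit_vec 2" "simple_vec 2 = unit_vec 2 - unit_vec 3"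
    using l by (simp_all add: simple_vec_def eval_nat_numeral One_nat_def)
  obtain e f where tr: "sl2_triple (\<alpha> 1) e f (coroot 1)" using simple_sl2_triple[OF rng(1)] by blast
  note t = sl2_tripleD[OF tr]
  obtain x where x: "x \<in> wt (phi (simple_vec 2))" "x \<noteq> 0"
    using wt_nonzero_vector[of "simple_vec 2"] simple_vec_root_vecs[OF rng(2)] root_vecs_eq by blast
  have "br f x \<in> wt (phi (- simple_vec 1 + simple_vec 2))"
    by (rule wt_br_phi[OF simple_wt(2)[OF rng(1) t(3)] x(1)])
  then have "br f x = 0"
    by (rule mixed_sign_wt_zero[OF rng, rotated 2]) (simp_all add: psum_simple_vec[OF rng(1,1)]
      psum_simple_vec[OF rng(1,2)] psum_simple_vec[OF rng(2,1)] psum_simple_vec[OF rng(2,2)])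
  moreover have "phi (simple_vec 2) (coroot 1) \<noteq> 0"
    unfolding phi_coroot[OF rng(1)] using l by (simp add: sv unit_vec_def One_nat_def)
  ultimately have "br e x \<noteq> 0" by (intro sl2_raise_nonzero[OF tr x]) simp_all
  moreover have "e \<in> wt (phi (simple_vec 1))" using t(2) phi_simple_vec[OF rng(1)] by simp
  ultimately have base: "noncommuting_vecs (unit_vec 1 - unit_vec 2) (unit_vec 2 - unit_vec 3)"
    using x(1) unfolding noncommuting_def sv by blast
  \<comment> \<open>Changing the sign of the third coordinate turns \<open>\<epsilon>\<^sub>2 - \<epsilon>\<^sub>3\<close> into \<open>\<epsilon>\<^sub>2 + \<epsilon>\<^sub>3\<close>.\<close>
  have neg: "(unit_vec 1 - unit_vec 2)(3 := - (unit_vec 1 - unit_vec 2) 3) = unit_vec 1 - unit_vec 2"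
    "(unit_vec 2 - unit_vec 3)(3 := - (unit_vec 2 - unit_vec 3) 3) = unit_vec 2 + unit_vec 3"
    by (auto simp: fun_eq_iff unit_vec_def)
  have base': "noncommuting_vecs (unit_vec 1 - unit_vec 2) (unit_vec 2 + unit_vec 3)"
    using noncommuting_negate[OF base, of 3] l unfolding neg by simp
  obtain \<pi> where \<pi>: "\<pi> permutes {1..l}" "\<pi> 1 = 1" "\<pi> j = 2" "\<pi> i = 3"
    using permutation_three[of 1 j i "{1..l}" 1 2 3] ij l by auto
  have "(unit_vec 1 - unit_vec 2) \<circ> \<pi> = unit_vec 1 - unit_vec j"
    "(unit_vec 2 + unit_vec 3) \<circ> \<pi> = unit_vec j + unit_vec i"
    using unit_vec_permute[OF \<pi>(1,2)] unit_vec_permute[OF \<pi>(1,3)] unit_vec_permute[OF \<pi>(1,4)]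
    by (simp_all add: fun_eq_iff)
  with noncommuting_permute[OF base' \<pi>(1)] show ?thesis by simp
qed

lemma commuting_vecs:
  assumes "b \<in> B_pos l" "c \<in> B_pos l" "b + c \<notin> B_pos l"
  shows "\<not> noncommuting_vecs b c"
proof
  assume "noncommuting_vecs b c"
  then obtain x y where xy: "x \<in> wt (phi b)" "y \<in> wt (phi c)" "br x y \<noteq> 0"
    unfolding noncommuting_def by blast
  have br: "br x y \<in> wt (phi (b + c))" by (rule wt_br_phi[OF xy(1,2)])
  obtain t where t: "t \<in> {1..l}" "0 < psum b t" using B_pos_psum_positive[OF assms(1)] by blast
  have pos: "0 < psum (b + c) t" using t psum_B_pos_nonneg[OF assms(2), of t] by simp
  have "phi (b + c) \<notin> root_set"
  proof
    assume "phi (b + c) \<in> root_set"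
    moreover have bc: "b \<in> B_roots l" "c \<in> B_roots l" using assms unfolding B_roots_def by blast+
    moreover from bc have "(b + c) k = 0" if "k \<notin> {1..l}" for k
      using B_roots_support[of b k] B_roots_support[of c k] that by simp
    ultimately have "b + c \<in> B_roots l" using phi_root_iff[of "b + c"] by blast
    then obtain d where "d \<in> B_pos l" "b + c = - d" using assms(3) unfolding B_roots_def by blast
    then show False using pos psum_B_pos_nonneg[of d l t] by simp
  qed
  from nonroot_wt_zero[OF this t(1) _ br] pos xy(3) show False by simp
qed

lemma B_ideal_count: "J \<subseteq> {1..l} \<Longrightarrow> B_ideal_count l J (\<lambda>b c. \<not> noncommuting_vecs b c)"
  using l_pos commuting_vecs noncommuting_short noncommuting_hook by unfold_locales auto

lemma lie_abelian_ideal_of: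
  "lie_abelian br (ideal_of scale br H \<Phi>) \<longleftrightarrow> (\<forall>\<beta>\<in>\<Phi>. \<forall>\<gamma>\<in>\<Phi>. \<not> noncommuting \<beta> \<gamma>)"
proof
  assume ab: "lie_abelian br (ideal_of scale br H \<Phi>)"
  have "wt \<beta> \<subseteq> ideal_of scale br H \<Phi>" if "\<beta> \<in> \<Phi>" for \<beta>
    unfolding ideal_of_def using that by (blast intro: span_base)
  with ab show "\<forall>\<beta>\<in>\<Phi>. \<forall>\<gamma>\<in>\<Phi>. \<not> noncommuting \<beta> \<gamma>"
    unfolding lie_abelian_def noncommuting_def by blast
next
  assume nc: "\<forall>\<beta>\<in>\<Phi>. \<forall>\<gamma>\<in>\<Phi>. \<not> noncommuting \<beta> \<gamma>"
  let ?U = "\<Union>\<beta>\<in>\<Phi>. wt \<beta>"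
  have base: "br x y = 0" if "x \<in> ?U" "y \<in> ?U" for x y
    using nc that unfolding noncommuting_def by blast
  have right: "br x y = 0" if "x \<in> ?U" "y \<in> span ?U" for x y
  proof -
    have "y \<in> {y. br x y = 0}"
      using that(2)
    proof (rule span_subspace_induct)
      show "subspace {y. br x y = 0}" by (rule subspaceI) (simp_all add: br_add_right br_scale_right)
    qed (use base that(1) in blast)
    then show ?thesis by simp
  qed
  have "br x y = 0" if "x \<in> span ?U" "y \<in> span ?U" for x y
  proof -
    have "x \<in> {x. br x y = 0}"
      using that(1)
    proof (rule span_subspace_induct)
      show "subspace {x. br x y = 0}" by (rule subspaceI) (simp_all add: br_add_left br_scale_left)
    qed (use right that(2) in blast)
    then show ?thesis by simp
  qed
  then show "lie_abelian br (ideal_of scale br H \<Phi>)"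
    unfolding lie_abelian_def ideal_of_def by blast
qed

text \<open>The coordinate map is additive, and injective on vectors supported in \<open>{1..l}\<close>.  So it carries the
  condition on sums of roots over to vectors and back.\<close>

lemma F_I_ab_eq:
  assumes J: "J \<subseteq> {1..l}"
  shows "F_I_ab scale br H l \<alpha> (\<alpha> ` J) =
    (image phi) ` B_ideal_count.ab_ideals l J (\<lambda>b c. \<not> noncommuting_vecs b c)"
proof -
  interpret B_ideal_count l J "\<lambda>b c. \<not> noncommuting_vecs b c" by (rule B_ideal_count[OF J])
  have supp: "b k = 0" if "b \<in> B_pos l \<union> levi_roots l J" "k \<notin> {1..l}" for b k
    using that B_roots_support[of b k] unfolding B_roots_def levi_roots_def by blast
  have phi_mem: "phi b \<in> phi ` A \<longleftrightarrow> b \<in> A"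
    if "A \<subseteq> B_pos l \<union> levi_roots l J" "\<And>k. k \<notin> {1..l} \<Longrightarrow> b k = 0" for b A
    using that supp by (intro inj_on_image_mem_iff[OF phi_inj_on]) blast+
  have iff: "phi ` \<Psi> \<in> F_I_ab scale br H l \<alpha> (\<alpha> ` J) \<longleftrightarrow> \<Psi> \<in> ab_ideals" if \<Psi>: "\<Psi> \<subseteq> B_pos l" for \<Psi>
  proof -
    have mem_par: "phi ` \<Psi> \<subseteq> phi ` B_pos l - phi ` levi_roots l J \<longleftrightarrow> \<Psi> \<subseteq> B_pos l - levi_roots l J"
    proof -
      have "phi b \<in> phi ` levi_roots l J \<longleftrightarrow> b \<in> levi_roots l J" if "b \<in> \<Psi>" for b
        using that \<Psi> supp by (intro phi_mem) blast+
      then have "(\<forall>b\<in>\<Psi>. phi b \<notin> phi ` levi_roots l J) \<longleftrightarrow> (\<forall>b\<in>\<Psi>. b \<notin> levi_roots l J)"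
        by (intro ball_cong refl) simp
      moreover have "phi ` \<Psi> \<subseteq> phi ` B_pos l" using \<Psi> by (rule image_mono)
      then have "phi ` \<Psi> \<subseteq> phi ` B_pos l - phi ` levi_roots l J \<longleftrightarrow>
          (\<forall>b\<in>\<Psi>. phi b \<notin> phi ` levi_roots l J)"
        unfolding subset_iff ball_simps(9)[symmetric] by auto
      moreover have "\<Psi> \<subseteq> B_pos l - levi_roots l J \<longleftrightarrow> (\<forall>b\<in>\<Psi>. b \<notin> levi_roots l J)"
        using \<Psi> by blast
      ultimately show ?thesis by (simp only:)
    qed
    have sums: "phi b + phi c \<in> phi ` A \<longleftrightarrow> b + c \<in> A"
      if "b \<in> B_pos l" "c \<in> B_pos l \<union> levi_roots l J" "A \<subseteq> B_pos l" for b c A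
    proof -
      have "phi (b + c) \<in> phi ` A \<longleftrightarrow> b + c \<in> A"
        using that supp[of b] supp[of c] by (intro phi_mem) auto
      then show ?thesis by (simp add: phi_add)
    qed
    have "(\<forall>\<beta>\<in>phi ` \<Psi>. \<forall>\<gamma>\<in>phi ` B_pos l \<union> phi ` levi_roots l J.
          \<beta> + \<gamma> \<in> phi ` B_pos l \<longrightarrow> \<beta> + \<gamma> \<in> phi ` \<Psi>) \<longleftrightarrow>
        (\<forall>\<beta>\<in>\<Psi>. \<forall>\<gamma>\<in>B_pos l \<union> levi_roots l J. \<beta> + \<gamma> \<in> B_pos l \<longrightarrow> \<beta> + \<gamma> \<in> \<Psi>)"
      unfolding image_Un[symmetric] ball_simps using \<Psi>
      by (intro ball_cong refl) (simp add: sums subset_iff)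
    then show ?thesis
      unfolding F_I_ab_def F_I_def positive_roots_eq roots_gen_eq[OF J] ab_ideals_def par_ideals_def
        lie_abelian_ideal_of mem_Collect_eq mem_par by blast
  qed
  show ?thesis
  proof (intro equalityI subsetI)
    fix \<Phi> assume \<Phi>: "\<Phi> \<in> F_I_ab scale br H l \<alpha> (\<alpha> ` J)"
    then have "\<Phi> \<subseteq> phi ` B_pos l" unfolding F_I_ab_def F_I_def positive_roots_eq by blast
    then obtain \<Psi> where \<Psi>: "\<Psi> \<subseteq> B_pos l" "\<Phi> = phi ` \<Psi>" unfolding subset_image_iff by blast
    then have "\<Psi> \<in> ab_ideals" using iff[OF \<Psi>(1)] \<Phi> by simp
    then show "\<Phi> \<in> (image phi) ` ab_ideals" using \<Psi>(2) by (rule rev_image_eqI)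
  next
    fix \<Phi> assume "\<Phi> \<in> (image phi) ` ab_ideals"
    then obtain \<Psi> where \<Psi>: "\<Psi> \<in> ab_ideals" "\<Phi> = phi ` \<Psi>" by blast
    then have "\<Psi> \<subseteq> B_pos l" unfolding ab_ideals_def par_ideals_def by blast
    from iff[OF this] \<Psi> show "\<Phi> \<in> F_I_ab scale br H l \<alpha> (\<alpha> ` J)" by simp
  qed
qed

lemma card_F_I_ab:
  assumes J: "J \<subseteq> {1..l}"
  shows "card (F_I_ab scale br H l \<alpha> (\<alpha> ` J)) = (if 1 \<in> J then 1 else 2) * card (block_ideals l J)"
proof -
  interpret B_ideal_count l J "\<lambda>b c. \<not> noncommuting_vecs b c" by (rule B_ideal_count[OF J])
  have "inj_on phi (B_pos l)"
    by (rule inj_on_subset[OF phi_inj_on]) (use B_roots_support in \<open>auto simp: B_roots_def\<close>)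
  then have "inj_on (image phi) (Pow (B_pos l))" by (rule inj_on_image_Pow)
  then have "inj_on (image phi) ab_ideals"
    by (rule inj_on_subset) (auto simp: ab_ideals_def par_ideals_def)
  then show ?thesis unfolding F_I_ab_eq[OF J] card_image card_ab_ideals by (simp add: card_image card_ab_ideals)
qed

end

section \<open>Connected components as blocks\<close>

lemma block_eq_minus_count:
  assumes "1 \<le> i" "J \<subseteq> {1..l}"
  shows "block J i = i - card {t \<in> J. t < i}"
proof -
  have "{1..<i} = ({1..<i} - J) \<union> {t \<in> J. t < i}" using assms by auto
  then have "card {1..<i} = card (({1..<i} - J) \<union> {t \<in> J. t < i})" by simp
  also have "\<dots> = card ({1..<i} - J) + card {t \<in> J. t < i}"
    using assms(2) by (intro card_Un_disjoint) (auto intro: finite_subset)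
  finally show ?thesis using assms(1) by (simp add: block_def)
qed

lemma block_less_imp_less: "block J i < block J j \<Longrightarrow> i < j"
  using block_mono[of j i J] by (meson leD not_le_imp_less)

lemma inner_blocks_without_last:
  assumes "J \<subseteq> {1..l}" "l \<notin> J"
  shows "inner_blocks l J = block J ` J"
proof -
  have "block J i \<le> num_blocks l J" if "i \<in> J" for i
  proof -
    have i: "1 \<le> i" "i \<le> l" using that assms(1) by auto
    then have "l \<in> {i..l}" by simp
    then have "\<not> {i..l} \<subseteq> J" using assms(2) by blast
    then show ?thesis using block_le_num_blocks_iff i by blast
  qed
  then show ?thesis unfolding inner_blocks_def by blast
qed

lemma inner_blocks_with_last:
  assumes "J \<subseteq> {1..l}" "l \<in> J"
  shows "inner_blocks l J = block J ` J - {block J l}"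
proof -
  have "block J i \<le> num_blocks l J \<longleftrightarrow> block J i \<noteq> block J l" if "i \<in> J" for i
  proof -
    have i: "1 \<le> i" "i \<le> l" using that assms(1) by auto
    have "{i..l} = insert l {i..<l}" using i by auto
    then have "{i..l} \<subseteq> J \<longleftrightarrow> {i..<l} \<subseteq> J" using assms(2) by simp
    also have "\<dots> \<longleftrightarrow> block J l \<le> block J i" using block_le_iff[OF i(1)] by blast
    also have "\<dots> \<longleftrightarrow> block J i = block J l" using block_mono[OF i(2), of J] by linarith
    finally show ?thesis using block_le_num_blocks_iff[OF i(1), of J l] by blast
  qed
  then show ?thesis unfolding inner_blocks_def by auto
qed

text \<open>The sets \<open>X j\<close> are the nonempty traces of the blocks on \<open>J\<close>, numbered by increasing minima.  Everything
  before the minimum of \<open>X j\<close> lies in \<open>J\<close>, hence in an earlier \<open>X k\<close>, or is a cut; so subtracting the sizes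
  of the earlier sets leaves one more than the number of cuts, which is the block number.  The block that
  is not closed by a cut exists iff \<open>l \<in> J\<close>, and then it is the last one.\<close>

lemma numbered_blocks:
  fixes X :: "nat \<Rightarrow> nat set"
  assumes J: "J \<subseteq> {1..l}"
    and X: "\<And>j. j \<in> {1..s} \<Longrightarrow> \<exists>i\<in>J. X j = {z \<in> J. block J z = block J i}"
    and cover: "\<And>i. i \<in> J \<Longrightarrow> \<exists>j\<in>{1..s}. i \<in> X j"
    and mono: "strict_mono_on {1..s} (\<lambda>j. Min (X j))"
  shows "j \<in> {1..s} \<Longrightarrow> Min (X j) - (\<Sum>k=1..j-1. card (X k)) = block J (Min (X j))"
    and "inj_on (\<lambda>j. block J (Min (X j))) {1..s}"
    and "(\<lambda>j. block J (Min (X j))) ` {1..(if l \<in> J then s - 1 else s)} = inner_blocks l J"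
proof -
  let ?m = "\<lambda>j. Min (X j)"
  have finJ: "finite J" using J finite_subset by blast
  have Xm: "X j = {z \<in> J. block J z = block J (?m j)}" and mJ: "?m j \<in> J" if j: "j \<in> {1..s}" for j
  proof -
    obtain i where i: "i \<in> J" "X j = {z \<in> J. block J z = block J i}" using X[OF j] by blast
    then have "?m j \<in> X j" using finJ by (intro Min_in) auto
    then show "?m j \<in> J" "X j = {z \<in> J. block J z = block J (?m j)}" using i by auto
  qed
  have XD: "t \<in> J" "block J t = block J (?m j)" if "j \<in> {1..s}" "t \<in> X j" for j t
    using arg_cong[OF Xm[OF that(1)], of "\<lambda>S. t \<in> S"] that(2) by simp_all
  have finX: "finite (X j)" if "j \<in> {1..s}" for j
    using X[OF that] finJ by auto
  have m_less: "?m j < ?m k" if "j \<in> {1..s}" "k \<in> {1..s}" "j < k" for j k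
    using strict_mono_onD[OF mono that] .
  have block_less: "block J (?m j) < block J (?m k)" if jk: "j \<in> {1..s}" "k \<in> {1..s}" "j < k" for j k
  proof -
    have "X j \<noteq> X k" using m_less[OF jk] by auto
    then have "block J (?m j) \<noteq> block J (?m k)" using Xm[OF jk(1)] Xm[OF jk(2)] by auto
    moreover have "block J (?m j) \<le> block J (?m k)" using m_less[OF jk] by (intro block_mono) simp
    ultimately show ?thesis by simp
  qed
  show inj: "inj_on (\<lambda>j. block J (?m j)) {1..s}"
  proof (rule inj_onI)
    fix j k assume jk: "j \<in> {1..s}" "k \<in> {1..s}" "block J (?m j) = block J (?m k)"
    then show "j = k"
      using block_less[OF jk(1,2)] block_less[OF jk(2,1)] by (cases j k rule: linorder_cases) simp_all
  qed
  have image: "(\<lambda>j. block J (?m j)) ` {1..s} = block J ` J"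
  proof (intro equalityI subsetI)
    fix a assume "a \<in> block J ` J"
    then obtain i where i: "i \<in> J" "a = block J i" by blast
    then obtain j where j: "j \<in> {1..s}" "i \<in> X j" using cover by blast
    then have "block J i = block J (?m j)" using XD by blast
    then show "a \<in> (\<lambda>j. block J (?m j)) ` {1..s}" using i j by blast
  qed (use mJ in blast)
  show "?m j - (\<Sum>k=1..j-1. card (X k)) = block J (?m j)" if j: "j \<in> {1..s}"
  proof -
    have sub: "k \<in> {1..s}" "k < j" if "k \<in> {1..j-1}" for k using that j by auto
    have "(\<Sum>k=1..j-1. card (X k)) = card (\<Union>k\<in>{1..j-1}. X k)"
    proof (rule card_UN_disjoint[symmetric])
      show "\<forall>k\<in>{1..j-1}. finite (X k)" using finX sub by blast
      show "\<forall>k\<in>{1..j-1}. \<forall>k'\<in>{1..j-1}. k \<noteq> k' \<longrightarrow> X k \<inter> X k' = {}"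
      proof (intro ballI impI)
        fix k k' assume kk: "k \<in> {1..j-1}" "k' \<in> {1..j-1}" "k \<noteq> k'"
        then have "block J (?m k) \<noteq> block J (?m k')" using inj sub by (meson inj_onD)
        then show "X k \<inter> X k' = {}"
          using XD(2)[OF sub(1)[OF kk(1)]] XD(2)[OF sub(1)[OF kk(2)]] by (metis disjoint_iff)
      qed
    qed simp
    also have "(\<Union>k\<in>{1..j-1}. X k) = {t \<in> J. t < ?m j}"
    proof (intro equalityI subsetI)
      fix t assume "t \<in> (\<Union>k\<in>{1..j-1}. X k)"
      then obtain k where k: "k \<in> {1..j-1}" "t \<in> X k" by blast
      then have t: "t \<in> J" "block J t = block J (?m k)" using XD sub(1)[OF k(1)] by blast+
      then have "block J t < block J (?m j)" using block_less[OF sub(1)[OF k(1)] j sub(2)[OF k(1)]] by simp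
      then show "t \<in> {t \<in> J. t < ?m j}" using t block_less_imp_less by blast
    next
      fix t assume t: "t \<in> {t \<in> J. t < ?m j}"
      then obtain k where k: "k \<in> {1..s}" "t \<in> X k" using cover by blast
      have "?m k \<le> t" using finX[OF k(1)] k(2) by simp
      then have "?m k < ?m j" using t by simp
      then have "k < j" using m_less[OF j k(1)] by (metis linorder_neqE_nat order_less_asym order_less_irrefl)
      then have "k \<in> {1..j-1}" using k(1) by auto
      then show "t \<in> (\<Union>k\<in>{1..j-1}. X k)" using k(2) by blast
    qed
    finally show ?thesis using block_eq_minus_count[OF _ J, of "?m j"] mJ[OF j] J by auto
  qed
  show "(\<lambda>j. block J (?m j)) ` {1..(if l \<in> J then s - 1 else s)} = inner_blocks l J"
  proof (cases "l \<in> J")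
    case False
    then show ?thesis using image inner_blocks_without_last[OF J] by simp
  next
    case True
    then obtain j where j: "j \<in> {1..s}" "block J (?m j) = block J l" using image by (metis (no_types, lifting) image_iff)
    then have s: "s \<in> {1..s}" by simp
    \<comment> \<open>The uncut block is the largest one, so it comes last in the numbering.\<close>
    have "j = s"
    proof (rule ccontr)
      assume "j \<noteq> s"
      then have "block J l < block J (?m s)" using block_less[OF j(1) s] j by auto
      then have "l < ?m s" by (rule block_less_imp_less)
      then show False using mJ[OF s] J by auto
    qed
    have "{1..s - 1} = {1..s} - {s}" using s by auto
    then have "(\<lambda>j. block J (?m j)) ` {1..s - 1} = (\<lambda>j. block J (?m j)) ` {1..s} - (\<lambda>j. block J (?m j)) ` {s}"
      using inj_on_image_set_diff[OF inj, of "{1..s}" "{s}"] s by simp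
    also have "\<dots> = block J ` J - {block J l}" using image j(2) \<open>j = s\<close> by simp
    also have "\<dots> = inner_blocks l J" using inner_blocks_with_last[OF J True] by simp
    finally show ?thesis using True by simp
  qed
qed

context type_B_lie
begin

lemma dynkin_edge_iff:
  assumes J: "J \<subseteq> {1..l}" and "i \<in> J" "j \<in> J"
  shows "(\<alpha> i, \<alpha> j) \<in> dynkin_edges scale br H (\<alpha> ` J) \<longleftrightarrow> j = Suc i \<or> i = Suc j"
proof -
  have ij: "i \<in> {1..l}" "j \<in> {1..l}" using assms by auto
  have "(\<exists>h. is_coroot scale br H (\<alpha> j) h \<and> \<alpha> i h \<noteq> 0) \<longleftrightarrow> \<alpha> i (coroot j) \<noteq> 0"
    using coroot(1)[OF ij(2)] coroot_unique[OF simple_dual[OF ij(2)]] by blast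
  moreover have "\<alpha> i = \<alpha> j \<longleftrightarrow> i = j" using inj_on_eq_iff[OF simple_inj ij] .
  ultimately show ?thesis
    using assms by (auto simp: dynkin_edges_def coroot(2)[OF ij(2,1)] cartan_matrix_B_def)
qed

text \<open>Edges of the subdiagram join consecutive indices of \<open>J\<close>, which are in the same block; conversely the
  indices between two elements of \<open>J\<close> in the same block all belong to \<open>J\<close>.\<close>

lemma dynkin_component_eq:
  assumes J: "J \<subseteq> {1..l}" and x: "x \<in> J"
  shows "(dynkin_edges scale br H (\<alpha> ` J))\<^sup>* `` {\<alpha> x} = \<alpha> ` {z \<in> J. block J z = block J x}"
    (is "?E\<^sup>* `` _ = _")
proof (intro equalityI subsetI)
  fix \<gamma> assume "\<gamma> \<in> ?E\<^sup>* `` {\<alpha> x}"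
  then have "(\<alpha> x, \<gamma>) \<in> ?E\<^sup>*" by simp
  then show "\<gamma> \<in> \<alpha> ` {z \<in> J. block J z = block J x}"
  proof (induction rule: rtrancl_induct)
    case base
    then show ?case using x by simp
  next
    case (step \<beta> \<gamma>)
    then obtain z where z: "z \<in> J" "block J z = block J x" "\<beta> = \<alpha> z" by blast
    obtain w where w: "w \<in> J" "\<gamma> = \<alpha> w" using step(2) unfolding dynkin_edges_def by blast
    have "w = Suc z \<or> z = Suc w" using step(2) dynkin_edge_iff[OF J z(1) w(1)] z(3) w(2) by blast
    then have "block J w = block J z"
      using block_Suc[of z J] block_Suc[of w J] z(1) w(1) J by auto
    then have "w \<in> {z \<in> J. block J z = block J x}" using z w by simp
    then show ?case using w(2) by (rule rev_image_eqI)
  qed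
next
  have path: "(\<alpha> a, \<alpha> b) \<in> ?E\<^sup>* \<and> (\<alpha> b, \<alpha> a) \<in> ?E\<^sup>*" if "a \<le> b" "{a..b} \<subseteq> J" for a b
    using that
  proof (induction b rule: dec_induct)
    case (step b)
    then have "b \<in> J" "Suc b \<in> J" by auto
    then have "(\<alpha> b, \<alpha> (Suc b)) \<in> ?E" "(\<alpha> (Suc b), \<alpha> b) \<in> ?E" using dynkin_edge_iff[OF J] by blast+
    moreover have "{a..b} \<subseteq> J" using step.prems by auto
    ultimately show ?case using step.IH
      by (meson converse_rtrancl_into_rtrancl rtrancl.rtrancl_into_rtrancl)
  qed simp
  fix \<gamma> assume "\<gamma> \<in> \<alpha> ` {z \<in> J. block J z = block J x}"
  then obtain z where z: "z \<in> J" "block J z = block J x" "\<gamma> = \<alpha> z" by blast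
  have interval: "{a..b} \<subseteq> J" if "a \<in> J" "b \<in> J" "a \<le> b" "block J a = block J b" for a b
  proof -
    have "1 \<le> a" using J that by auto
    then have "{a..<b} \<subseteq> J" using block_le_iff[of a J b] that by simp
    moreover have "{a..b} = insert b {a..<b}" using that(3) by auto
    ultimately show ?thesis using that(2) by simp
  qed
  have "(\<alpha> x, \<alpha> z) \<in> ?E\<^sup>*"
    using path[of x z] path[of z x] interval[of x z] interval[of z x] x z by (cases "x \<le> z") simp_all
  then show "\<gamma> \<in> ?E\<^sup>* `` {\<alpha> x}" using z by simp
qed

lemma dynkin_components_eq:
  assumes J: "J \<subseteq> {1..l}"
  shows "dynkin_components scale br H (\<alpha> ` J) = (\<lambda>i. \<alpha> ` {z \<in> J. block J z = block J i}) ` J"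
proof -
  have "dynkin_components scale br H (\<alpha> ` J) =
      (\<lambda>\<beta>. (dynkin_edges scale br H (\<alpha> ` J))\<^sup>* `` {\<beta>}) ` \<alpha> ` J"
    unfolding dynkin_components_def quotient_def by blast
  then show ?thesis using dynkin_component_eq[OF J] by (simp add: image_image)
qed

end

theorem proposition5p18:
  fixes scale :: "complex \<Rightarrow> 'g::ab_group_add \<Rightarrow> 'g"
    and br :: "'g \<Rightarrow> 'g \<Rightarrow> 'g"
    and H :: "'g set"
    and l r s n :: nat
    and \<alpha> :: "nat \<Rightarrow> 'g \<Rightarrow> complex"
    and I :: "('g \<Rightarrow> complex) set"
    and C :: "nat \<Rightarrow> ('g \<Rightarrow> complex) set"
    and m lj :: "nat \<Rightarrow> nat"
  assumes "complex_simple_lie_algebra scale br"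
    and "cartan_subalgebra scale br H"
    and "l \<ge> 1"
    and "simple_system scale br H l \<alpha>"
    and "type_B scale br H l \<alpha>"
    and "I \<subseteq> \<alpha> ` {1..l}"
    and "r = card I"
    and "bij_betw C {1..s} (dynkin_components scale br H I)"
    and "\<And>j. j \<in> {1..s} \<Longrightarrow> m j = Min {i \<in> {1..l}. \<alpha> i \<in> C j}"
    and "strict_mono_on {1..s} m"
    and "\<And>j. j \<in> {1..s} \<Longrightarrow> lj j = m j - (\<Sum>k=1..j-1. card (C k))"
    and "n = (if \<alpha> l \<in> I then s - 1 else s)"
  shows "card (F_I_ab scale br H l \<alpha> I) =
    (if \<alpha> 1 \<notin> I
     then 2 ^ (l - r) + (\<Sum>j=1..n. 2 * ((l - r - 1) choose (lj j - 1)))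
     else 2 ^ (l - r - 1) + (\<Sum>j=1..n. (l - r - 1) choose (lj j - 1)))"
proof -
  interpret type_B_lie scale br H l \<alpha>
    using assms(1-5) unfolding type_B_lie_def simple_lie_with_cartan_def
      simple_lie_with_cartan_axioms_def type_B_lie_axioms_def by blast
  define J where "J = {i \<in> {1..l}. \<alpha> i \<in> I}"
  have J: "J \<subseteq> {1..l}" and I: "I = \<alpha> ` J" using assms(6) unfolding J_def by blast+
  have inj: "inj_on \<alpha> J" using simple_inj J by (rule inj_on_subset)
  have mem: "\<alpha> i \<in> I \<longleftrightarrow> i \<in> J" if "i \<in> {1..l}" for i using that by (simp add: J_def)
  have blocks: "num_blocks l J = l - r"
    using card_Diff_subset[of J "{1..l}"] J finite_subset[OF J]
    by (simp add: assms(7) I card_image[OF inj])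
  define X where "X j = {i \<in> {1..l}. \<alpha> i \<in> C j}" for j
  have comp: "C ` {1..s} = (\<lambda>i. \<alpha> ` {z \<in> J. block J z = block J i}) ` J"
    using assms(8) unfolding bij_betw_def I dynkin_components_eq[OF J] by blast
  have pull: "{i \<in> {1..l}. \<alpha> i \<in> \<alpha> ` Z} = Z" if "Z \<subseteq> J" for Z
  proof -
    have "Z \<subseteq> {1..l}" using that J by (rule subset_trans)
    have "\<alpha> i \<in> \<alpha> ` Z \<longleftrightarrow> i \<in> Z" if "i \<in> {1..l}" for i
      by (rule inj_on_image_mem_iff[OF simple_inj that \<open>Z \<subseteq> {1..l}\<close>])
    then have "{i \<in> {1..l}. \<alpha> i \<in> \<alpha> ` Z} = {i \<in> {1..l}. i \<in> Z}"
      by (intro Collect_cong conj_cong refl)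
    then show ?thesis using \<open>Z \<subseteq> {1..l}\<close> by auto
  qed
  have X: "\<exists>i\<in>J. X j = {z \<in> J. block J z = block J i} \<and> card (C j) = card (X j)" if j: "j \<in> {1..s}" for j
  proof -
    have "C j \<in> (\<lambda>i. \<alpha> ` {z \<in> J. block J z = block J i}) ` J"
      unfolding comp[symmetric] using j by (rule imageI)
    then obtain i where i: "i \<in> J" "C j = \<alpha> ` {z \<in> J. block J z = block J i}" by (rule imageE)
    have "X j = {i' \<in> {1..l}. \<alpha> i' \<in> \<alpha> ` {z \<in> J. block J z = block J i}}"
      unfolding X_def i(2) ..
    also have "\<dots> = {z \<in> J. block J z = block J i}" by (rule pull) blast
    finally have "X j = {z \<in> J. block J z = block J i}" .
    moreover have "card (C j) = card {z \<in> J. block J z = block J i}"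
      unfolding i(2) by (rule card_image) (rule inj_on_subset[OF inj], blast)
    ultimately show ?thesis using i(1) by (intro bexI[of _ i]) simp_all
  qed
  have cover: "\<exists>j\<in>{1..s}. i \<in> X j" if i: "i \<in> J" for i
  proof -
    have "\<alpha> ` {z \<in> J. block J z = block J i} \<in> C ` {1..s}"
      unfolding comp using i by (rule imageI)
    then obtain j where j: "j \<in> {1..s}" "\<alpha> ` {z \<in> J. block J z = block J i} = C j" by (rule imageE)
    then have "i \<in> X j" using i J unfolding X_def j(2)[symmetric] by auto
    with j(1) show ?thesis by blast
  qed
  have m: "m j = Min (X j)" if "j \<in> {1..s}" for j using assms(9)[OF that] by (simp add: X_def)
  have mono: "strict_mono_on {1..s} (\<lambda>j. Min (X j))"
  proof (rule strict_mono_onI)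
    fix j k assume jk: "j \<in> {1..s}" "k \<in> {1..s}" "j < k"
    then show "Min (X j) < Min (X k)" using strict_mono_onD[OF assms(10) jk] by (simp only: m)
  qed
  have X': "\<exists>i\<in>J. X j = {z \<in> J. block J z = block J i}" if "j \<in> {1..s}" for j using X[OF that] by blast
  have index: "Min (X j) - (\<Sum>k=1..j-1. card (X k)) = block J (Min (X j))" if "j \<in> {1..s}" for j
    using J X' cover mono that by (rule numbered_blocks(1))
  have index_inj: "inj_on (\<lambda>j. block J (Min (X j))) {1..s}"
    using J X' cover mono by (rule numbered_blocks(2))
  have index_image: "(\<lambda>j. block J (Min (X j))) ` {1..(if l \<in> J then s - 1 else s)} = inner_blocks l J"
    using J X' cover mono by (rule numbered_blocks(3))
  have n: "n = (if l \<in> J then s - 1 else s)" using assms(12) mem[of l] l_pos by simp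
  then have n_le: "{1..n} \<subseteq> {1..s}" by auto
  have lj: "lj j = block J (Min (X j))" if j: "j \<in> {1..s}" for j
  proof -
    have "(\<Sum>k=1..j-1. card (C k)) = (\<Sum>k=1..j-1. card (X k))"
      using X j by (intro sum.cong refl) force
    then show ?thesis using index[OF j] assms(11)[OF j] m[OF j] by simp
  qed
  have sum: "(\<Sum>x\<in>inner_blocks l J. (l - r - 1) choose (x - 1)) = (\<Sum>j=1..n. (l - r - 1) choose (lj j - 1))"
  proof -
    have "inner_blocks l J = (\<lambda>j. block J (Min (X j))) ` {1..n}" using index_image n by simp
    moreover have "inj_on (\<lambda>j. block J (Min (X j))) {1..n}" using index_inj n_le by (rule inj_on_subset)
    ultimately have "(\<Sum>x\<in>inner_blocks l J. (l - r - 1) choose (x - 1)) =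
        (\<Sum>j=1..n. (l - r - 1) choose (block J (Min (X j)) - 1))"
      by (simp add: sum.reindex)
    also have "\<dots> = (\<Sum>j=1..n. (l - r - 1) choose (lj j - 1))"
      using lj n_le by (intro sum.cong refl) (simp add: subset_iff)
    finally show ?thesis .
  qed
  have count: "card (block_ideals l J) = 2 ^ (l - r - 1) + (\<Sum>j=1..n. (l - r - 1) choose (lj j - 1))"
    unfolding card_block_ideals[OF J] blocks sum ..
  show ?thesis
  proof (cases "1 \<in> J")
    case True
    then show ?thesis using card_F_I_ab[OF J] count mem[of 1] l_pos by (simp add: I[symmetric])
  next
    case False
    then have "1 \<in> {1..l} - J" using l_pos by simp
    then have "num_blocks l J \<noteq> 0" by auto
    then obtain q where q: "l - r = Suc q" unfolding blocks using not0_implies_Suc by blast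
    have "card (F_I_ab scale br H l \<alpha> I) = 2 * card (block_ideals l J)"
      using card_F_I_ab[OF J] False by (simp add: I[symmetric])
    also have "\<dots> = 2 ^ (l - r) + (\<Sum>j=1..n. 2 * ((l - r - 1) choose (lj j - 1)))"
      unfolding count by (simp add: q sum_distrib_left)
    finally show ?thesis using False mem[of 1] l_pos by simp
  qed
qed

end
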